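(* Let $(M_1,F_1)$ and $(M_2,F_2)$ be Finsler manifolds, let $f:M_1\to\mathbb{R}$ be a smooth nowhere vanishing function, and let $(M,F)$ be the warped product Finsler manifold $M=M_1\times M_2$, $F=\sqrt{F_1^2+f^2F_2^2}$. Let $I\!M=\{(\mathbf{x},\mathbf{y})\in TM^0 : F(\mathbf{x},\mathbf{y})=1\}$ be its indicatrix bundle, and let $\varphi$, $\eta^*$, $\xi^*$, $\bar G$ be respectively the $(1,1)$-tensor field, 1-form, vector field and Riemannian metric on $I\!M$ defined in the context. Then $I\!M$ with $(\varphi,\eta^*,\xi^*,\bar G)$ is a contact manifold (in the sense of the contact structure defined in the context).
   Context: Contact structure: on a $(2k+1)$-dimensional Riemannian manifold $(N,g)$ it is a triple $(\varphi,\eta,\xi)$, with $\varphi$ a $(1,1)$-tensor field, $\eta$ a global 1-form and $\xi$ a vector field, such that $\varphi(\xi)=0$, $\eta\circ\varphi=0$, $\eta(\xi)=1$, $\varphi^2=-\mathrm{Id}+\eta\otimes\xi$, $g(\varphi X,\varphi Y)=g(X,Y)-\eta(X)\eta(Y)$ and $d\eta(X,Y)=g(X,\varphi Y)$ for all vector fields $X,Y$ on $N$. Setting: $\dim M_1=n$, $\dim M_2=m$, with local coordinates $(x^i,y^i)$ on $TM_1$ and $(u^\alpha,v^\alpha)$ on $TM_2$ ($i,j,\dots=1,\dots,n$; $\alpha,\beta,\dots=1,\dots,m$). $TM^0:=TM_1^0\oplus TM_2^0$ (nonzero tangent vectors in each factor); $F$ is defined on $TM^0$. Write $\mathbf{x}=(x,u)$,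 $\mathbf{y}=(y,v)$, and $g_{ij}=\frac12\frac{\partial^2F_1^2}{\partial y^i\partial y^j}$, $g_{\alpha\beta}=\frac12\frac{\partial^2F_2^2}{\partial v^\alpha\partial v^\beta}$ with inverses $g^{ij}$, $g^{\alpha\beta}$; the fundamental tensor of $F$ is block diagonal with blocks $g_{ij}$ and $f^2g_{\alpha\beta}$. Nonlinear connection: let $G^i=\frac14 g^{ih}\big(\frac{\partial^2F_1^2}{\partial y^h\partial x^j}y^j-\frac{\partial F_1^2}{\partial x^h}\big)$ be the semi-spray coefficients of $F_1$ and $G^\alpha$ those of $F_2$ (defined analogously). Those of $F$ are $$B^i=G^i-\tfrac14 g^{ij}F_2^2\frac{\partial f^2}{\partial x^j},\qquad B^\alpha=G^\alpha+\tfrac1{4f^2}g^{\alpha\beta}\frac{\partial F_2^2}{\partial v^\beta}\frac{\partial f^2}{\partial x^i}y^i.$$ Put $B^i_j=\frac{\partial B^i}{\partial y^j}$, $B^\alpha_j=\frac{\partial B^\alpha}{\partial y^j}$, $B^i_\beta=\frac{\partial B^i}{\partial v^\beta}$, $B^\alpha_\beta=\frac{\partial B^\alpha}{\partial v^\beta}$, and $$\tfrac{\delta^*}{\delta^*x^i}=\tfrac{\partial}{\partial x^i}-B_i^j\tfrac{\partial}{\partial y^j}-B_i^\alpha\tfrac{\partial}{\partial v^\alpha},\quad \tfrac{\delta^*}{\delta^*u^\alpha}=\tfrac{\partial}{\partial u^\alpha}-B_\alpha^\beta\tfrac{\partial}{\partial v^\beta}-B_\alpha^i\tfrac{\partial}{\partial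 y^i},$$ $$\delta^*y^i=dy^i+B^i_jdx^j+B^i_\alpha du^\alpha,\quad \delta^*v^\alpha=dv^\alpha+B^\alpha_\beta du^\beta+B^\alpha_idx^i.$$ Sasaki-type metric on $TM^0$: $G=g_{ij}dx^idx^j+f^2g_{\alpha\beta}du^\alpha du^\beta+g_{ij}\delta^*y^i\delta^*y^j+f^2g_{\alpha\beta}\delta^*v^\alpha\delta^*v^\beta$. Almost complex structure on $TM^0$: $J\frac{\partial}{\partial y^i}=\frac{\delta^*}{\delta^*x^i}$, $J\frac{\delta^*}{\delta^*x^i}=-\frac{\partial}{\partial y^i}$, $J\frac{\partial}{\partial v^\alpha}=\frac{\delta^*}{\delta^*u^\alpha}$, $J\frac{\delta^*}{\delta^*u^\alpha}=-\frac{\partial}{\partial v^\alpha}$. On $I\!M$: $\bar G$ is the restriction of $G$; $\xi^*=y^i\frac{\delta^*}{\delta^*x^i}+v^\alpha\frac{\delta^*}{\delta^*u^\alpha}$; $\eta^*=y^ig_{ij}dx^j+f^2v^\alpha g_{\alpha\beta}du^\beta$. With $\eta=dF$, let $D=\{X : \eta(X)=\eta^*(X)=0\}$ (a distribution tangent to $I\!M$, where vectors $X$ are tangent to $TM^0$ at points of $I\!M$). Then $\varphi$ is defined by $\varphi=J|_D$ and $\varphi(\xi^* )=0$.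
   Formalization: The exterior derivative is taken with the opposite of the usual sign, dη(X,Y) = Yη(X) − Xη(Y) + η([X,Y]); with the usual d the condition dη*(X,Y) = Ḡ(X,φY) fails by a sign, already for two flat lines with f = 1. *)

theory Defs
  imports "HOL-Analysis.Analysis"
begin

section \<open>Smooth maps between Euclidean spaces\<close>

text \<open>Only used for open \<open>S\<close>; \<open>smooth_on\<close> is of class \<open>C\<close>-infinity.\<close>

primrec Ck_on :: "nat \<Rightarrow> 'a::euclidean_space set \<Rightarrow> ('a \<Rightarrow> 'b::real_normed_vector) \<Rightarrow> bool" where
  "Ck_on 0 S f \<longleftrightarrow> continuous_on S f"
| "Ck_on (Suc k) S f \<longleftrightarrow>
     (\<forall>x\<in>S. f differentiable (at x)) \<and> (\<forall>w. Ck_on k S (\<lambda>x. frechet_derivative f (at x) w))"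

definition smooth_on :: "'a::euclidean_space set \<Rightarrow> ('a \<Rightarrow> 'b::real_normed_vector) \<Rightarrow> bool" where
  "smooth_on S f \<longleftrightarrow> (\<forall>k. Ck_on k S f)"

section \<open>Manifolds\<close>

text \<open>
  A chart is a pair of its domain and its coordinate map. The values of the coordinate map outside
  the domain are irrelevant. The topology of a manifold is the one generated by its atlas.
\<close>

type_synonym ('p, 'e) chart = "'p set \<times> ('p \<Rightarrow> 'e)"
type_synonym ('p, 'e) atlas = "('p, 'e) chart set"

definition chart_inv :: "('p, 'e) chart \<Rightarrow> 'e \<Rightarrow> 'p" where
  "chart_inv c = inv_into (fst c) (snd c)"

definition chart_image :: "('p, 'e) chart \<Rightarrow> 'e set" where
  "chart_image c = snd c ` fst c"

definition carrier_of :: "('p, 'e) atlas \<Rightarrow> 'p set" where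
  "carrier_of A = (\<Union>c\<in>A. fst c)"

definition atlas_topology :: "('p, 'e::euclidean_space) atlas \<Rightarrow> 'p topology" where
  "atlas_topology A =
     topology (\<lambda>W. W \<subseteq> carrier_of A \<and> (\<forall>c\<in>A. open (snd c ` (W \<inter> fst c))))"

definition smooth_atlas :: "('p, 'e::euclidean_space) atlas \<Rightarrow> bool" where
  "smooth_atlas A \<longleftrightarrow>
     (\<forall>c\<in>A. inj_on (snd c) (fst c) \<and> open (chart_image c)) \<and>
     (\<forall>c\<in>A. \<forall>d\<in>A. open (snd c ` (fst c \<inter> fst d)) \<and>
        smooth_on (snd c ` (fst c \<inter> fst d)) (snd d \<circ> chart_inv c))"

definition smooth_manifold :: "('p, 'e::euclidean_space) atlas \<Rightarrow> bool" where
  "smooth_manifold A \<longleftrightarrow>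
     smooth_atlas A \<and> Hausdorff_space (atlas_topology A) \<and> second_countable (atlas_topology A)"

text \<open>Some chart of \<open>A\<close> around \<open>p\<close>.\<close>

definition chart_at :: "('p, 'e) atlas \<Rightarrow> 'p \<Rightarrow> ('p, 'e) chart" where
  "chart_at A p = (SOME c. c \<in> A \<and> p \<in> fst c)"

definition smooth_function :: "('p, 'e::euclidean_space) atlas \<Rightarrow> ('p \<Rightarrow> real) \<Rightarrow> bool" where
  "smooth_function A h \<longleftrightarrow> (\<forall>c\<in>A. smooth_on (chart_image c) (h \<circ> chart_inv c))"

subsection \<open>Tangent vectors\<close>

text \<open>
  A tangent vector at \<open>p\<close> is the family of its components with respect to all charts around \<open>p\<close>,
  subject to the usual transformation law; it is \<open>0\<close> at all other arguments, so that a
  tangent vector is determined by any one of its components.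
\<close>

type_synonym ('p, 'e) tvec = "('p, 'e) chart \<Rightarrow> 'e"

definition tangent_space :: "('p, 'e::euclidean_space) atlas \<Rightarrow> 'p \<Rightarrow> ('p, 'e) tvec set" where
  "tangent_space A p =
     {X. (\<forall>c. \<not> (c \<in> A \<and> p \<in> fst c) \<longrightarrow> X c = 0) \<and>
         (\<forall>c\<in>A. \<forall>d\<in>A. p \<in> fst c \<and> p \<in> fst d \<longrightarrow>
            X d = frechet_derivative (snd d \<circ> chart_inv c) (at (snd c p)) (X c))}"

text \<open>The tangent vector at \<open>p\<close> with component \<open>w\<close> in the chart \<open>c\<close>.\<close>

definition tangent_vec ::
  "('p, 'e::euclidean_space) atlas \<Rightarrow> ('p, 'e) chart \<Rightarrow> 'p \<Rightarrow> 'e \<Rightarrow> ('p, 'e) tvec" where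
  "tangent_vec A c p w =
     (\<lambda>d. if d \<in> A \<and> p \<in> fst d
          then frechet_derivative (snd d \<circ> chart_inv c) (at (snd c p)) w else 0)"

definition tangent_map ::
  "('p, 'e::euclidean_space) atlas \<Rightarrow> ('q, 'd::euclidean_space) atlas \<Rightarrow> ('p \<Rightarrow> 'q) \<Rightarrow>
   'p \<Rightarrow> ('p, 'e) tvec \<Rightarrow> ('q, 'd) tvec" where
  "tangent_map A B h p X =
     (\<lambda>d. if d \<in> B \<and> h p \<in> fst d
          then let c = chart_at A p
               in frechet_derivative (snd d \<circ> h \<circ> chart_inv c) (at (snd c p)) (X c)
          else 0)"

definition differential ::
  "('p, 'e::euclidean_space) atlas \<Rightarrow> ('p \<Rightarrow> real) \<Rightarrow> 'p \<Rightarrow> ('p, 'e) tvec \<Rightarrow> real" where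
  "differential A h p X =
     (let c = chart_at A p in frechet_derivative (h \<circ> chart_inv c) (at (snd c p)) (X c))"

subsection \<open>Tensor fields\<close>

definition smooth_vector_field ::
  "('p, 'e::euclidean_space) atlas \<Rightarrow> ('p \<Rightarrow> ('p, 'e) tvec) \<Rightarrow> bool" where
  "smooth_vector_field A \<xi> \<longleftrightarrow>
     (\<forall>p\<in>carrier_of A. \<xi> p \<in> tangent_space A p) \<and>
     (\<forall>c\<in>A. smooth_on (chart_image c) (\<lambda>z. \<xi> (chart_inv c z) c))"

definition smooth_one_form ::
  "('p, 'e::euclidean_space) atlas \<Rightarrow> ('p \<Rightarrow> ('p, 'e) tvec \<Rightarrow> real) \<Rightarrow> bool" where
  "smooth_one_form A \<eta> \<longleftrightarrow>
     (\<forall>p\<in>carrier_of A. \<forall>X\<in>tangent_space A p. \<forall>Y\<in>tangent_space A p. \<forall>a b.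
        \<eta> p (\<lambda>c. a *\<^sub>R X c + b *\<^sub>R Y c) = a * \<eta> p X + b * \<eta> p Y) \<and>
     (\<forall>c\<in>A. \<forall>w. smooth_on (chart_image c)
        (\<lambda>z. \<eta> (chart_inv c z) (tangent_vec A c (chart_inv c z) w)))"

definition smooth_tensor_1_1 ::
  "('p, 'e::euclidean_space) atlas \<Rightarrow> ('p \<Rightarrow> ('p, 'e) tvec \<Rightarrow> ('p, 'e) tvec) \<Rightarrow> bool" where
  "smooth_tensor_1_1 A \<phi> \<longleftrightarrow>
     (\<forall>p\<in>carrier_of A. \<forall>X\<in>tangent_space A p. \<phi> p X \<in> tangent_space A p) \<and>
     (\<forall>p\<in>carrier_of A. \<forall>X\<in>tangent_space A p. \<forall>Y\<in>tangent_space A p. \<forall>a b.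
        \<phi> p (\<lambda>c. a *\<^sub>R X c + b *\<^sub>R Y c) = (\<lambda>c. a *\<^sub>R \<phi> p X c + b *\<^sub>R \<phi> p Y c)) \<and>
     (\<forall>c\<in>A. \<forall>w. smooth_on (chart_image c)
        (\<lambda>z. \<phi> (chart_inv c z) (tangent_vec A c (chart_inv c z) w) c))"

definition riemannian_metric ::
  "('p, 'e::euclidean_space) atlas \<Rightarrow> ('p \<Rightarrow> ('p, 'e) tvec \<Rightarrow> ('p, 'e) tvec \<Rightarrow> real) \<Rightarrow> bool" where
  "riemannian_metric A g \<longleftrightarrow>
     (\<forall>p\<in>carrier_of A. \<forall>X\<in>tangent_space A p. \<forall>Y\<in>tangent_space A p. g p X Y = g p Y X) \<and>
     (\<forall>p\<in>carrier_of A. \<forall>X\<in>tangent_space A p. \<forall>Y\<in>tangent_space A p. \<forall>Z\<in>tangent_space A p. \<forall>a b.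
        g p (\<lambda>c. a *\<^sub>R X c + b *\<^sub>R Y c) Z = a * g p X Z + b * g p Y Z) \<and>
     (\<forall>p\<in>carrier_of A. \<forall>X\<in>tangent_space A p. X \<noteq> (\<lambda>_. 0) \<longrightarrow> g p X X > 0) \<and>
     (\<forall>c\<in>A. \<forall>w w'. smooth_on (chart_image c)
        (\<lambda>z. g (chart_inv c z) (tangent_vec A c (chart_inv c z) w)
                                (tangent_vec A c (chart_inv c z) w')))"

text \<open>
  Exterior derivative of a 1-form, normalised without the factor 1/2 and with the differentiation
  index written last, i.e. \<open>d (\<eta>\<^sub>a dz\<^sup>a) = (\<partial>\<eta>\<^sub>a / \<partial>z\<^sup>b) dz\<^sup>a \<and> dz\<^sup>b\<close> (the exterior derivative
  acting from the right), which for vector fields reads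
  \<open>d\<eta>(X, Y) = Y(\<eta>(X)) - X(\<eta>(Y)) + \<eta>([X, Y])\<close>.
  On 1-forms this is the negative of the convention where \<open>d\<close> acts from the left.
  The choice matters: with \<open>d\<close> acting from the left, the almost complex structure, 1-form and metric
  defined below satisfy \<open>d\<eta>(X, Y) = - g(X, \<phi> Y)\<close>, as one already sees for two flat lines
  and \<open>f = 1\<close>; it is with the present convention that \<open>d\<eta>(X, Y) = g(X, \<phi> Y)\<close>.
\<close>

definition ext_deriv ::
  "('p, 'e::euclidean_space) atlas \<Rightarrow> ('p \<Rightarrow> ('p, 'e) tvec \<Rightarrow> real) \<Rightarrow>
   'p \<Rightarrow> ('p, 'e) tvec \<Rightarrow> ('p, 'e) tvec \<Rightarrow> real" where
  "ext_deriv A \<eta> p X Y =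
     (let c = chart_at A p;
          \<eta>c = (\<lambda>w z. \<eta> (chart_inv c z) (tangent_vec A c (chart_inv c z) w))
      in frechet_derivative (\<eta>c (X c)) (at (snd c p)) (Y c)
       - frechet_derivative (\<eta>c (Y c)) (at (snd c p)) (X c))"

definition contact_structure ::
  "('p, 'e::euclidean_space) atlas \<Rightarrow> ('p \<Rightarrow> ('p, 'e) tvec \<Rightarrow> ('p, 'e) tvec) \<Rightarrow>
   ('p \<Rightarrow> ('p, 'e) tvec \<Rightarrow> real) \<Rightarrow> ('p \<Rightarrow> ('p, 'e) tvec) \<Rightarrow>
   ('p \<Rightarrow> ('p, 'e) tvec \<Rightarrow> ('p, 'e) tvec \<Rightarrow> real) \<Rightarrow> bool" where
  "contact_structure A \<phi> \<eta> \<xi> g \<longleftrightarrow>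
     smooth_manifold A \<and> odd DIM('e) \<and> riemannian_metric A g \<and>
     smooth_tensor_1_1 A \<phi> \<and> smooth_one_form A \<eta> \<and> smooth_vector_field A \<xi> \<and>
     (\<forall>p\<in>carrier_of A.
        \<phi> p (\<xi> p) = (\<lambda>_. 0) \<and>
        \<eta> p (\<xi> p) = 1 \<and>
        (\<forall>X\<in>tangent_space A p.
           \<eta> p (\<phi> p X) = 0 \<and>
           \<phi> p (\<phi> p X) = (\<lambda>c. - X c + \<eta> p X *\<^sub>R \<xi> p c) \<and>
           (\<forall>Y\<in>tangent_space A p.
              g p (\<phi> p X) (\<phi> p Y) = g p X Y - \<eta> p X * \<eta> p Y \<and>
              ext_deriv A \<eta> p X Y = g p X (\<phi> p Y))))"

subsection \<open>Embedded submanifolds\<close>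

text \<open>
  The charts of a subset \<open>N\<close> of the manifold with atlas \<open>A\<close>, modelled on \<open>'e\<close>: the diffeomorphisms
  from relatively open subsets \<open>U\<close> of \<open>N\<close> onto open subsets of \<open>'e\<close>. As usual, a map on a subset of
  a manifold is smooth if locally it extends to a smooth map on an open set.
  \<open>N\<close> is an embedded submanifold of dimension \<open>DIM('e)\<close> iff these charts cover \<open>N\<close>.
\<close>

definition submanifold_atlas ::
  "('p, 'd::euclidean_space) atlas \<Rightarrow> 'p set \<Rightarrow> ('p, 'e::euclidean_space) atlas" where
  "submanifold_atlas A N =
     {(U, \<psi>). openin (subtopology (atlas_topology A) N) U \<and> inj_on \<psi> U \<and> open (\<psi> ` U) \<and>
        (\<forall>c\<in>A. \<forall>p\<in>U \<inter> fst c. \<exists>W h. open W \<and> snd c p \<in> W \<and> smooth_on W h \<and>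
            (\<forall>q\<in>U \<inter> fst c. snd c q \<in> W \<longrightarrow> h (snd c q) = \<psi> q)) \<and>
        (\<forall>c\<in>A. open (\<psi> ` (U \<inter> fst c)) \<and>
            smooth_on (\<psi> ` (U \<inter> fst c)) (snd c \<circ> inv_into U \<psi>))}"

section \<open>Finsler manifolds\<close>

definition partial :: "'n \<Rightarrow> (real^'n \<Rightarrow> real) \<Rightarrow> real^'n \<Rightarrow> real" where
  "partial i h x = frechet_derivative h (at x) (axis i 1)"

text \<open>
  In the following, \<open>F x y\<close> is a Finsler function in local coordinates \<open>x\<^sup>i, y\<^sup>i\<close>;
  \<open>fundamental_tensor F x y $ i $ j\<close> is \<open>g\<^sub>i\<^sub>j\<close> and \<open>spray F x y $ i\<close> is \<open>G\<^sup>i\<close>.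
\<close>

definition fundamental_tensor ::
  "(real^'n \<Rightarrow> real^'n \<Rightarrow> real) \<Rightarrow> real^'n \<Rightarrow> real^'n \<Rightarrow> real^'n^'n" where
  "fundamental_tensor F x y =
     (\<chi> i j. 1/2 * partial i (\<lambda>y. partial j (\<lambda>y. (F x y)\<^sup>2) y) y)"

definition spray :: "(real^'n \<Rightarrow> real^'n \<Rightarrow> real) \<Rightarrow> real^'n \<Rightarrow> real^'n \<Rightarrow> real^'n" where
  "spray F x y =
     (\<chi> i. 1/4 * (\<Sum>h\<in>UNIV. matrix_inv (fundamental_tensor F x y) $ i $ h *
        ((\<Sum>j\<in>UNIV. partial h (\<lambda>y. partial j (\<lambda>x. (F x y)\<^sup>2) x) y * y $ j)
          - partial h (\<lambda>x. (F x y)\<^sup>2) x)))"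

text \<open>The coordinate expression in the chart \<open>c\<close> of a function on the tangent bundle.\<close>

definition in_chart ::
  "('a, 'e::euclidean_space) atlas \<Rightarrow> ('a \<times> ('a, 'e) tvec \<Rightarrow> real) \<Rightarrow> ('a, 'e) chart \<Rightarrow>
   'e \<Rightarrow> 'e \<Rightarrow> real" where
  "in_chart A F c x y = F (chart_inv c x, tangent_vec A c (chart_inv c x) y)"

definition finsler_manifold ::
  "('a, real^'n) atlas \<Rightarrow> ('a \<times> ('a, real^'n) tvec \<Rightarrow> real) \<Rightarrow> bool" where
  "finsler_manifold A F \<longleftrightarrow>
     smooth_manifold A \<and>
     (\<forall>p\<in>carrier_of A. \<forall>y\<in>tangent_space A p.
        F (p, y) \<ge> 0 \<and> (y \<noteq> (\<lambda>_. 0) \<longrightarrow> F (p, y) > 0) \<and>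
        (\<forall>t>0. F (p, \<lambda>c. t *\<^sub>R y c) = t * F (p, y))) \<and>
     (\<forall>c\<in>A.
        smooth_on (chart_image c \<times> (- {0})) (\<lambda>(x, y). in_chart A F c x y) \<and>
        (\<forall>x\<in>chart_image c. \<forall>y. y \<noteq> 0 \<longrightarrow>
           (\<forall>w. w \<noteq> 0 \<longrightarrow> w \<bullet> (fundamental_tensor (in_chart A F c) x y *v w) > 0)))"

section \<open>Warped products in local coordinates\<close>

text \<open>
  A point of \<open>TM\<close> has coordinates \<open>((x, u), (y, v))\<close>. The same type of tuples is used for tangent
  vectors of \<open>TM\<close>: \<open>((a, b), (p, q))\<close> stands for
  \<open>a\<^sup>i \<partial>/\<partial>x\<^sup>i + b\<^sup>\<alpha> \<partial>/\<partial>u\<^sup>\<alpha> + p\<^sup>i \<partial>/\<partial>y\<^sup>i + q\<^sup>\<alpha> \<partial>/\<partial>v\<^sup>\<alpha>\<close>.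
\<close>

type_synonym ('n, 'm) tm = "((real^'n) \<times> (real^'m)) \<times> ((real^'n) \<times> (real^'m))"

locale warped_coordinates =
  fixes F1 :: "real^'n \<Rightarrow> real^'n \<Rightarrow> real"
    and F2 :: "real^'m \<Rightarrow> real^'m \<Rightarrow> real"
    and f :: "real^'n \<Rightarrow> real"
begin

definition B1 :: "('n, 'm) tm \<Rightarrow> real^'n" where
  "B1 = (\<lambda>((x, u), (y, v)).
     \<chi> i. spray F1 x y $ i
        - 1/4 * (\<Sum>j\<in>UNIV. matrix_inv (fundamental_tensor F1 x y) $ i $ j * (F2 u v)\<^sup>2 *
                   partial j (\<lambda>x. (f x)\<^sup>2) x))"

definition B2 :: "('n, 'm) tm \<Rightarrow> real^'m" where
  "B2 = (\<lambda>((x, u), (y, v)).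
     \<chi> \<alpha>. spray F2 u v $ \<alpha>
        + 1 / (4 * (f x)\<^sup>2) *
          (\<Sum>\<beta>\<in>UNIV. matrix_inv (fundamental_tensor F2 u v) $ \<alpha> $ \<beta> *
             partial \<beta> (\<lambda>v. (F2 u v)\<^sup>2) v * (\<Sum>i\<in>UNIV. partial i (\<lambda>x. (f x)\<^sup>2) x * y $ i)))"

text \<open>The coefficients \<open>B\<^sup>i\<^sub>j\<close>, \<open>B\<^sup>i\<^sub>\<beta>\<close>, \<open>B\<^sup>\<alpha>\<^sub>j\<close>, \<open>B\<^sup>\<alpha>\<^sub>\<beta>\<close>, upper index first.\<close>

definition B11 :: "('n, 'm) tm \<Rightarrow> 'n \<Rightarrow> 'n \<Rightarrow> real" where
  "B11 = (\<lambda>((x, u), (y, v)) i j. partial j (\<lambda>y. B1 ((x, u), (y, v)) $ i) y)"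

definition B12 :: "('n, 'm) tm \<Rightarrow> 'n \<Rightarrow> 'm \<Rightarrow> real" where
  "B12 = (\<lambda>((x, u), (y, v)) i \<beta>. partial \<beta> (\<lambda>v. B1 ((x, u), (y, v)) $ i) v)"

definition B21 :: "('n, 'm) tm \<Rightarrow> 'm \<Rightarrow> 'n \<Rightarrow> real" where
  "B21 = (\<lambda>((x, u), (y, v)) \<alpha> j. partial j (\<lambda>y. B2 ((x, u), (y, v)) $ \<alpha>) y)"

definition B22 :: "('n, 'm) tm \<Rightarrow> 'm \<Rightarrow> 'm \<Rightarrow> real" where
  "B22 = (\<lambda>((x, u), (y, v)) \<alpha> \<beta>. partial \<beta> (\<lambda>v. B2 ((x, u), (y, v)) $ \<alpha>) v)"

text \<open>The adapted frame and the dual coframe.\<close>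

definition dd_y :: "'n \<Rightarrow> ('n, 'm) tm" where
  "dd_y i = ((0, 0), (axis i 1, 0))"

definition dd_v :: "'m \<Rightarrow> ('n, 'm) tm" where
  "dd_v \<alpha> = ((0, 0), (0, axis \<alpha> 1))"

definition delta_x :: "('n, 'm) tm \<Rightarrow> 'n \<Rightarrow> ('n, 'm) tm" where
  "delta_x z i = ((axis i 1, 0), (0, 0))
     - (\<Sum>j\<in>UNIV. B11 z j i *\<^sub>R dd_y j) - (\<Sum>\<alpha>\<in>UNIV. B21 z \<alpha> i *\<^sub>R dd_v \<alpha>)"

definition delta_u :: "('n, 'm) tm \<Rightarrow> 'm \<Rightarrow> ('n, 'm) tm" where
  "delta_u z \<alpha> = ((0, axis \<alpha> 1), (0, 0))
     - (\<Sum>\<beta>\<in>UNIV. B22 z \<beta> \<alpha> *\<^sub>R dd_v \<beta>) - (\<Sum>i\<in>UNIV. B12 z i \<alpha> *\<^sub>R dd_y i)"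

definition delta_y :: "('n, 'm) tm \<Rightarrow> 'n \<Rightarrow> ('n, 'm) tm \<Rightarrow> real" where
  "delta_y z i = (\<lambda>((a, b), (p, q)).
     p $ i + (\<Sum>j\<in>UNIV. B11 z i j * a $ j) + (\<Sum>\<alpha>\<in>UNIV. B12 z i \<alpha> * b $ \<alpha>))"

definition delta_v :: "('n, 'm) tm \<Rightarrow> 'm \<Rightarrow> ('n, 'm) tm \<Rightarrow> real" where
  "delta_v z \<alpha> = (\<lambda>((a, b), (p, q)).
     q $ \<alpha> + (\<Sum>\<beta>\<in>UNIV. B22 z \<alpha> \<beta> * b $ \<beta>) + (\<Sum>i\<in>UNIV. B21 z \<alpha> i * a $ i))"

definition sasaki_loc :: "('n, 'm) tm \<Rightarrow> ('n, 'm) tm \<Rightarrow> ('n, 'm) tm \<Rightarrow> real" where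
  "sasaki_loc z X Y =
     (case (z, X, Y) of (((x, u), (y, v)), ((a, b), _), ((a', b'), _)) \<Rightarrow>
       let g1 = fundamental_tensor F1 x y; g2 = fundamental_tensor F2 u v
       in (\<Sum>i\<in>UNIV. \<Sum>j\<in>UNIV. g1 $ i $ j * a $ i * a' $ j)
        + (\<Sum>\<alpha>\<in>UNIV. \<Sum>\<beta>\<in>UNIV. (f x)\<^sup>2 * g2 $ \<alpha> $ \<beta> * b $ \<alpha> * b' $ \<beta>)
        + (\<Sum>i\<in>UNIV. \<Sum>j\<in>UNIV. g1 $ i $ j * delta_y z i X * delta_y z j Y)
        + (\<Sum>\<alpha>\<in>UNIV. \<Sum>\<beta>\<in>UNIV. (f x)\<^sup>2 * g2 $ \<alpha> $ \<beta> * delta_v z \<alpha> X * delta_v z \<beta> Y))"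

text \<open>
  The linear map with \<open>\<partial>/\<partial>y\<^sup>i \<mapsto> \<delta>/\<delta>x\<^sup>i\<close>, \<open>\<delta>/\<delta>x\<^sup>i \<mapsto> - \<partial>/\<partial>y\<^sup>i\<close>, \<open>\<partial>/\<partial>v\<^sup>\<alpha> \<mapsto> \<delta>/\<delta>u\<^sup>\<alpha>\<close>,
  \<open>\<delta>/\<delta>u\<^sup>\<alpha> \<mapsto> - \<partial>/\<partial>v\<^sup>\<alpha>\<close>, written by means of the dual coframe.
\<close>

definition J_loc :: "('n, 'm) tm \<Rightarrow> ('n, 'm) tm \<Rightarrow> ('n, 'm) tm" where
  "J_loc z X =
     (case X of ((a, b), _) \<Rightarrow>
         (\<Sum>i\<in>UNIV. delta_y z i X *\<^sub>R delta_x z i) - (\<Sum>i\<in>UNIV. (a $ i) *\<^sub>R dd_y i)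
       + (\<Sum>\<alpha>\<in>UNIV. delta_v z \<alpha> X *\<^sub>R delta_u z \<alpha>) - (\<Sum>\<alpha>\<in>UNIV. (b $ \<alpha>) *\<^sub>R dd_v \<alpha>))"

definition xi_loc :: "('n, 'm) tm \<Rightarrow> ('n, 'm) tm" where
  "xi_loc z =
     (case z of (_, (y, v)) \<Rightarrow>
       (\<Sum>i\<in>UNIV. (y $ i) *\<^sub>R delta_x z i) + (\<Sum>\<alpha>\<in>UNIV. (v $ \<alpha>) *\<^sub>R delta_u z \<alpha>))"

definition eta_loc :: "('n, 'm) tm \<Rightarrow> ('n, 'm) tm \<Rightarrow> real" where
  "eta_loc z X =
     (case (z, X) of (((x, u), (y, v)), ((a, b), _)) \<Rightarrow>
         (\<Sum>i\<in>UNIV. \<Sum>j\<in>UNIV. y $ i * fundamental_tensor F1 x y $ i $ j * a $ j)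
       + (f x)\<^sup>2 * (\<Sum>\<alpha>\<in>UNIV. \<Sum>\<beta>\<in>UNIV. v $ \<alpha> * fundamental_tensor F2 u v $ \<alpha> $ \<beta> * b $ \<beta>))"

end

section \<open>The indicatrix bundle of a warped product\<close>

type_synonym ('a, 'n, 'b, 'm) tm_point =
  "('a \<times> ('a, real^'n) tvec) \<times> ('b \<times> ('b, real^'m) tvec)"

locale warped_product =
  fixes A1 :: "('a, real^'n) atlas" and F1 :: "'a \<times> ('a, real^'n) tvec \<Rightarrow> real"
    and A2 :: "('b, real^'m) atlas" and F2 :: "'b \<times> ('b, real^'m) tvec \<Rightarrow> real"
    and f :: "'a \<Rightarrow> real"
begin

definition TM0 :: "('a, 'n, 'b, 'm) tm_point set" where
  "TM0 = {((p, y), (q, v)).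
     p \<in> carrier_of A1 \<and> y \<in> tangent_space A1 p \<and> y \<noteq> (\<lambda>_. 0) \<and>
     q \<in> carrier_of A2 \<and> v \<in> tangent_space A2 q \<and> v \<noteq> (\<lambda>_. 0)}"

definition TM0_chart ::
  "('a, real^'n) chart \<Rightarrow> ('b, real^'m) chart \<Rightarrow> (('a, 'n, 'b, 'm) tm_point, ('n, 'm) tm) chart"
  where
  "TM0_chart c1 c2 =
     ({P \<in> TM0. fst (fst P) \<in> fst c1 \<and> fst (snd P) \<in> fst c2},
      \<lambda>((p, y), (q, v)). ((snd c1 p, snd c2 q), (y c1, v c2)))"

definition TM0_atlas :: "(('a, 'n, 'b, 'm) tm_point, ('n, 'm) tm) atlas" where
  "TM0_atlas = {TM0_chart c1 c2 | c1 c2. c1 \<in> A1 \<and> c2 \<in> A2}"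

definition F :: "('a, 'n, 'b, 'm) tm_point \<Rightarrow> real" where
  "F = (\<lambda>((p, y), (q, v)). sqrt ((F1 (p, y))\<^sup>2 + (f p)\<^sup>2 * (F2 (q, v))\<^sup>2))"

definition indicatrix :: "('a, 'n, 'b, 'm) tm_point set" where
  "indicatrix = {P \<in> TM0. F P = 1}"

text \<open>
  The tensor fields on \<open>TM0\<close> are evaluated in the induced coordinates of some charts \<open>c1\<close>, \<open>c2\<close>
  around the base points.
\<close>

definition c1 :: "('a, 'n, 'b, 'm) tm_point \<Rightarrow> ('a, real^'n) chart" where
  "c1 P = chart_at A1 (fst (fst P))"

definition c2 :: "('a, 'n, 'b, 'm) tm_point \<Rightarrow> ('b, real^'m) chart" where
  "c2 P = chart_at A2 (fst (snd P))"

definition sasaki ::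
  "('a, 'n, 'b, 'm) tm_point \<Rightarrow> (('a, 'n, 'b, 'm) tm_point, ('n, 'm) tm) tvec \<Rightarrow>
   (('a, 'n, 'b, 'm) tm_point, ('n, 'm) tm) tvec \<Rightarrow> real" where
  "sasaki P X Y =
     (let c = TM0_chart (c1 P) (c2 P)
      in warped_coordinates.sasaki_loc
           (in_chart A1 F1 (c1 P)) (in_chart A2 F2 (c2 P)) (f \<circ> chart_inv (c1 P))
           (snd c P) (X c) (Y c))"

definition J ::
  "('a, 'n, 'b, 'm) tm_point \<Rightarrow> (('a, 'n, 'b, 'm) tm_point, ('n, 'm) tm) tvec \<Rightarrow>
   (('a, 'n, 'b, 'm) tm_point, ('n, 'm) tm) tvec" where
  "J P X =
     (let c = TM0_chart (c1 P) (c2 P)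
      in tangent_vec TM0_atlas c P
           (warped_coordinates.J_loc
              (in_chart A1 F1 (c1 P)) (in_chart A2 F2 (c2 P)) (f \<circ> chart_inv (c1 P))
              (snd c P) (X c)))"

definition xi_TM0 ::
  "('a, 'n, 'b, 'm) tm_point \<Rightarrow> (('a, 'n, 'b, 'm) tm_point, ('n, 'm) tm) tvec" where
  "xi_TM0 P =
     (let c = TM0_chart (c1 P) (c2 P)
      in tangent_vec TM0_atlas c P
           (warped_coordinates.xi_loc
              (in_chart A1 F1 (c1 P)) (in_chart A2 F2 (c2 P)) (f \<circ> chart_inv (c1 P))
              (snd c P)))"

definition eta_TM0 ::
  "('a, 'n, 'b, 'm) tm_point \<Rightarrow> (('a, 'n, 'b, 'm) tm_point, ('n, 'm) tm) tvec \<Rightarrow> real" where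
  "eta_TM0 P X =
     (let c = TM0_chart (c1 P) (c2 P)
      in warped_coordinates.eta_loc
           (in_chart A1 F1 (c1 P)) (in_chart A2 F2 (c2 P)) (f \<circ> chart_inv (c1 P))
           (snd c P) (X c))"

definition D ::
  "('a, 'n, 'b, 'm) tm_point \<Rightarrow> (('a, 'n, 'b, 'm) tm_point, ('n, 'm) tm) tvec set" where
  "D P = {X \<in> tangent_space TM0_atlas P. differential TM0_atlas F P X = 0 \<and> eta_TM0 P X = 0}"

text \<open>
  \<open>\<phi> = J\<close> on \<open>D\<close> and \<open>\<phi> \<xi> = 0\<close>, extended linearly along the splitting of the tangent space of the
  indicatrix bundle into \<open>D\<close> and the line spanned by \<open>\<xi>\<close>.
\<close>

definition phi_TM0 ::
  "('a, 'n, 'b, 'm) tm_point \<Rightarrow> (('a, 'n, 'b, 'm) tm_point, ('n, 'm) tm) tvec \<Rightarrow>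
   (('a, 'n, 'b, 'm) tm_point, ('n, 'm) tm) tvec" where
  "phi_TM0 P Z = J P (THE X. X \<in> D P \<and> (\<exists>a. Z = (\<lambda>c. X c + a *\<^sub>R xi_TM0 P c)))"

text \<open>
  The indicatrix bundle as a manifold modelled on \<open>'e\<close>, and the induced tensor fields. \<open>push\<close> is the
  differential of the inclusion into \<open>TM0\<close>, \<open>pull\<close> its inverse on vectors tangent to the
  indicatrix bundle.
\<close>

definition indicatrix_atlas :: "(('a, 'n, 'b, 'm) tm_point, 'e::euclidean_space) atlas" where
  "indicatrix_atlas = submanifold_atlas TM0_atlas indicatrix"

definition push ::
  "('a, 'n, 'b, 'm) tm_point \<Rightarrow> (('a, 'n, 'b, 'm) tm_point, 'e::euclidean_space) tvec \<Rightarrow>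
   (('a, 'n, 'b, 'm) tm_point, ('n, 'm) tm) tvec" where
  "push P = tangent_map indicatrix_atlas TM0_atlas (\<lambda>Q. Q) P"

definition pull ::
  "('a, 'n, 'b, 'm) tm_point \<Rightarrow> (('a, 'n, 'b, 'm) tm_point, ('n, 'm) tm) tvec \<Rightarrow>
   (('a, 'n, 'b, 'm) tm_point, 'e::euclidean_space) tvec" where
  "pull P = inv_into (tangent_space indicatrix_atlas P) (push P)"

definition indicatrix_metric ::
  "('a, 'n, 'b, 'm) tm_point \<Rightarrow> (('a, 'n, 'b, 'm) tm_point, 'e::euclidean_space) tvec \<Rightarrow>
   (('a, 'n, 'b, 'm) tm_point, 'e) tvec \<Rightarrow> real" where
  "indicatrix_metric P X Y = sasaki P (push P X) (push P Y)"

definition eta ::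
  "('a, 'n, 'b, 'm) tm_point \<Rightarrow> (('a, 'n, 'b, 'm) tm_point, 'e::euclidean_space) tvec \<Rightarrow> real"
  where
  "eta P X = eta_TM0 P (push P X)"

definition xi ::
  "('a, 'n, 'b, 'm) tm_point \<Rightarrow> (('a, 'n, 'b, 'm) tm_point, 'e::euclidean_space) tvec" where
  "xi P = pull P (xi_TM0 P)"

definition phi ::
  "('a, 'n, 'b, 'm) tm_point \<Rightarrow> (('a, 'n, 'b, 'm) tm_point, 'e::euclidean_space) tvec \<Rightarrow>
   (('a, 'n, 'b, 'm) tm_point, 'e) tvec" where
  "phi P X = pull P (phi_TM0 P (push P X))"

end

end

theory Submission
  imports Defs
begin

text \<open>
  With \<open>L = F\<^sup>2/2\<close>, the coefficients \<open>B\<close> are the spray of \<open>L\<close>: for every \<open>w\<close>,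
  \<open>2 g(w, B) = \<partial>\<^sub>x(\<partial>\<^sub>y L w) y - \<partial>\<^sub>x L w\<close>. Differentiating this equation in the fibre direction \<open>b\<close> and
  antisymmetrising in \<open>w, b\<close> removes all third derivatives of \<open>L\<close> and leaves
  \<open>g(w, N b) - g(b, N w) = \<partial>\<^sub>x\<partial>\<^sub>y L(b, w) - \<partial>\<^sub>x\<partial>\<^sub>y L(w, b)\<close> for \<open>N = \<partial>\<^sub>y B\<close>, which says exactly that
  \<open>d\<eta>(X, Y) = G(X, J Y)\<close>. Taking \<open>w = y\<close> in the spray equation before differentiating shows that
  horizontal vectors annihilate \<open>L\<close>; hence \<open>J\<close> exchanges \<open>\<eta>\<close> and \<open>dL\<close> up to sign and preserves the
  distribution \<open>D\<close>, and the contact identities become linear algebra on each tangent space.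
  The spray equation is invariant under changes of the base coordinates, so all tensors are
  independent of the charts in which they are evaluated. Charts of the indicatrix bundle come from
  radial projection of the fibres.
\<close>


section \<open>Calculus of smooth maps\<close>

text \<open>Every tensor is evaluated in a chart picked by choice at each point, and the choice may
  jump from point to point, whereas smoothness and the exterior derivative refer to one fixed chart.
  Hence the computations are made for an abstract Lagrangian on one coordinate domain
  (\<open>spray_coords\<close>), and chart independence is an identity between two such domains
  (\<open>spray_change\<close>). There B is known only through the spray equation: positivity of g
  makes it unique, and it transforms well, unlike formulas with inverse matrices. The factor 1/2 in
  L makes its fibre Hessian the fundamental tensor and turns \<open>F = 1\<close> into
  \<open>2 L = 1\<close>, which is the normalisation \<eta>(\<xi>) = 1. The field J \<xi> is minus
  the radial field of the fibre and is normal to the indicatrix; hence J must be cut down to \<phi>,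
  and yet J and \<phi> have the same product with any tangent vector. Tangent vectors of the
  indicatrix live in a model space of their own, so identities are checked after the injective
  inclusion, whose range is the kernel of dL by a dimension count.\<close>

abbreviation FD :: "('a::real_normed_vector \<Rightarrow> 'b::real_normed_vector) \<Rightarrow> 'a \<Rightarrow> 'a \<Rightarrow> 'b" where
  "FD f x \<equiv> frechet_derivative f (at x)"

section \<open>Maps of class C^k: locality and closure properties\<close>

lemma FD_eqI: "(f has_derivative f') (at x) \<Longrightarrow> FD f x = f'"
  using frechet_derivative_at by metis

lemma Ck_on_subset: "Ck_on k T f \<Longrightarrow> S \<subseteq> T \<Longrightarrow> Ck_on k S f"
  by (induction k arbitrary: f) (auto intro: continuous_on_subset)

text \<open>\<open>Ck_on\<close> uses full derivatives at the points of \<open>S\<close>, so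
  agreement on \<open>S\<close> determines them only through openness.\<close>

lemma Ck_on_cong:
  assumes "open S" "\<And>x. x \<in> S \<Longrightarrow> f x = g x" "Ck_on k S f"
  shows "Ck_on k S g"
  using assms(2,3)
proof (induction k arbitrary: f g)
  case 0
  then show ?case by (simp cong: continuous_on_cong)
next
  case (Suc k)
  have d: "g differentiable (at x)" "FD g x = FD f x" if "x \<in> S" for x
  proof -
    have "(f has_derivative FD f x) (at x)"
      using Suc.prems(2) that by (simp add: frechet_derivative_works)
    then have "(g has_derivative FD f x) (at x)"
      using has_derivative_transform_within_open[OF _ assms(1) that] Suc.prems(1) by metis
    then show "g differentiable (at x)" "FD g x = FD f x"
      by (auto simp: differentiable_def FD_eqI)
  qed
  have "Ck_on k S (\<lambda>x. FD g x w)" for w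
    by (rule Suc.IH[where f = "\<lambda>x. FD f x w"]) (use d Suc.prems in auto)
  then show ?case using d by simp
qed

lemma Ck_on_Suc_imp: "Ck_on (Suc k) S f \<Longrightarrow> Ck_on k S f"
proof (induction k arbitrary: f)
  case 0
  then show ?case
    by (auto intro!: continuous_at_imp_continuous_on differentiable_imp_continuous_within)
next
  case (Suc k)
  then show ?case by (auto simp del: Ck_on.simps simp add: Ck_on.simps(2)[of _ S])
qed

lemma Ck_on_local:
  assumes "\<And>x. x \<in> S \<Longrightarrow> \<exists>W. open W \<and> x \<in> W \<and> Ck_on k W f"
  shows "Ck_on k S f"
  using assms
proof (induction k arbitrary: f)
  case 0
  then show ?case
    by (auto intro!: continuous_at_imp_continuous_on) (metis continuous_on_eq_continuous_at)
next
  case (Suc k)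
  then show ?case by simp meson
qed

lemma Ck_on_const: "Ck_on k S (\<lambda>x. c)"
  by (induction k arbitrary: c) auto

lemma Ck_on_linear:
  assumes "bounded_linear f"
  shows "Ck_on k S f"
proof (cases k)
  case 0
  then show ?thesis using assms by (simp add: linear_continuous_on)
next
  case (Suc k)
  have "FD f x = f" for x using assms by (intro FD_eqI bounded_linear_imp_has_derivative)
  then show ?thesis
    using Suc assms bounded_linear_imp_differentiable by (auto simp: Ck_on_const)
qed

lemma Ck_on_add:
  assumes "open S" "Ck_on k S f" "Ck_on k S g"
  shows "Ck_on k S (\<lambda>x. f x + g x)"
  using assms(2,3)
proof (induction k arbitrary: f g)
  case 0
  then show ?case by (simp add: continuous_on_add)
next
  case (Suc k)
  have d: "((\<lambda>x. f x + g x) has_derivative (\<lambda>w. FD f x w + FD g x w)) (at x)" if "x \<in> S" for x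
    using Suc.prems that by (intro has_derivative_add) (auto simp: frechet_derivative_works)
  have "Ck_on k S (\<lambda>x. FD (\<lambda>x. f x + g x) x w)" for w
  proof (rule Ck_on_cong[OF assms(1)])
    show "Ck_on k S (\<lambda>x. FD f x w + FD g x w)" using Suc by simp
  qed (simp add: FD_eqI[OF d])
  then show ?case using d by (auto simp: differentiable_def)
qed

text \<open>Scalar multiples, inner products and real products are instances. In each term of the
  product rule one factor stays undifferentiated, so it is lowered from order \<open>Suc k\<close>
  to \<open>k\<close> by \<open>Ck_on_Suc_imp\<close>.\<close>

lemma Ck_on_bilinear:
  assumes "bounded_bilinear p" "open S" "Ck_on k S f" "Ck_on k S g"
  shows "Ck_on k S (\<lambda>x. p (f x) (g x))"
  using assms(3,4)
proof (induction k arbitrary: f g)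
  case 0
  then show ?case by (simp add: bounded_bilinear.continuous_on[OF assms(1)])
next
  case (Suc k)
  have d: "((\<lambda>x. p (f x) (g x)) has_derivative (\<lambda>w. p (f x) (FD g x w) + p (FD f x w) (g x))) (at x)"
    if "x \<in> S" for x
    using Suc.prems that
    by (intro bounded_bilinear.FDERIV[OF assms(1)]) (auto simp: frechet_derivative_works)
  have "Ck_on k S (\<lambda>x. FD (\<lambda>x. p (f x) (g x)) x w)" for w
  proof (rule Ck_on_cong[OF assms(2)])
    show "Ck_on k S (\<lambda>x. p (f x) (FD g x w) + p (FD f x w) (g x))"
      using Suc.prems Suc.prems[THEN Ck_on_Suc_imp]
      by (intro Ck_on_add assms Suc.IH) simp_all
  qed (simp add: FD_eqI[OF d])
  then show ?case using d by (auto simp: differentiable_def)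
qed

lemma Ck_on_sum:
  assumes "open S" "\<And>i. i \<in> I \<Longrightarrow> Ck_on k S (f i)"
  shows "Ck_on k S (\<lambda>x. \<Sum>i\<in>I. f i x)"
  using assms(2)
  by (induction I rule: infinite_finite_induct) (auto intro: Ck_on_const Ck_on_add[OF assms(1)])

lemma linear_basis_expansion:
  assumes "linear f"
  shows "f w = (\<Sum>b\<in>Basis. (w \<bullet> b) *\<^sub>R f b)"
proof -
  have "f w = f (\<Sum>b\<in>Basis. (w \<bullet> b) *\<^sub>R b)" by (simp add: euclidean_representation)
  then show ?thesis using assms by (simp add: linear_sum linear_cmul del: euclidean_representation_sum)
qed

lemma Ck_on_compose:
  fixes g :: "'b::euclidean_space \<Rightarrow> 'c::real_normed_vector" and f :: "'a::euclidean_space \<Rightarrow> 'b"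
  assumes "open S" "Ck_on k T g" "Ck_on k S f" "f ` S \<subseteq> T"
  shows "Ck_on k S (\<lambda>x. g (f x))"
  using assms(2,3)
proof (induction k arbitrary: g)
  case 0
  then show ?case using assms(4) by (auto intro: continuous_on_compose2)
next
  case (Suc k)
  have d: "((\<lambda>x. g (f x)) has_derivative (\<lambda>w. FD g (f x) (FD f x w))) (at x)" if "x \<in> S" for x
    using diff_chain_at[of f "FD f x" x g "FD g (f x)"] Suc.prems that assms(4)
    by (auto simp: frechet_derivative_works o_def)
  have "Ck_on k S (\<lambda>x. FD (\<lambda>x. g (f x)) x w)" for w
  proof (rule Ck_on_cong[OF assms(1)])
    \<comment> \<open>The derivative of the composition has the moving direction
      \<open>FD f x w\<close>, while the hypothesis on \<open>g\<close> concerns fixed directions;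
      expanding in \<open>Basis\<close> leaves products of scalars with
      \<open>FD g (f x) b\<close>.\<close>
    show "Ck_on k S (\<lambda>x. \<Sum>b\<in>Basis. (FD f x w \<bullet> b) *\<^sub>R FD g (f x) b)"
      using Suc.prems(1) Suc.prems(2) Suc.prems(2)[THEN Ck_on_Suc_imp]
      by (intro Ck_on_sum assms(1) Ck_on_bilinear[OF bounded_bilinear_scaleR] Suc.IH
          Ck_on_bilinear[OF bounded_bilinear_inner] Ck_on_const) simp_all
    show "(\<Sum>b\<in>Basis. (FD f x w \<bullet> b) *\<^sub>R FD g (f x) b) = FD (\<lambda>x. g (f x)) x w" if "x \<in> S" for x
      using that Suc.prems(1) assms(4)
      by (subst linear_basis_expansion[of "FD g (f x)", symmetric])
        (auto simp: FD_eqI[OF d] intro: linear_frechet_derivative)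
  qed
  then show ?case using d by (auto simp: differentiable_def)
qed

named_theorems smooth_intros

lemma smooth_on_subset: "smooth_on T f \<Longrightarrow> S \<subseteq> T \<Longrightarrow> smooth_on S f"
  by (auto simp: smooth_on_def intro: Ck_on_subset)

lemma smooth_on_cong: "smooth_on S f \<Longrightarrow> open S \<Longrightarrow> (\<And>x. x \<in> S \<Longrightarrow> f x = g x) \<Longrightarrow> smooth_on S g"
  by (metis smooth_on_def Ck_on_cong)

lemma smooth_on_local:
  "(\<And>x. x \<in> S \<Longrightarrow> \<exists>W. open W \<and> x \<in> W \<and> smooth_on W f) \<Longrightarrow> smooth_on S f"
  unfolding smooth_on_def by (metis Ck_on_local)

lemma smooth_on_const [smooth_intros]: "smooth_on S (\<lambda>x. c)"
  by (simp add: smooth_on_def Ck_on_const)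

lemma smooth_on_linear: "bounded_linear f \<Longrightarrow> smooth_on S f"
  by (simp add: smooth_on_def Ck_on_linear)

lemma smooth_on_add [smooth_intros]:
  "open S \<Longrightarrow> smooth_on S f \<Longrightarrow> smooth_on S g \<Longrightarrow> smooth_on S (\<lambda>x. f x + g x)"
  by (simp add: smooth_on_def Ck_on_add)

lemma smooth_on_sum [smooth_intros]:
  "open S \<Longrightarrow> (\<And>i. i \<in> I \<Longrightarrow> smooth_on S (f i)) \<Longrightarrow> smooth_on S (\<lambda>x. \<Sum>i\<in>I. f i x)"
  by (simp add: smooth_on_def Ck_on_sum)

lemma smooth_on_bilinear:
  "bounded_bilinear p \<Longrightarrow> open S \<Longrightarrow> smooth_on S f \<Longrightarrow> smooth_on S g
    \<Longrightarrow> smooth_on S (\<lambda>x. p (f x) (g x))"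
  by (simp add: smooth_on_def Ck_on_bilinear)

lemmas smooth_on_scaleR [smooth_intros] = smooth_on_bilinear[OF bounded_bilinear_scaleR]
lemmas smooth_on_inner [smooth_intros] = smooth_on_bilinear[OF bounded_bilinear_inner]
lemmas smooth_on_mult [smooth_intros] =
  smooth_on_bilinear[OF bounded_bilinear_mult]

lemma smooth_on_compose:
  fixes g :: "'b::euclidean_space \<Rightarrow> 'c::real_normed_vector" and f :: "'a::euclidean_space \<Rightarrow> 'b"
  shows "open S \<Longrightarrow> smooth_on T g \<Longrightarrow> smooth_on S f \<Longrightarrow> (\<And>x. x \<in> S \<Longrightarrow> f x \<in> T)
    \<Longrightarrow> smooth_on S (\<lambda>x. g (f x))"
  unfolding smooth_on_def by (blast intro: Ck_on_compose)

lemma smooth_on_linear_compose: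
  fixes g :: "'b::euclidean_space \<Rightarrow> 'c::real_normed_vector" and f :: "'a::euclidean_space \<Rightarrow> 'b"
  shows "bounded_linear g \<Longrightarrow> open S \<Longrightarrow> smooth_on S f \<Longrightarrow> smooth_on S (\<lambda>x. g (f x))"
  using smooth_on_compose[of S UNIV g f] smooth_on_linear by blast

lemma smooth_on_ident [smooth_intros]: "smooth_on S (\<lambda>x. x)"
  by (intro smooth_on_linear bounded_linear_ident)

lemmas smooth_on_fst [smooth_intros] = smooth_on_linear_compose[OF bounded_linear_fst]
lemmas smooth_on_snd [smooth_intros] = smooth_on_linear_compose[OF bounded_linear_snd]
lemmas smooth_on_vec_nth [smooth_intros] =
  smooth_on_linear_compose[OF bounded_linear_vec_nth]

lemma smooth_on_minus [smooth_intros]: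
  fixes f :: "'a::euclidean_space \<Rightarrow> 'b::real_normed_vector"
  assumes "open S" "smooth_on S f"
  shows "smooth_on S (\<lambda>x. - f x)"
  using smooth_on_scaleR[OF assms(1) smooth_on_const assms(2), of "-1"] by simp

lemma smooth_on_diff [smooth_intros]:
  fixes f :: "'a::euclidean_space \<Rightarrow> 'b::real_normed_vector"
  shows "open S \<Longrightarrow> smooth_on S f \<Longrightarrow> smooth_on S g \<Longrightarrow> smooth_on S (\<lambda>x. f x - g x)"
  using smooth_on_add[of S f "\<lambda>x. - g x"] by (simp add: smooth_on_minus)

lemma smooth_on_Pair [smooth_intros]:
  fixes f :: "'a::euclidean_space \<Rightarrow> 'b::euclidean_space" and g :: "'a \<Rightarrow> 'c::euclidean_space"
  assumes "open S" "smooth_on S f" "smooth_on S g"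
  shows "smooth_on S (\<lambda>x. (f x, g x))"
proof -
  have "smooth_on S (\<lambda>x. (f x, 0) + (0, g x))"
    by (intro smooth_intros assms smooth_on_linear_compose[of "\<lambda>y. (y, 0)"]
        smooth_on_linear_compose[of "\<lambda>y. (0, y)"] bounded_linear_Pair bounded_linear_ident
        bounded_linear_zero)
  then show ?thesis by simp
qed

lemma smooth_on_vec_lambda [smooth_intros]:
  fixes f :: "'i::finite \<Rightarrow> 'a::euclidean_space \<Rightarrow> real"
  assumes "open S" "\<And>i. smooth_on S (f i)"
  shows "smooth_on S (\<lambda>x. \<chi> i. f i x)"
proof -
  have "(\<lambda>x. \<chi> i. f i x) = (\<lambda>x. \<Sum>i\<in>UNIV. f i x *\<^sub>R axis i 1)"
    by (auto simp: vec_eq_iff axis_def if_distrib cong: if_cong)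
  then show ?thesis by (simp add: smooth_intros assms)
qed

lemma smooth_on_prod [smooth_intros]:
  fixes f :: "'i \<Rightarrow> 'a::euclidean_space \<Rightarrow> real"
  assumes "open S" "\<And>i. i \<in> I \<Longrightarrow> smooth_on S (f i)"
  shows "smooth_on S (\<lambda>x. \<Prod>i\<in>I. f i x)"
  using assms(2)
  by (induction I rule: infinite_finite_induct) (auto intro: smooth_intros assms(1))

lemma smooth_on_power [smooth_intros]:
  fixes f :: "'a::euclidean_space \<Rightarrow> real"
  shows "open S \<Longrightarrow> smooth_on S f \<Longrightarrow> smooth_on S (\<lambda>x. f x ^ n)"
  by (induction n) (auto intro: smooth_intros)

text \<open>The derivative of \<open>inverse\<close> is a polynomial in \<open>inverse\<close>
  itself, so the induction hypothesis already covers it.\<close>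

lemma Ck_on_inverse: "Ck_on k (- {0}) (inverse :: real \<Rightarrow> real)"
proof (induction k)
  case 0
  show ?case by (auto intro!: continuous_intros)
next
  case (Suc k)
  have o: "open (- {0::real})" by auto
  have d: "(inverse has_derivative (\<lambda>w. - (inverse x * w * inverse x))) (at x)"
    if "x \<noteq> 0" for x :: real
    using has_derivative_inverse'[OF that] .
  have "Ck_on k (- {0}) (\<lambda>x. FD inverse x w)" for w :: real
  proof (rule Ck_on_cong[OF o])
    show "Ck_on k (- {0}) (\<lambda>x. (-w) * (inverse x * inverse x))"
      by (intro Ck_on_bilinear[OF bounded_bilinear_mult] o Suc Ck_on_const)
  qed (auto simp: FD_eqI[OF d])
  then show ?case using d by (auto simp: differentiable_def)
qed

lemma smooth_on_inverse [smooth_intros]: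
  fixes f :: "'a::euclidean_space \<Rightarrow> real"
  assumes "open S" "smooth_on S f" "\<And>x. x \<in> S \<Longrightarrow> f x \<noteq> 0"
  shows "smooth_on S (\<lambda>x. inverse (f x))"
  by (rule smooth_on_compose[of S "- {0}" inverse f]) (use assms in \<open>auto simp: smooth_on_def Ck_on_inverse\<close>)

lemma smooth_on_divide [smooth_intros]:
  fixes f :: "'a::euclidean_space \<Rightarrow> real"
  assumes "open S" "smooth_on S f" "smooth_on S g" "\<And>x. x \<in> S \<Longrightarrow> g x \<noteq> 0"
  shows "smooth_on S (\<lambda>x. f x / g x)"
  unfolding divide_inverse by (intro smooth_intros assms)

text \<open>The derivative is a multiple of \<open>inverse (sqrt x)\<close>: the induction
  hypothesis for \<open>sqrt\<close> is composed with the smooth map \<open>inverse\<close>.\<close>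

lemma Ck_on_sqrt: "Ck_on k {0<..} sqrt"
proof (induction k)
  case 0
  show ?case by (auto intro!: continuous_intros)
next
  case (Suc k)
  have o: "open {0::real<..}" by auto
  have d: "(sqrt has_derivative (\<lambda>w. w * (inverse (sqrt x) / 2))) (at x)" if "x > 0" for x
  proof -
    have "(*) (inverse (sqrt x) / 2) = (\<lambda>w. w * (inverse (sqrt x) / 2))" by (simp add: fun_eq_iff)
    then show ?thesis using DERIV_real_sqrt[OF that] by (simp only: has_field_derivative_def)
  qed
  have "Ck_on k {0<..} (\<lambda>x. FD sqrt x w)" for w
  proof (rule Ck_on_cong[OF o])
    show "Ck_on k {0<..} (\<lambda>x. (w / 2) * inverse (sqrt x))"
      by (intro Ck_on_bilinear[OF bounded_bilinear_mult] o Ck_on_const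
          Ck_on_compose[OF o Ck_on_inverse] Suc) auto
  qed (auto simp: FD_eqI[OF d])
  then show ?case using d by (auto simp: differentiable_def)
qed

lemma smooth_on_sqrt [smooth_intros]:
  fixes f :: "'a::euclidean_space \<Rightarrow> real"
  assumes "open S" "smooth_on S f" "\<And>x. x \<in> S \<Longrightarrow> f x > 0"
  shows "smooth_on S (\<lambda>x. sqrt (f x))"
  by (rule smooth_on_compose[of S "{0<..}" sqrt f]) (use assms in \<open>auto simp: smooth_on_def Ck_on_sqrt\<close>)

section \<open>Derivatives of smooth maps at moving points and in moving directions\<close>

lemma smooth_on_differentiable: "smooth_on S f \<Longrightarrow> x \<in> S \<Longrightarrow> f differentiable (at x)"
  using Ck_on.simps(2) smooth_on_def by blast

lemma smooth_on_has_derivative: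
  "smooth_on S f \<Longrightarrow> x \<in> S \<Longrightarrow> (f has_derivative FD f x) (at x)"
  using smooth_on_differentiable frechet_derivative_works by blast

lemma smooth_on_linear_FD: "smooth_on S f \<Longrightarrow> x \<in> S \<Longrightarrow> linear (FD f x)"
  by (simp add: linear_frechet_derivative smooth_on_differentiable)

lemma smooth_on_continuous_on: "smooth_on S f \<Longrightarrow> continuous_on S f"
  using Ck_on.simps(1) smooth_on_def by blast

lemma smooth_on_FD: "smooth_on S f \<Longrightarrow> smooth_on S (\<lambda>x. FD f x w)"
  using Ck_on.simps(2) unfolding smooth_on_def by blast

lemma FD_cong:
  assumes "smooth_on S f" "open S" "x \<in> S" "\<And>y. y \<in> S \<Longrightarrow> f y = g y"
  shows "FD g x = FD f x"
  using has_derivative_transform_within_open[OF smooth_on_has_derivative[OF assms(1,3)] assms(2,3,4)]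
  by (rule FD_eqI)

text \<open>Expanding the direction in \<open>Basis\<close> reduces this to the ordinary product and
  chain rules. The later differentiations of Euler's relation, of the spray equation and of \<eta>
  all rest on it.\<close>

lemma FD_compose_apply_has_derivative:
  fixes f :: "'a::euclidean_space \<Rightarrow> 'b::real_normed_vector" and k :: "'c::real_normed_vector \<Rightarrow> 'a"
  assumes "open T" "smooth_on T f" and k: "(k has_derivative k') (at x)" "k x \<in> T"
    and w: "(w has_derivative w') (at x)"
  shows "((\<lambda>x. FD f (k x) (w x)) has_derivative
     (\<lambda>h. FD (\<lambda>z. FD f z (w x)) (k x) (k' h) + FD f (k x) (w' h))) (at x)"
proof -
  have lin: "linear (FD f y)" if "y \<in> T" for y using assms(2) that by (rule smooth_on_linear_FD)
  have dF: "((\<lambda>z. FD f z b) has_derivative FD (\<lambda>z. FD f z b) (k x)) (at (k x))" for b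
    using smooth_on_FD[OF assms(2)] k(2) by (rule smooth_on_has_derivative)
  have "((\<lambda>y. \<Sum>b\<in>Basis. (w x \<bullet> b) *\<^sub>R FD f y b) has_derivative
      (\<lambda>h. \<Sum>b\<in>Basis. (w x \<bullet> b) *\<^sub>R FD (\<lambda>z. FD f z b) (k x) h)) (at (k x))"
    by (intro has_derivative_sum has_derivative_scaleR_right dF)
  then have "((\<lambda>y. FD f y (w x)) has_derivative
      (\<lambda>h. \<Sum>b\<in>Basis. (w x \<bullet> b) *\<^sub>R FD (\<lambda>z. FD f z b) (k x) h)) (at (k x))"
    by (rule has_derivative_transform_within_open[OF _ assms(1) k(2)])
      (simp add: linear_basis_expansion[OF lin, symmetric])
  note eq = FD_eqI[OF this]
  have "((\<lambda>x. w x \<bullet> b) has_derivative (\<lambda>h. w' h \<bullet> b)) (at x)" for b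
    using w by (auto intro: derivative_eq_intros)
  then have 1: "((\<lambda>x. \<Sum>b\<in>Basis. (w x \<bullet> b) *\<^sub>R FD f (k x) b) has_derivative
      (\<lambda>h. \<Sum>b\<in>Basis. (w x \<bullet> b) *\<^sub>R FD (\<lambda>z. FD f z b) (k x) (k' h) + (w' h \<bullet> b) *\<^sub>R FD f (k x) b)) (at x)"
    by (intro has_derivative_sum has_derivative_scaleR has_derivative_compose[OF k(1) dF])
  have "isCont k x" using k(1) by (rule has_derivative_continuous)
  then obtain S where S: "open S" "x \<in> S" "\<And>y. y \<in> S \<Longrightarrow> k y \<in> T"
    using continuous_at_open[of x k] assms(1) k(2) by metis
  have "((\<lambda>x. FD f (k x) (w x)) has_derivative
      (\<lambda>h. \<Sum>b\<in>Basis. (w x \<bullet> b) *\<^sub>R FD (\<lambda>z. FD f z b) (k x) (k' h) + (w' h \<bullet> b) *\<^sub>R FD f (k x) b)) (at x)"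
    by (rule has_derivative_transform_within_open[OF 1 S(1,2)])
      (simp add: linear_basis_expansion[OF lin[OF S(3)], symmetric])
  then show ?thesis
    by (simp add: eq sum.distrib linear_basis_expansion[OF lin[OF k(2)], symmetric])
qed

lemma FD_apply_has_derivative:
  fixes f :: "'a::euclidean_space \<Rightarrow> 'b::real_normed_vector"
  assumes "open S" "smooth_on S f" "x \<in> S" "(w has_derivative w') (at x)"
  shows "((\<lambda>x. FD f x (w x)) has_derivative
     (\<lambda>h. FD (\<lambda>z. FD f z (w x)) x h + FD f x (w' h))) (at x)"
  using FD_compose_apply_has_derivative[OF assms(1,2) has_derivative_ident assms(3,4)] .

lemma DERIV_along_line:
  fixes g :: "'a::euclidean_space \<Rightarrow> real"
  assumes "smooth_on S g" "y + r *\<^sub>R v \<in> S"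
  shows "DERIV (\<lambda>r. g (y + r *\<^sub>R v)) r :> FD g (y + r *\<^sub>R v) v"
proof -
  have "((\<lambda>r. y + r *\<^sub>R v) has_derivative (\<lambda>t. t *\<^sub>R v)) (at r)"
    by (auto intro!: derivative_eq_intros)
  from diff_chain_at[OF this smooth_on_has_derivative[OF assms]]
  show ?thesis
    using linear_cmul[OF smooth_on_linear_FD[OF assms]]
    by (simp add: has_field_derivative_def o_def mult_commute_abs)
qed

section \<open>Symmetry of second derivatives\<close>

lemma second_difference:
  fixes f :: "'a::euclidean_space \<Rightarrow> real"
  assumes sm: "smooth_on S f" and "s > 0"
    and S: "\<And>a b. 0 \<le> a \<Longrightarrow> a \<le> s \<Longrightarrow> 0 \<le> b \<Longrightarrow> b \<le> s \<Longrightarrow> x + a *\<^sub>R v + b *\<^sub>R w \<in> S"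
  obtains a b where "0 \<le> a" "a \<le> s" "0 \<le> b" "b \<le> s"
    "f (x + s *\<^sub>R v + s *\<^sub>R w) - f (x + s *\<^sub>R v) - f (x + s *\<^sub>R w) + f x =
       s\<^sup>2 * FD (\<lambda>x. FD f x v) (x + a *\<^sub>R v + b *\<^sub>R w) w"
proof -
  have "\<exists>a. 0 < a \<and> a < s \<and>
      (f (x + s *\<^sub>R w + s *\<^sub>R v) - f (x + s *\<^sub>R v)) - (f (x + s *\<^sub>R w + 0 *\<^sub>R v) - f (x + 0 *\<^sub>R v)) =
      (s - 0) * (FD f (x + s *\<^sub>R w + a *\<^sub>R v) v - FD f (x + a *\<^sub>R v) v)"
  proof (rule MVT2[OF \<open>s > 0\<close>])
    fix r assume r: "0 \<le> r" "r \<le> s"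
    show "DERIV (\<lambda>r. f (x + s *\<^sub>R w + r *\<^sub>R v) - f (x + r *\<^sub>R v)) r :>
        FD f (x + s *\<^sub>R w + r *\<^sub>R v) v - FD f (x + r *\<^sub>R v) v"
      using S[OF r, of s] S[OF r, of 0] \<open>s > 0\<close>
      by (intro DERIV_diff DERIV_along_line[OF sm]) (simp_all add: algebra_simps)
  qed
  then obtain a where a: "0 < a" "a < s" and eq1:
    "f (x + s *\<^sub>R v + s *\<^sub>R w) - f (x + s *\<^sub>R v) - f (x + s *\<^sub>R w) + f x =
      s * (FD f (x + a *\<^sub>R v + s *\<^sub>R w) v - FD f (x + a *\<^sub>R v) v)"
    by (auto simp: algebra_simps)
  have "\<exists>b. 0 < b \<and> b < s \<and>
      FD f (x + a *\<^sub>R v + s *\<^sub>R w) v - FD f (x + a *\<^sub>R v + 0 *\<^sub>R w) v =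
      (s - 0) * FD (\<lambda>x. FD f x v) (x + a *\<^sub>R v + b *\<^sub>R w) w"
  proof (rule MVT2[OF \<open>s > 0\<close>])
    fix r assume r: "0 \<le> r" "r \<le> s"
    show "DERIV (\<lambda>r. FD f (x + a *\<^sub>R v + r *\<^sub>R w) v) r :>
        FD (\<lambda>x. FD f x v) (x + a *\<^sub>R v + r *\<^sub>R w) w"
      using S[of a r] r a by (intro DERIV_along_line[OF smooth_on_FD[OF sm]]) auto
  qed
  then obtain b where b: "0 < b" "b < s" and eq2:
    "FD f (x + a *\<^sub>R v + s *\<^sub>R w) v - FD f (x + a *\<^sub>R v) v =
      s * FD (\<lambda>x. FD f x v) (x + a *\<^sub>R v + b *\<^sub>R w) w" by auto
  show thesis
    by (rule that[of a b]) (use a b eq1 eq2 in \<open>auto simp: power2_eq_square\<close>)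
qed

text \<open>The second difference is symmetric in \<open>v\<close> and \<open>w\<close>, and by
  \<open>second_difference\<close> it equals \<open>s\<^sup>2\<close> times either mixed derivative
  at some point of a small parallelogram; continuity carries the equality to
  \<open>x\<close>.\<close>

lemma FD_symmetric_real:
  fixes f :: "'a::euclidean_space \<Rightarrow> real"
  assumes "open S" "smooth_on S f" "x \<in> S"
  shows "FD (\<lambda>x. FD f x v) x w = FD (\<lambda>x. FD f x w) x v"
proof (rule ccontr)
  define A where "A = (\<lambda>v w y. FD (\<lambda>x. FD f x v) y w)"
  assume neq: "\<not> ?thesis"
  \<comment> \<open>Half the gap: two values that agree cannot each lie strictly within
    \<open>d\<close> of numbers that are \<open>2 * d\<close> apart.\<close>
  define d where "d = \<bar>A v w x - A w v x\<bar> / 2"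
  have d: "d > 0" using neq by (simp add: d_def A_def)
  have "isCont (A v w) x" for v w
    using smooth_on_continuous_on[OF smooth_on_FD[OF smooth_on_FD[OF assms(2)]]] assms(1,3)
    by (auto simp: continuous_on_eq_continuous_at A_def)
  then have "\<forall>\<^sub>F y in nhds x. dist (A v w y) (A v w x) < d" "\<forall>\<^sub>F y in nhds x. dist (A w v y) (A w v x) < d"
    using d unfolding continuous_at_eps_delta eventually_nhds_metric by metis+
  moreover have "\<forall>\<^sub>F y in nhds x. y \<in> S" using assms(1,3) by (rule eventually_nhds_in_open)
  ultimately have "\<forall>\<^sub>F y in nhds x. y \<in> S \<and> dist (A v w y) (A v w x) < d \<and> dist (A w v y) (A w v x) < d"
    by eventually_elim auto
  then obtain e where e: "e > 0"
    "\<And>y. dist y x < e \<Longrightarrow> y \<in> S \<and> dist (A v w y) (A v w x) < d \<and> dist (A w v y) (A w v x) < d"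
    by (auto simp: eventually_nhds_metric)
  \<comment> \<open>Keeps the whole parallelogram within distance \<open>e\<close> of
    \<open>x\<close>; the summand 1 guards against \<open>v = w = 0\<close>.\<close>
  define s where "s = e / (2 * (norm v + norm w + 1))"
  have s: "s > 0" using e by (auto simp: s_def intro!: divide_pos_pos add_nonneg_pos)
  have near: "dist (x + a *\<^sub>R v + b *\<^sub>R w) x < e" if "0 \<le> a" "a \<le> s" "0 \<le> b" "b \<le> s" for a b
  proof -
    have "dist (x + a *\<^sub>R v + b *\<^sub>R w) x \<le> norm (a *\<^sub>R v) + norm (b *\<^sub>R w)"
      using norm_triangle_ineq[of "a *\<^sub>R v" "b *\<^sub>R w"] by (simp add: dist_norm)
    also have "\<dots> \<le> s * norm v + s * norm w"
      using that by (intro add_mono) (auto intro: mult_right_mono)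
    also have "\<dots> < s * (2 * (norm v + norm w + 1))"
    proof -
      have "0 \<le> s * norm v" "0 \<le> s * norm w" using s by simp_all
      moreover have "s * (2 * (norm v + norm w + 1)) = 2 * (s * norm v) + 2 * (s * norm w) + 2 * s"
        by (simp add: algebra_simps)
      ultimately show ?thesis using s by linarith
    qed
    also have "\<dots> = e"
    proof -
      have "norm v + norm w + 1 \<noteq> 0" using norm_ge_zero[of v] norm_ge_zero[of w] by linarith
      then show ?thesis by (simp add: s_def)
    qed
    finally show ?thesis .
  qed
  have near': "dist (x + a *\<^sub>R w + b *\<^sub>R v) x < e" if "0 \<le> a" "a \<le> s" "0 \<le> b" "b \<le> s" for a b
    using near[of b a] that by (simp add: add.commute add.left_commute)
  obtain a b where 1: "0 \<le> a" "a \<le> s" "0 \<le> b" "b \<le> s"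
    "f (x + s *\<^sub>R v + s *\<^sub>R w) - f (x + s *\<^sub>R v) - f (x + s *\<^sub>R w) + f x = s\<^sup>2 * A v w (x + a *\<^sub>R v + b *\<^sub>R w)"
    unfolding A_def using second_difference[OF assms(2) s, of x v w] near e by blast
  obtain a' b' where 2: "0 \<le> a'" "a' \<le> s" "0 \<le> b'" "b' \<le> s"
    "f (x + s *\<^sub>R w + s *\<^sub>R v) - f (x + s *\<^sub>R w) - f (x + s *\<^sub>R v) + f x = s\<^sup>2 * A w v (x + a' *\<^sub>R w + b' *\<^sub>R v)"
    unfolding A_def using second_difference[OF assms(2) s, of x w v] near' e by blast
  have "s\<^sup>2 * A v w (x + a *\<^sub>R v + b *\<^sub>R w) = s\<^sup>2 * A w v (x + a' *\<^sub>R w + b' *\<^sub>R v)"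
  proof -
    have "x + s *\<^sub>R w + s *\<^sub>R v = x + s *\<^sub>R v + s *\<^sub>R w" by simp
    with 1(5) 2(5) show ?thesis by (simp only:)
  qed
  then have "A v w (x + a *\<^sub>R v + b *\<^sub>R w) = A w v (x + a' *\<^sub>R w + b' *\<^sub>R v)"
    using s by simp
  moreover have "\<bar>A v w (x + a *\<^sub>R v + b *\<^sub>R w) - A v w x\<bar> < d" "\<bar>A w v (x + a' *\<^sub>R w + b' *\<^sub>R v) - A w v x\<bar> < d"
    using e(2)[OF near[OF 1(1-4)]] e(2)[OF near'[OF 2(1-4)]] by (auto simp: dist_real_def)
  moreover have "\<bar>A v w x - A w v x\<bar> = 2 * d" by (simp add: d_def)
  ultimately show False by linarith
qed

lemma FD_inner:
  assumes "smooth_on S f" "x \<in> S"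
  shows "FD (\<lambda>x. f x \<bullet> b) x w = FD f x w \<bullet> b"
  using smooth_on_has_derivative[OF assms]
  by (subst FD_eqI) (auto intro: derivative_eq_intros)

lemma FD_symmetric:
  fixes f :: "'a::euclidean_space \<Rightarrow> 'b::euclidean_space"
  assumes "open S" "smooth_on S f" "x \<in> S"
  shows "FD (\<lambda>x. FD f x v) x w = FD (\<lambda>x. FD f x w) x v"
proof (rule euclidean_eqI)
  fix b :: 'b
  have *: "FD (\<lambda>x. FD f x v) x w \<bullet> b = FD (\<lambda>x. FD (\<lambda>x. f x \<bullet> b) x v) x w" for v w
    unfolding FD_inner[OF smooth_on_FD[OF assms(2)] assms(3), symmetric]
    by (subst FD_cong[OF _ assms(1,3), of "\<lambda>x. FD f x v \<bullet> b" "\<lambda>x. FD (\<lambda>x. f x \<bullet> b) x v"])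
      (auto simp: FD_inner[OF assms(2)] intro!: smooth_on_inner smooth_on_const smooth_on_FD assms)
  have "smooth_on S (\<lambda>x. f x \<bullet> b)" by (intro smooth_intros assms)
  then show "FD (\<lambda>x. FD f x v) x w \<bullet> b = FD (\<lambda>x. FD f x w) x v \<bullet> b"
    unfolding * by (rule FD_symmetric_real[OF assms(1) _ assms(3)])
qed


text \<open>Symmetry moves the inner direction to the outer place, where a derivative is
  linear.\<close>

lemma FD_FD_linear:
  fixes f :: "'a::euclidean_space \<Rightarrow> 'b::euclidean_space"
  assumes "open S" "smooth_on S f" "x \<in> S"
  shows "linear (\<lambda>v. FD (\<lambda>x. FD f x v) x w)"
  unfolding FD_symmetric[OF assms, of _ w] by (rule smooth_on_linear_FD[OF smooth_on_FD[OF assms(2)] assms(3)])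

lemma smooth_on_FD_compose:
  fixes f :: "'a::euclidean_space \<Rightarrow> 'b::real_normed_vector" and k :: "'c::euclidean_space \<Rightarrow> 'a"
  assumes "open S" "smooth_on T f" "smooth_on S k" "\<And>x. x \<in> S \<Longrightarrow> k x \<in> T" "smooth_on S w"
  shows "smooth_on S (\<lambda>x. FD f (k x) (w x))"
proof (rule smooth_on_cong)
  show "smooth_on S (\<lambda>x. \<Sum>b\<in>Basis. (w x \<bullet> b) *\<^sub>R FD f (k x) b)"
    by (intro smooth_on_sum smooth_on_scaleR smooth_on_inner smooth_on_const assms
        smooth_on_compose[OF assms(1) smooth_on_FD[OF assms(2)]])
  show "(\<Sum>b\<in>Basis. (w x \<bullet> b) *\<^sub>R FD f (k x) b) = FD f (k x) (w x)" if "x \<in> S" for x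
    using linear_basis_expansion[OF smooth_on_linear_FD[OF assms(2) assms(4)[OF that]], of "w x"] by simp
qed (fact assms)

lemma smooth_on_FD_FD_compose:
  fixes f :: "'a::euclidean_space \<Rightarrow> 'b::euclidean_space" and k :: "'c::euclidean_space \<Rightarrow> 'a"
  assumes "open S" "open T" "smooth_on T f" "smooth_on S k" "\<And>x. x \<in> S \<Longrightarrow> k x \<in> T"
    "smooth_on S v" "smooth_on S w"
  shows "smooth_on S (\<lambda>x. FD (\<lambda>z. FD f z (v x)) (k x) (w x))"
proof (rule smooth_on_cong)
  show "smooth_on S (\<lambda>x. \<Sum>b\<in>Basis. (v x \<bullet> b) *\<^sub>R FD (\<lambda>z. FD f z b) (k x) (w x))"
    by (intro smooth_on_sum smooth_on_scaleR smooth_on_inner smooth_on_const assms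
        smooth_on_FD_compose[OF assms(1) smooth_on_FD[OF assms(3)]])
  show "(\<Sum>b\<in>Basis. (v x \<bullet> b) *\<^sub>R FD (\<lambda>z. FD f z b) (k x) (w x)) =
      FD (\<lambda>z. FD f z (v x)) (k x) (w x)" if "x \<in> S" for x
    using linear_basis_expansion[OF FD_FD_linear[OF assms(2,3) assms(5)[OF that]], of "v x" "w x"] by simp
qed (fact assms)

section \<open>Homogeneous Lagrangians and their sprays in coordinates\<close>

text \<open>Both factors are merged into the single space \<open>'e\<close>, so the warping is
  invisible here. Of the homogeneity of L only Euler's relation is kept, and B is specified
  implicitly by \<open>spray\<close>.\<close>

locale spray_coords =
  fixes Om :: "('e::euclidean_space \<times> 'e) set" and L :: "'e \<times> 'e \<Rightarrow> real" and B :: "'e \<times> 'e \<Rightarrow> 'e"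
  assumes open_Om: "open Om" and smooth_L: "smooth_on Om L" and smooth_B: "smooth_on Om B"
    and euler: "z \<in> Om \<Longrightarrow> FD L z (0, snd z) = 2 * L z"
    and pos: "z \<in> Om \<Longrightarrow> w \<noteq> 0 \<Longrightarrow> FD (\<lambda>z. FD L z (0, w)) z (0, w) > 0"
    and spray: "z \<in> Om \<Longrightarrow> 2 * FD (\<lambda>z. FD L z (0, w)) z (0, B z) =
      FD (\<lambda>z. FD L z (0, w)) z (snd z, 0) - FD L z (w, 0)"
begin

text \<open>
  Points \<open>z\<close> are pairs of a base point and a velocity, tangent vectors \<open>X\<close> pairs of a base and a fibre
  component. In the notation of the paper \<open>N z a\<close> is \<open>B\<^sup>i\<^sub>j a\<^sup>j\<close>, \<open>del z X\<close> collects the \<open>\<delta>\<^sup>*y\<^sup>i(X)\<close>,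
  \<open>th\<close> is \<open>\<eta>\<^sup>*\<close>, and \<open>phi\<close> is the extension of \<open>J\<close> from \<open>D\<close> by \<open>phi \<xi>\<^sup>* = 0\<close>.
\<close>

definition H where "H z X Y = FD (\<lambda>z. FD L z X) z Y"
definition g where "g z a b = H z (0, a) (0, b)"
definition N where "N z a = FD B z (0, a)"
definition del where "del z X = snd X + N z (fst X)"
definition G where "G z X Y = g z (fst X) (fst Y) + g z (del z X) (del z Y)"
definition J where "J z X = (del z X, - fst X - N z (del z X))"
definition xi where "xi z = (snd z, - N z (snd z))"
definition th where "th z (X :: 'e \<times> 'e) = FD L z (0, fst X)"
definition phi where "phi z X = J z (X - th z X *\<^sub>R xi z)"

section \<open>Linearity and symmetry of the pointwise forms\<close>

lemma linear_L: "z \<in> Om \<Longrightarrow> linear (FD L z)"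
  using smooth_L by (rule smooth_on_linear_FD)

lemma H_sym: "z \<in> Om \<Longrightarrow> H z X Y = H z Y X"
  unfolding H_def by (rule FD_symmetric[OF open_Om smooth_L])

lemma linear_H2: "z \<in> Om \<Longrightarrow> linear (H z X)"
  unfolding H_def using smooth_on_FD[OF smooth_L] by (rule smooth_on_linear_FD)

lemma linear_N: "z \<in> Om \<Longrightarrow> linear (N z)"
  unfolding N_def
  by (rule linear_compose[of "\<lambda>a. (0, a)" "FD B z", unfolded o_def])
    (auto intro: linearI smooth_on_linear_FD[OF smooth_B])

lemma linear_inr: "linear (\<lambda>a. (0, a))" and linear_inl: "linear (\<lambda>a. (a, 0))"
  by (auto intro: linearI)

lemma linear_g2: "z \<in> Om \<Longrightarrow> linear (g z a)"
  unfolding g_def using linear_compose[OF linear_inr linear_H2] by (simp add: o_def)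

lemma g_sym: "z \<in> Om \<Longrightarrow> g z a b = g z b a"
  unfolding g_def by (rule H_sym)

lemma linear_g1: "z \<in> Om \<Longrightarrow> linear (\<lambda>a. g z a b)"
proof -
  assume z: "z \<in> Om"
  have "(\<lambda>a. g z a b) = g z b" by (rule ext) (rule g_sym[OF z])
  with linear_g2[OF z] show ?thesis by simp
qed

lemma linear_del: "z \<in> Om \<Longrightarrow> linear (del z)"
  unfolding del_def using linear_N
  by (intro linearI) (simp_all add: linear_add linear_cmul scaleR_add_right)

lemma linear_J: "z \<in> Om \<Longrightarrow> linear (J z)"
  unfolding J_def using linear_N linear_del
  by (intro linearI) (simp_all add: linear_add linear_cmul scaleR_diff_right)

lemma linear_th: "z \<in> Om \<Longrightarrow> linear (th z)"
proof -
  assume z: "z \<in> Om"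
  have "linear (\<lambda>X :: 'e \<times> 'e. (0 :: 'e, fst X))" by (auto intro: linearI)
  from linear_compose[OF this linear_L[OF z]] show ?thesis by (simp add: th_def[abs_def] o_def)
qed

lemma linear_phi: "z \<in> Om \<Longrightarrow> linear (phi z)"
proof -
  assume z: "z \<in> Om"
  have "linear (\<lambda>X. X - th z X *\<^sub>R xi z)"
    by (rule linearI)
      (simp_all add: linear_add[OF linear_th[OF z]] linear_cmul[OF linear_th[OF z]]
        scaleR_add_left scaleR_diff_right)
  from linear_compose[OF this linear_J[OF z]] show ?thesis
    by (simp add: phi_def[abs_def] o_def)
qed

lemma G_sym: "z \<in> Om \<Longrightarrow> G z X Y = G z Y X"
  by (simp add: G_def g_sym)

lemma linear_G2: "z \<in> Om \<Longrightarrow> linear (G z X)"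
  unfolding G_def using linear_g2[of z] linear_del[of z]
  by (intro linearI) (simp_all add: linear_add linear_cmul algebra_simps)

lemma linear_G1: "z \<in> Om \<Longrightarrow> linear (\<lambda>X. G z X Y)"
proof -
  assume z: "z \<in> Om"
  have "(\<lambda>X. G z X Y) = G z Y" by (rule ext) (rule G_sym[OF z])
  with linear_G2[OF z] show ?thesis by simp
qed

lemma H_split: "z \<in> Om \<Longrightarrow> H z X Y = H z X (fst Y, 0) + H z X (0, snd Y)"
  using linear_add[OF linear_H2, of z X "(fst Y, 0)" "(0, snd Y)"] by simp

lemma L_split: "z \<in> Om \<Longrightarrow> FD L z Y = FD L z (fst Y, 0) + FD L z (0, snd Y)"
  using linear_add[OF linear_L, of z "(fst Y, 0)" "(0, snd Y)"] by simp

text \<open>Differentiate Euler's relation; the moving direction \<open>(0, snd z)\<close>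
  contributes the subtracted term. For vertical \<open>h\<close> this says that the vertical
  derivative of L is the metric dual of the velocity; for \<open>h\<close> without fibre part the
  right side is just \<open>2 * FD L z h\<close>.\<close>

lemma H_euler:
  assumes "z \<in> Om"
  shows "H z (0, snd z) h = 2 * FD L z h - FD L z (0, snd h)"
proof -
  have "((\<lambda>z. (0, snd z)) has_derivative (\<lambda>h. (0, snd h))) (at z)"
    by (auto intro!: derivative_eq_intros)
  from FD_apply_has_derivative[OF open_Om smooth_L assms this]
  have 1: "((\<lambda>z. FD L z (0, snd z)) has_derivative (\<lambda>h. H z (0, snd z) h + FD L z (0, snd h))) (at z)"
    unfolding H_def .
  have 2: "((\<lambda>z. FD L z (0, snd z)) has_derivative (\<lambda>h. 2 * FD L z h)) (at z)"
    by (rule has_derivative_transform_within_open[OF _ open_Om assms, of "\<lambda>z. 2 * L z"])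
      (auto simp: euler intro!: derivative_eq_intros smooth_on_has_derivative[OF smooth_L assms])
  show ?thesis using fun_cong[OF has_derivative_unique[OF 1 2], of h] by simp
qed

text \<open>This identifies \<open>th\<close>, defined as a vertical derivative, with the form whose
  coefficients are \<open>y^i g_ij\<close>.\<close>

lemma th_eq_g: "z \<in> Om \<Longrightarrow> FD L z (0, b) = g z (snd z) b"
  by (simp add: g_def H_euler)

lemma spray': "z \<in> Om \<Longrightarrow> 2 * g z w (B z) = H z (0, w) (snd z, 0) - FD L z (w, 0)"
  unfolding g_def H_def by (rule spray)

lemma spray_euler: "z \<in> Om \<Longrightarrow> 2 * FD L z (0, B z) = FD L z (snd z, 0)"
  using spray'[of z "snd z"] linear_0[OF linear_L[of z]]
  by (simp add: g_def H_euler prod_eq_iff flip: zero_prod_def)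

lemma has_derivative_L_vary:
  assumes "z \<in> Om" "(w has_derivative w') (at z)"
  shows "((\<lambda>z. FD L z (w z)) has_derivative (\<lambda>h. H z (w z) h + FD L z (w' h))) (at z)"
  using FD_apply_has_derivative[OF open_Om smooth_L assms] unfolding H_def .

lemma has_derivative_B: "z \<in> Om \<Longrightarrow> (B has_derivative FD B z) (at z)"
  using smooth_B by (rule smooth_on_has_derivative)

text \<open>Horizontal vectors annihilate \<open>L\<close>: differentiate \<open>spray_euler\<close> vertically.\<close>

lemma L_N:
  assumes "z \<in> Om"
  shows "FD L z (0, N z b) = FD L z (b, 0)"
proof -
  have 1: "((\<lambda>z. 2 * FD L z (0, B z)) has_derivative
      (\<lambda>h. 2 * (H z (0, B z) h + FD L z (0, FD B z h)))) (at z)"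
    by (intro has_derivative_mult_right has_derivative_L_vary assms has_derivative_Pair
        has_derivative_const has_derivative_B)
  have "((\<lambda>z. FD L z (snd z, 0)) has_derivative (\<lambda>h. H z (snd z, 0) h + FD L z (snd h, 0))) (at z)"
    by (intro has_derivative_L_vary assms) (auto intro!: derivative_eq_intros)
  then have 2: "((\<lambda>z. 2 * FD L z (0, B z)) has_derivative
      (\<lambda>h. H z (snd z, 0) h + FD L z (snd h, 0))) (at z)"
    by (rule has_derivative_transform_within_open[OF _ open_Om assms]) (simp add: spray_euler)
  have "2 * (H z (0, B z) (0, b) + FD L z (0, N z b)) = H z (snd z, 0) (0, b) + FD L z (b, 0)"
    using fun_cong[OF has_derivative_unique[OF 1 2], of "(0, b)"] by (simp add: N_def)
  moreover have "2 * H z (0, B z) (0, b) = H z (snd z, 0) (0, b) - FD L z (b, 0)"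
    using spray'[OF assms, of b] by (simp add: g_def H_sym assms)
  ultimately show ?thesis by simp
qed

text \<open>Differentiate the spray equation vertically and antisymmetrise: the third derivatives \<open>T\<close> of \<open>L\<close>
  cancel by \<open>T_sym\<close>.\<close>

lemma g_N_antisym:
  assumes "z \<in> Om"
  shows "g z w (N z b) - g z b (N z w) = H z (0, w) (b, 0) - H z (0, b) (w, 0)"
proof -
  define T where "T w v h = FD (\<lambda>z. FD (\<lambda>z. FD L z (0, w)) z v) z h" for w v h
  have sm: "smooth_on Om (\<lambda>z. FD L z (0, w))" for w using smooth_L by (rule smooth_on_FD)
  have T_sym: "T w v (0, b) = T b v (0, w)" for w v b
  proof -
    have "T w v (0, b) = FD (\<lambda>z. FD (\<lambda>z. FD L z (0, w)) z (0, b)) z v"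
      unfolding T_def by (rule FD_symmetric[OF open_Om sm assms])
    also have "\<dots> = FD (\<lambda>z. FD (\<lambda>z. FD L z (0, b)) z (0, w)) z v"
      by (subst FD_cong[OF smooth_on_FD[OF sm] open_Om assms, symmetric])
        (auto simp: H_sym[unfolded H_def])
    also have "\<dots> = T b v (0, w)"
      unfolding T_def by (rule FD_symmetric[OF open_Om sm assms])
    finally show ?thesis .
  qed
  have main: "2 * (T w (0, B z) (0, b) + g z w (N z b)) =
      T w (snd z, 0) (0, b) + H z (0, w) (b, 0) - H z (w, 0) (0, b)" for w b
  proof -
    have 1: "((\<lambda>z. 2 * FD (\<lambda>z. FD L z (0, w)) z (0, B z)) has_derivative
        (\<lambda>h. 2 * (T w (0, B z) h + FD (\<lambda>z. FD L z (0, w)) z (0, FD B z h)))) (at z)"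
      unfolding T_def
      by (intro has_derivative_mult_right FD_apply_has_derivative[OF open_Om sm assms]
          has_derivative_Pair has_derivative_const has_derivative_B assms)
    have "((\<lambda>z. FD (\<lambda>z. FD L z (0, w)) z (snd z, 0)) has_derivative
        (\<lambda>h. T w (snd z, 0) h + FD (\<lambda>z. FD L z (0, w)) z (snd h, 0))) (at z)"
      unfolding T_def
      by (intro FD_apply_has_derivative[OF open_Om sm assms]) (auto intro!: derivative_eq_intros)
    from has_derivative_diff[OF this smooth_on_has_derivative[OF smooth_on_FD[OF smooth_L] assms, of "(w, 0)"]]
    have 2: "((\<lambda>z. 2 * FD (\<lambda>z. FD L z (0, w)) z (0, B z)) has_derivative
        (\<lambda>h. T w (snd z, 0) h + FD (\<lambda>z. FD L z (0, w)) z (snd h, 0) - FD (\<lambda>z. FD L z (w, 0)) z h)) (at z)"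
      by (rule has_derivative_transform_within_open[OF _ open_Om assms]) (simp add: spray)
    show ?thesis
      using fun_cong[OF has_derivative_unique[OF 1 2], of "(0, b)"]
      by (simp add: N_def g_def H_def)
  qed
  show ?thesis
    using main[of w b] main[of b w] T_sym[of w "(0, B z)" b] T_sym[of w "(snd z, 0)" b]
      H_sym[OF assms, of "(w, 0)"] H_sym[OF assms, of "(b, 0)"] by simp
qed

section \<open>Linear algebra of J, G, \<eta> and \<xi>\<close>

lemma fst_J [simp]: "fst (J z X) = del z X"
  by (simp add: J_def)

lemma del_J [simp]: "del z (J z X) = - fst X"
  by (simp add: J_def del_def)

lemma snd_J: "snd (J z X) = - fst X - N z (del z X)"
  by (simp add: J_def)

lemma J_J: "z \<in> Om \<Longrightarrow> J z (J z X) = - X"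
  by (rule prod_eqI) (simp_all add: snd_J linear_neg[OF linear_N], simp add: del_def)

lemma fst_xi [simp]: "fst (xi z) = snd z"
  by (simp add: xi_def)

lemma del_xi [simp]: "del z (xi z) = 0"
  by (simp add: xi_def del_def)

text \<open>The left side is d\<eta> with the differentiation index last. Splitting
  \<open>snd Y\<close> and \<open>snd X\<close> into \<open>del\<close> and \<open>N\<close> parts,
  the two terms with \<open>N\<close> form the expression of \<open>g_N_antisym\<close>, which
  cancels the mixed second derivatives of L.\<close>

lemma omega: "z \<in> Om \<Longrightarrow> H z (0, fst X) Y - H z (0, fst Y) X = G z X (J z Y)"
proof -
  assume z: "z \<in> Om"
  have "g z (fst X) (snd Y) = g z (fst X) (del z Y) - g z (fst X) (N z (fst Y))" for X Y
    by (simp add: del_def linear_add[OF linear_g2[OF z]])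
  note 1 = this[of X Y] this[of Y X]
  have "H z (0, fst X) Y = H z (0, fst X) (fst Y, 0) + g z (fst X) (snd Y)" for X Y
    unfolding g_def by (rule H_split[OF z])
  note 2 = this[of X Y] this[of Y X]
  show ?thesis
    unfolding 2 1 using g_N_antisym[OF z, of "fst X" "fst Y"]
    by (simp add: G_def linear_neg[OF linear_g2[OF z]] g_sym[OF z, of "del z X"])
qed

lemma G_J_J: "z \<in> Om \<Longrightarrow> G z (J z X) (J z Y) = G z X Y"
  by (simp add: G_def linear_neg[OF linear_g2] linear_neg[OF linear_g1])

lemma G_pos: "z \<in> Om \<Longrightarrow> X \<noteq> 0 \<Longrightarrow> G z X X > 0"
proof -
  assume z: "z \<in> Om" and "X \<noteq> 0"
  have p: "g z a a \<ge> 0" "g z a a > 0 \<longleftrightarrow> a \<noteq> 0" for a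
    using pos[OF z, of a] linear_0[OF linear_g2[OF z, of a]]
    by (cases "a = 0"; force simp: g_def H_def)+
  have "fst X \<noteq> 0 \<or> del z X \<noteq> 0"
    using \<open>X \<noteq> 0\<close> linear_0[OF linear_N[OF z]] by (auto simp: del_def prod_eq_iff)
  then show ?thesis
    unfolding G_def using p(1)[of "fst X"] p(1)[of "del z X"] p(2)[of "fst X"] p(2)[of "del z X"]
    by linarith
qed

text \<open>By \<open>L_N\<close> the derivative along a horizontal vector is zero, so only the
  vertical part \<open>del z X\<close> counts.\<close>

lemma dL_del: "z \<in> Om \<Longrightarrow> FD L z X = FD L z (0, del z X)"
proof -
  assume z: "z \<in> Om"
  have "FD L z (0, del z X) = FD L z (0, snd X) + FD L z (0, N z (fst X))"
    using linear_add[OF linear_L[OF z], of "(0, snd X)" "(0, N z (fst X))"] by (simp add: del_def)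
  then show ?thesis using L_N[OF z] L_split[OF z, of X] by simp
qed

lemma th_J: "z \<in> Om \<Longrightarrow> th z (J z X) = FD L z X"
  by (simp add: th_def dL_del[of z X])

lemma L_neg: "z \<in> Om \<Longrightarrow> FD L z (0, - a) = - FD L z (0, a)"
  using linear_neg[OF linear_L, of z "(0, a)"] by simp

lemma dL_J: "z \<in> Om \<Longrightarrow> FD L z (J z X) = - th z X"
  by (simp add: dL_del[of z "J z X"] th_def L_neg)

lemma dL_xi: "z \<in> Om \<Longrightarrow> FD L z (xi z) = 0"
  using linear_0[OF linear_L[of z]] by (simp add: dL_del[of z "xi z"] zero_prod_def)

lemma th_xi: "z \<in> Om \<Longrightarrow> th z (xi z) = 2 * L z"
  by (simp add: th_def euler)

lemma G_xi: "z \<in> Om \<Longrightarrow> G z X (xi z) = th z X"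
  by (simp add: G_def th_def th_eq_g g_sym[of z "fst X" "snd z"] linear_0[OF linear_g2])

section \<open>Contact identities at a point of the level set \<open>2 L = 1\<close>\<close>

context
  fixes z assumes z: "z \<in> Om" and L1: "2 * L z = 1"
begin

lemma th_xi1: "th z (xi z) = 1" using z L1 by (simp add: th_xi)

lemma th_D: "th z (X - th z X *\<^sub>R xi z) = 0"
  by (simp add: linear_diff[OF linear_th[OF z]] linear_cmul[OF linear_th[OF z]] th_xi1)

lemma dL_D: "FD L z (X - th z X *\<^sub>R xi z) = FD L z X"
  using dL_xi[OF z] linear_L[OF z] by (simp add: linear_diff linear_cmul)

lemma phi_xi: "phi z (xi z) = 0"
  using linear_0[OF linear_J[OF z]] by (simp add: phi_def th_xi1)

lemma dL_phi: "FD L z (phi z X) = 0"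
  by (simp add: phi_def dL_J[OF z] th_D)

text \<open>\<open>th_J\<close> turns the claim into the vanishing of dL on \<open>X\<close> minus
  its \<open>xi\<close> component, and removing a multiple of \<open>xi\<close> does not change
  dL.\<close>

lemma th_phi: "FD L z X = 0 \<Longrightarrow> th z (phi z X) = 0"
  by (simp add: phi_def th_J[OF z] dL_D)

lemma phi_phi: "FD L z X = 0 \<Longrightarrow> phi z (phi z X) = - X + th z X *\<^sub>R xi z"
  using J_J[OF z, of "X - th z X *\<^sub>R xi z"] th_phi[of X]
  by (subst phi_def) (simp add: phi_def[of z X])

text \<open>\<open>J\<close> is an isometry and \<open>th\<close> is the \<open>G\<close>-dual of
  the unit vector \<open>xi\<close>, so removing the \<open>xi\<close> component is orthogonal
  projection.\<close>

lemma G_phi_phi: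
  "G z (phi z X) (phi z Y) = G z X Y - th z X * th z Y"
proof -
  let ?P = "\<lambda>X. X - th z X *\<^sub>R xi z"
  have "G z (phi z X) (phi z Y) = G z (?P X) (?P Y)"
    unfolding phi_def by (rule G_J_J[OF z])
  also have "\<dots> = G z X (?P Y) - th z X * G z (xi z) (?P Y)"
    using linear_diff[OF linear_G1[OF z], of X _ "?P Y"] linear_cmul[OF linear_G1[OF z], of _ "xi z" "?P Y"]
    by simp
  also have "G z (xi z) (?P Y) = 0"
    using G_xi[OF z, of "?P Y"] G_sym[OF z] th_D by metis
  also have "G z X (?P Y) = G z X Y - th z Y * G z X (xi z)"
    using linear_diff[OF linear_G2[OF z], of X Y] linear_cmul[OF linear_G2[OF z], of X _ "xi z"] by simp
  finally show ?thesis by (simp add: G_xi[OF z])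
qed

text \<open>\<open>phi\<close> and \<open>J\<close> differ by a multiple of
  \<open>J z (xi z) = (0, - snd z)\<close>, whose product with \<open>X\<close> is
  \<open>- FD L z X\<close>.\<close>

lemma G_phi: "FD L z X = 0 \<Longrightarrow> G z X (phi z Y) = G z X (J z Y)"
proof -
  assume X: "FD L z X = 0"
  have "G z X (J z (xi z)) = - FD L z X"
    using dL_del[OF z, of X]
    by (simp add: G_def linear_0[OF linear_g2[OF z]] linear_neg[OF linear_g2[OF z]]
        th_eq_g[OF z] g_sym[OF z, of "del z X"])
  then show ?thesis
    using X linear_G2[OF z, of X] linear_J[OF z] by (simp add: phi_def linear_diff linear_cmul)
qed

end

section \<open>Smoothness of the pointwise objects along a smooth map\<close>

context
  fixes S :: "'c::euclidean_space set" and k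
  assumes S: "open S" and k: "smooth_on S k" "\<And>x. x \<in> S \<Longrightarrow> k x \<in> Om"
begin

lemma smooth_on_g:
  "smooth_on S v \<Longrightarrow> smooth_on S w \<Longrightarrow> smooth_on S (\<lambda>x. g (k x) (v x) (w x))"
  unfolding g_def H_def
  by (intro smooth_on_FD_FD_compose[OF S open_Om smooth_L k] smooth_on_Pair S smooth_on_const)

lemma smooth_on_N: "smooth_on S w \<Longrightarrow> smooth_on S (\<lambda>x. N (k x) (w x))"
  unfolding N_def by (intro smooth_on_FD_compose[OF S smooth_B k] smooth_on_Pair S smooth_on_const)

lemma smooth_on_del: "smooth_on S w \<Longrightarrow> smooth_on S (\<lambda>x. del (k x) (w x))"
  unfolding del_def by (intro smooth_on_add smooth_on_N smooth_on_fst smooth_on_snd S)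

lemma smooth_on_G:
  "smooth_on S v \<Longrightarrow> smooth_on S w \<Longrightarrow> smooth_on S (\<lambda>x. G (k x) (v x) (w x))"
  unfolding G_def by (intro smooth_on_add smooth_on_g smooth_on_del smooth_on_fst S)

lemma smooth_on_th: "smooth_on S w \<Longrightarrow> smooth_on S (\<lambda>x. th (k x) (w x))"
  unfolding th_def
  by (intro smooth_on_FD_compose[OF S smooth_L k] smooth_on_Pair smooth_on_const smooth_on_fst S)

lemma smooth_on_J: "smooth_on S w \<Longrightarrow> smooth_on S (\<lambda>x. J (k x) (w x))"
  unfolding J_def
  by (intro smooth_on_Pair smooth_on_diff smooth_on_minus smooth_on_N smooth_on_del smooth_on_fst S)

lemma smooth_on_xi: "smooth_on S (\<lambda>x. xi (k x))"
  unfolding xi_def by (intro smooth_on_Pair smooth_on_minus smooth_on_N smooth_on_snd S k)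

lemma smooth_on_phi: "smooth_on S w \<Longrightarrow> smooth_on S (\<lambda>x. phi (k x) (w x))"
  unfolding phi_def
  by (intro smooth_on_J smooth_on_diff smooth_on_scaleR smooth_on_th smooth_on_xi S)

end

end

text \<open>\<open>\<phi>\<close> is the change of base coordinates, and its tangent map carries
  \<open>L\<close> to \<open>L'\<close>; \<open>B\<close> and \<open>B'\<close> are linked only
  through their own spray equations. \<open>Om0\<close> is the overlap in the first coordinates.
  Surjectivity of \<open>FD \<phi>\<close> lets every test vector be written as an image.\<close>

locale spray_change =
  A: spray_coords Om L B + A': spray_coords Om' L' B'
  for Om :: "('e::euclidean_space \<times> 'e) set" and L B
    and Om' :: "('e::euclidean_space \<times> 'e) set" and L' B' +
  fixes Om0 :: "('e::euclidean_space \<times> 'e) set" and S :: "'e set" and \<phi> :: "'e \<Rightarrow> 'e"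
  assumes open_Om0: "open Om0" and Om0: "Om0 \<subseteq> Om" and open_S: "open S"
    and smooth_\<phi>: "smooth_on S \<phi>"
    and fst_S: "z \<in> Om0 \<Longrightarrow> fst z \<in> S"
    and \<Phi>_Om': "z \<in> Om0 \<Longrightarrow> (\<phi> (fst z), FD \<phi> (fst z) (snd z)) \<in> Om'"
    and L_\<Phi>: "z \<in> Om0 \<Longrightarrow> L' (\<phi> (fst z), FD \<phi> (fst z) (snd z)) = L z"
    and surj_\<phi>: "z \<in> Om0 \<Longrightarrow> surj (FD \<phi> (fst z))"
begin

definition \<Phi> where "\<Phi> z = (\<phi> (fst z), FD \<phi> (fst z) (snd z))"
text \<open>The second derivative of the coordinate change; it measures how far B, N and the fibre
  components are from transforming as tensors.\<close>

definition Q where "Q x u v = FD (\<lambda>x. FD \<phi> x u) x v"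
definition d\<Phi> where
  "d\<Phi> z X = (FD \<phi> (fst z) (fst X), Q (fst z) (snd z) (fst X) + FD \<phi> (fst z) (snd X))"

lemma linear_\<phi>: "x \<in> S \<Longrightarrow> linear (FD \<phi> x)"
  using smooth_\<phi> by (rule smooth_on_linear_FD)

lemma Q_sym: "x \<in> S \<Longrightarrow> Q x u v = Q x v u"
  unfolding Q_def by (rule FD_symmetric[OF open_S smooth_\<phi>])

lemma linear_Q2: "x \<in> S \<Longrightarrow> linear (Q x u)"
  unfolding Q_def using smooth_on_FD[OF smooth_\<phi>] by (rule smooth_on_linear_FD)

lemma linear_Q1: "x \<in> S \<Longrightarrow> linear (\<lambda>u. Q x u v)"
  unfolding Q_def by (rule FD_FD_linear[OF open_S smooth_\<phi>])

lemma has_derivative_\<phi>_vary: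
  assumes "z \<in> Om0" "(w has_derivative w') (at z)"
  shows "((\<lambda>z. FD \<phi> (fst z) (w z)) has_derivative
     (\<lambda>h. Q (fst z) (w z) (fst h) + FD \<phi> (fst z) (w' h))) (at z)"
  using FD_compose_apply_has_derivative[OF open_S smooth_\<phi> has_derivative_fst[OF has_derivative_ident]
      fst_S[OF assms(1)] assms(2)]
  unfolding Q_def .

lemma has_derivative_\<Phi>: "z \<in> Om0 \<Longrightarrow> (\<Phi> has_derivative d\<Phi> z) (at z)"
proof -
  assume z: "z \<in> Om0"
  have "(\<phi> has_derivative FD \<phi> (fst z)) (at (fst z))"
    by (rule smooth_on_has_derivative[OF smooth_\<phi> fst_S[OF z]])
  from has_derivative_compose[OF has_derivative_fst[OF has_derivative_ident] this]
  have "((\<lambda>z. \<phi> (fst z)) has_derivative (\<lambda>h. FD \<phi> (fst z) (fst h))) (at z)" .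
  moreover have "((\<lambda>z. FD \<phi> (fst z) (snd z)) has_derivative
      (\<lambda>h. Q (fst z) (snd z) (fst h) + FD \<phi> (fst z) (snd h))) (at z)"
    by (rule has_derivative_\<phi>_vary[OF z]) (auto intro!: derivative_eq_intros)
  ultimately show ?thesis
    unfolding \<Phi>_def[abs_def] d\<Phi>_def[abs_def] by (rule has_derivative_Pair)
qed

lemma Om0_D:
  assumes "z \<in> Om0"
  shows "z \<in> Om" "fst z \<in> S" "\<Phi> z \<in> Om'"
  using assms Om0 fst_S \<Phi>_Om' by (auto simp: \<Phi>_def)

lemma dL_\<Phi>:
  assumes "z \<in> Om0"
  shows "FD L z X = FD L' (\<Phi> z) (d\<Phi> z X)"
proof -
  have "((\<lambda>z. L' (\<Phi> z)) has_derivative (\<lambda>X. FD L' (\<Phi> z) (d\<Phi> z X))) (at z)"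
    by (rule has_derivative_compose[OF has_derivative_\<Phi>[OF assms]
          smooth_on_has_derivative[OF A'.smooth_L Om0_D(3)[OF assms]]])
  from has_derivative_transform_within_open[OF this open_Om0 assms, of L]
  show ?thesis by (simp add: L_\<Phi> \<Phi>_def FD_eqI)
qed

lemma dLy_\<Phi>: "z \<in> Om0 \<Longrightarrow> FD L z (0, w) = FD L' (\<Phi> z) (0, FD \<phi> (fst z) w)"
  using dL_\<Phi>[of z "(0, w)"] linear_0[OF linear_Q2[OF Om0_D(2)]] linear_0[OF linear_\<phi>[OF Om0_D(2)]]
  by (simp add: d\<Phi>_def)

lemma th_\<Phi>: "z \<in> Om0 \<Longrightarrow> A.th z X = A'.th (\<Phi> z) (d\<Phi> z X)"
  unfolding A.th_def A'.th_def by (simp add: dLy_\<Phi> d\<Phi>_def)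

context
  fixes z assumes z: "z \<in> Om0"
begin

lemmas z_mem = Om0_D[OF z]

text \<open>The extra term arises because the vertical vector
  \<open>(0, FD \<phi> (fst z) w)\<close> varies with the base point.\<close>

lemma H_\<Phi>:
  "A.H z (0, w) h = A'.H (\<Phi> z) (0, FD \<phi> (fst z) w) (d\<Phi> z h) + FD L' (\<Phi> z) (0, Q (fst z) w (fst h))"
proof -
  have "((\<lambda>z. (0, FD \<phi> (fst z) w)) has_derivative (\<lambda>h. (0, Q (fst z) w (fst h)))) (at z)"
    using has_derivative_Pair[OF has_derivative_const has_derivative_\<phi>_vary[OF z has_derivative_const[of w]]]
      linear_0[OF linear_\<phi>[OF z_mem(2)]] by simp
  from FD_compose_apply_has_derivative[OF A'.open_Om A'.smooth_L has_derivative_\<Phi>[OF z] z_mem(3) this]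
  have "((\<lambda>z. FD L' (\<Phi> z) (0, FD \<phi> (fst z) w)) has_derivative
      (\<lambda>h. A'.H (\<Phi> z) (0, FD \<phi> (fst z) w) (d\<Phi> z h) + FD L' (\<Phi> z) (0, Q (fst z) w (fst h)))) (at z)"
    unfolding A'.H_def .
  from has_derivative_transform_within_open[OF this open_Om0 z, of "\<lambda>z. FD L z (0, w)"]
  show ?thesis by (simp add: A.H_def dLy_\<Phi> FD_eqI)
qed

lemma g_\<Phi>: "A.g z a b = A'.g (\<Phi> z) (FD \<phi> (fst z) a) (FD \<phi> (fst z) b)"
  using H_\<Phi>[of a "(0, b)"] linear_0[OF linear_Q2[OF z_mem(2)]] linear_0[OF linear_\<phi>[OF z_mem(2)]]
    linear_0[OF A'.linear_L[OF z_mem(3)]]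
  by (simp add: A.g_def A'.g_def d\<Phi>_def zero_prod_def)

text \<open>Both sides are paired with \<open>FD \<phi> (fst z) w\<close>. Transforming the spray
  equation produces two \<open>Q\<close> terms under dL, which cancel by symmetry of
  \<open>Q\<close>, and one under \<open>g\<close>, which remains. Surjectivity lets the difference
  be paired with itself, and positivity makes it vanish.\<close>

lemma B_\<Phi>: "2 *\<^sub>R B' (\<Phi> z) = 2 *\<^sub>R FD \<phi> (fst z) (B z) - Q (fst z) (snd z) (snd z)"
proof -
  let ?x = "fst z" and ?y = "snd z"
  define v where "v = 2 *\<^sub>R FD \<phi> ?x (B z) - Q ?x ?y ?y - 2 *\<^sub>R B' (\<Phi> z)"
  have "A'.g (\<Phi> z) (FD \<phi> ?x w) v = 0" for w
  proof -
    have lg: "linear (A'.g (\<Phi> z) (FD \<phi> ?x w))" by (rule A'.linear_g2[OF z_mem(3)])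
    have "2 * A.g z w (B z) = A.H z (0, w) (?y, 0) - FD L z (w, 0)"
      by (rule A.spray'[OF z_mem(1)])
    also have "A.H z (0, w) (?y, 0) =
        A'.H (\<Phi> z) (0, FD \<phi> ?x w) (FD \<phi> ?x ?y, Q ?x ?y ?y) + FD L' (\<Phi> z) (0, Q ?x w ?y)"
      by (simp add: H_\<Phi> d\<Phi>_def linear_0[OF linear_\<phi>[OF z_mem(2)]])
    also have "A'.H (\<Phi> z) (0, FD \<phi> ?x w) (FD \<phi> ?x ?y, Q ?x ?y ?y) =
        A'.H (\<Phi> z) (0, FD \<phi> ?x w) (FD \<phi> ?x ?y, 0) + A'.g (\<Phi> z) (FD \<phi> ?x w) (Q ?x ?y ?y)"
      using A'.H_split[OF z_mem(3), of "(0, FD \<phi> ?x w)" "(FD \<phi> ?x ?y, Q ?x ?y ?y)"]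
      by (simp add: A'.g_def)
    also have "FD L z (w, 0) = FD L' (\<Phi> z) (FD \<phi> ?x w, 0) + FD L' (\<Phi> z) (0, Q ?x ?y w)"
      using A'.L_split[OF z_mem(3), of "d\<Phi> z (w, 0)"]
      by (simp add: dL_\<Phi>[OF z] d\<Phi>_def linear_0[OF linear_\<phi>[OF z_mem(2)]])
    also have "A.g z w (B z) = A'.g (\<Phi> z) (FD \<phi> ?x w) (FD \<phi> ?x (B z))"
      by (rule g_\<Phi>)
    finally show ?thesis
      using A'.spray'[OF z_mem(3), of "FD \<phi> ?x w"] Q_sym[OF z_mem(2), of ?y w] lg
      by (simp add: v_def linear_diff linear_cmul \<Phi>_def)
  qed
  moreover obtain w where "v = FD \<phi> ?x w" using surj_\<phi>[OF z] by (metis surjD)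
  ultimately have "A'.g (\<Phi> z) v v = 0" by simp
  then have "v = 0" using A'.pos[OF z_mem(3), of v] by (force simp: A'.g_def A'.H_def)
  then show ?thesis by (simp add: v_def)
qed

end

context
  fixes z assumes z: "z \<in> Om0"
begin

lemmas z_mem' = Om0_D[OF z]

text \<open>Differentiate \<open>B_\<Phi>\<close> along the fibre over a fixed base point; the
  quadratic term \<open>Q x y y\<close> turns into twice \<open>Q x y\<close>, so the factors 2 drop
  out.\<close>

lemma N_\<Phi>: "A'.N (\<Phi> z) (FD \<phi> (fst z) b) = FD \<phi> (fst z) (A.N z b) - Q (fst z) (snd z) b"
proof -
  let ?x = "fst z"
  define U where "U = {y. (?x, y) \<in> Om0}"
  have U: "open U"
    unfolding U_def by (rule open_vimage[OF open_Om0, unfolded vimage_def])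
      (auto intro!: continuous_intros)
  have yU: "snd z \<in> U" using z by (simp add: U_def)
  have in2: "((\<lambda>y. (?x, y)) has_derivative (\<lambda>h. (0, h))) (at (snd z))"
    by (auto intro!: derivative_eq_intros)
  have "((\<lambda>y. \<Phi> (?x, y)) has_derivative (\<lambda>h. d\<Phi> z (0, h))) (at (snd z))"
    using diff_chain_at[OF in2, of \<Phi> "d\<Phi> z"] has_derivative_\<Phi>[OF z] by (simp add: o_def)
  from diff_chain_at[OF this, of B' "FD B' (\<Phi> z)"] A'.has_derivative_B[OF z_mem'(3)]
  have "((\<lambda>y. B' (\<Phi> (?x, y))) has_derivative (\<lambda>h. FD B' (\<Phi> z) (d\<Phi> z (0, h)))) (at (snd z))"
    by (simp add: o_def)
  from has_derivative_scaleR_right[OF this, of 2]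
  have 1: "((\<lambda>y. 2 *\<^sub>R B' (\<Phi> (?x, y))) has_derivative
      (\<lambda>h. 2 *\<^sub>R A'.N (\<Phi> z) (FD \<phi> ?x h))) (at (snd z))"
    by (simp add: A'.N_def d\<Phi>_def linear_0[OF linear_\<phi>[OF z_mem'(2)]] linear_0[OF linear_Q2[OF z_mem'(2)]])
  have "bilinear (Q ?x)"
    using linear_Q1[OF z_mem'(2)] linear_Q2[OF z_mem'(2)] by (simp add: bilinear_def)
  then have bQ: "bounded_bilinear (Q ?x)" by (simp add: bilinear_conv_bounded_bilinear)
  have "((\<lambda>y. B (?x, y)) has_derivative (\<lambda>h. FD B z (0, h))) (at (snd z))"
    using diff_chain_at[OF in2, of B "FD B z"] A.has_derivative_B[OF z_mem'(1)] by (simp add: o_def)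
  from diff_chain_at[OF this, of "FD \<phi> ?x" "FD \<phi> ?x"] linear_\<phi>[OF z_mem'(2)]
  have "((\<lambda>y. FD \<phi> ?x (B (?x, y))) has_derivative (\<lambda>h. FD \<phi> ?x (A.N z h))) (at (snd z))"
    by (simp add: o_def A.N_def bounded_linear_imp_has_derivative linear_conv_bounded_linear)
  from has_derivative_diff[OF has_derivative_scaleR_right[OF this, of 2]
      bounded_bilinear.FDERIV[OF bQ has_derivative_ident has_derivative_ident]]
  have "((\<lambda>y. 2 *\<^sub>R FD \<phi> ?x (B (?x, y)) - Q ?x y y) has_derivative
      (\<lambda>h. 2 *\<^sub>R FD \<phi> ?x (A.N z h) - 2 *\<^sub>R Q ?x (snd z) h)) (at (snd z))"
    by (simp add: Q_sym[OF z_mem'(2), of _ "snd z"] scaleR_2)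
  then have 2: "((\<lambda>y. 2 *\<^sub>R B' (\<Phi> (?x, y))) has_derivative
      (\<lambda>h. 2 *\<^sub>R FD \<phi> ?x (A.N z h) - 2 *\<^sub>R Q ?x (snd z) h)) (at (snd z))"
    by (rule has_derivative_transform_within_open[OF _ U yU]) (use B_\<Phi> in \<open>auto simp: U_def\<close>)
  have "2 *\<^sub>R A'.N (\<Phi> z) (FD \<phi> ?x b) = 2 *\<^sub>R (FD \<phi> ?x (A.N z b) - Q ?x (snd z) b)"
    using fun_cong[OF has_derivative_unique[OF 1 2], of b] by (simp add: scaleR_diff_right)
  then show ?thesis by simp
qed

text \<open>The \<open>Q\<close> terms of \<open>d\<Phi>\<close> and of \<open>N_\<Phi>\<close>
  cancel, so the splitting into horizontal and vertical parts is independent of coordinates; the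
  invariance of G, J and \<xi> comes from this.\<close>

lemma del_\<Phi>: "A'.del (\<Phi> z) (d\<Phi> z X) = FD \<phi> (fst z) (A.del z X)"
  unfolding A'.del_def A.del_def
  by (simp add: d\<Phi>_def N_\<Phi> linear_add[OF linear_\<phi>[OF z_mem'(2)]])

lemma G_\<Phi>: "A'.G (\<Phi> z) (d\<Phi> z X) (d\<Phi> z Y) = A.G z X Y"
  unfolding A.G_def A'.G_def del_\<Phi> g_\<Phi>[OF z] by (simp add: d\<Phi>_def)

lemma J_\<Phi>: "A'.J (\<Phi> z) (d\<Phi> z X) = d\<Phi> z (A.J z X)"
  unfolding A.J_def A'.J_def del_\<Phi> N_\<Phi>
  by (simp add: d\<Phi>_def linear_diff[OF linear_\<phi>[OF z_mem'(2)]] linear_neg[OF linear_\<phi>[OF z_mem'(2)]])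

lemma xi_\<Phi>: "A'.xi (\<Phi> z) = d\<Phi> z (A.xi z)"
  using N_\<Phi>[of "snd z"] unfolding A.xi_def A'.xi_def
  by (simp add: d\<Phi>_def \<Phi>_def linear_neg[OF linear_\<phi>[OF z_mem'(2)]])

end

end

section \<open>Atlases and tangent vectors\<close>

text \<open>The factorisation of \<open>r\<close> through \<open>k\<close> and \<open>m\<close> is
  asked only where both maps are under control, which suits transition maps and inclusions on
  overlaps.\<close>

lemma FD_chain_local:
  fixes k :: "'a::euclidean_space \<Rightarrow> 'b::euclidean_space" and m :: "'b \<Rightarrow> 'c::euclidean_space"
  assumes "open S" "smooth_on S k" "open T" "smooth_on T m" "z \<in> S" "k z \<in> T"
    "\<And>z. z \<in> S \<Longrightarrow> k z \<in> T \<Longrightarrow> m (k z) = r z"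
  shows "FD r z w = FD m (k z) (FD k z w)"
proof -
  have "open (S \<inter> k -` T)"
    using assms(1-3) by (intro continuous_open_preimage smooth_on_continuous_on)
  moreover have "((\<lambda>z. m (k z)) has_derivative (\<lambda>w. FD m (k z) (FD k z w))) (at z)"
    using has_derivative_compose[OF smooth_on_has_derivative[OF assms(2,5)]
        smooth_on_has_derivative[OF assms(4,6)]] .
  ultimately have "(r has_derivative (\<lambda>w. FD m (k z) (FD k z w))) (at z)"
    by (intro has_derivative_transform_within_open[of "\<lambda>z. m (k z)" _ _ _ "S \<inter> k -` T" r])
      (use assms in auto)
  from FD_eqI[OF this] show ?thesis by simp
qed

lemma carrierI: "c \<in> A \<Longrightarrow> p \<in> fst c \<Longrightarrow> p \<in> carrier_of A"
  unfolding carrier_of_def by blast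

lemma carrierE:
  assumes "p \<in> carrier_of A"
  obtains c where "c \<in> A" "p \<in> fst c"
  using assms unfolding carrier_of_def by blast

lemma chart_at:
  assumes "p \<in> carrier_of A"
  shows "chart_at A p \<in> A" "p \<in> fst (chart_at A p)"
proof -
  have "\<exists>c. c \<in> A \<and> p \<in> fst c" using assms by (blast elim: carrierE)
  from someI_ex[OF this] show "chart_at A p \<in> A" "p \<in> fst (chart_at A p)"
    unfolding chart_at_def by blast+
qed

locale atlas =
  fixes A :: "('p, 'e::euclidean_space) atlas"
  assumes atlas: "smooth_atlas A"
begin

lemma inj_chart: "c \<in> A \<Longrightarrow> inj_on (snd c) (fst c)"
  using atlas by (auto simp: smooth_atlas_def)

lemma open_chart_image: "c \<in> A \<Longrightarrow> open (chart_image c)"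
  using atlas by (auto simp: smooth_atlas_def)

lemma open_overlap: "c \<in> A \<Longrightarrow> d \<in> A \<Longrightarrow> open (snd c ` (fst c \<inter> fst d))"
  using atlas by (auto simp: smooth_atlas_def)

lemma smooth_transition:
  "c \<in> A \<Longrightarrow> d \<in> A \<Longrightarrow> smooth_on (snd c ` (fst c \<inter> fst d)) (snd d \<circ> chart_inv c)"
  using atlas by (auto simp: smooth_atlas_def)

lemma chart_inv_chart: "c \<in> A \<Longrightarrow> p \<in> fst c \<Longrightarrow> chart_inv c (snd c p) = p"
  unfolding chart_inv_def by (rule inv_into_f_f[OF inj_chart])

lemma chart_chart_inv: "z \<in> chart_image c \<Longrightarrow> snd c (chart_inv c z) = z"
  unfolding chart_inv_def chart_image_def by (rule f_inv_into_f)

lemma chart_inv_in: "z \<in> chart_image c \<Longrightarrow> chart_inv c z \<in> fst c"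
  unfolding chart_inv_def chart_image_def by (rule inv_into_into)

lemma chart_inv_carrier: "c \<in> A \<Longrightarrow> z \<in> chart_image c \<Longrightarrow> chart_inv c z \<in> carrier_of A"
  by (rule carrierI[OF _ chart_inv_in])

lemma chart_mem: "c \<in> A \<Longrightarrow> p \<in> fst c \<Longrightarrow> snd c p \<in> snd c ` (fst c \<inter> V) \<longleftrightarrow> p \<in> V"
  using inj_on_image_mem_iff[OF inj_chart, of c p "fst c \<inter> V"] by simp

lemma FD_transition_chain:
  assumes "c \<in> A" "d \<in> A" "e \<in> A" "p \<in> fst c" "p \<in> fst d" "p \<in> fst e"
  shows "FD (snd e \<circ> chart_inv c) (snd c p) w =
    FD (snd e \<circ> chart_inv d) (snd d p) (FD (snd d \<circ> chart_inv c) (snd c p) w)"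
proof -
  have "FD (snd e \<circ> chart_inv c) (snd c p) w =
      FD (snd e \<circ> chart_inv d) ((snd d \<circ> chart_inv c) (snd c p)) (FD (snd d \<circ> chart_inv c) (snd c p) w)"
  proof (rule FD_chain_local[OF open_overlap smooth_transition open_overlap smooth_transition])
    fix z assume z: "z \<in> snd c ` (fst c \<inter> fst d)"
      "(snd d \<circ> chart_inv c) z \<in> snd d ` (fst d \<inter> fst e)"
    then obtain q where q: "q \<in> fst c" "q \<in> fst d" "z = snd c q" by blast
    show "(snd e \<circ> chart_inv d) ((snd d \<circ> chart_inv c) z) = (snd e \<circ> chart_inv c) z"
      using q assms by (simp add: chart_inv_chart)
  qed (use assms in \<open>auto simp: chart_inv_chart\<close>)
  then show ?thesis using assms by (simp add: chart_inv_chart)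
qed

lemma FD_transition_id:
  assumes "c \<in> A" "p \<in> fst c"
  shows "FD (snd c \<circ> chart_inv c) (snd c p) w = w"
proof -
  have "FD (snd c \<circ> chart_inv c) (snd c p) = FD (\<lambda>z. z) (snd c p)"
    by (rule FD_cong[OF smooth_on_ident open_chart_image[OF assms(1)]])
      (use assms in \<open>auto simp: chart_inv_chart chart_image_def\<close>)
  then show ?thesis by simp
qed

lemma linear_transition:
  assumes "c \<in> A" "d \<in> A" "p \<in> fst c" "p \<in> fst d"
  shows "linear (FD (snd d \<circ> chart_inv c) (snd c p))"
  by (rule smooth_on_linear_FD[OF smooth_transition]) (use assms in auto)

lemma tangent_vec_apply:
  "d \<in> A \<Longrightarrow> p \<in> fst d \<Longrightarrow> tangent_vec A c p w d = FD (snd d \<circ> chart_inv c) (snd c p) w"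
  by (simp add: tangent_vec_def)

lemma tangent_vec_self: "c \<in> A \<Longrightarrow> p \<in> fst c \<Longrightarrow> tangent_vec A c p w c = w"
  by (simp add: tangent_vec_def FD_transition_id)

lemma tangent_space_transition:
  "X \<in> tangent_space A p \<Longrightarrow> c \<in> A \<Longrightarrow> d \<in> A \<Longrightarrow> p \<in> fst c \<Longrightarrow> p \<in> fst d
    \<Longrightarrow> X d = FD (snd d \<circ> chart_inv c) (snd c p) (X c)"
  unfolding tangent_space_def by blast

lemma tangent_space_outside: "X \<in> tangent_space A p \<Longrightarrow> \<not> (c \<in> A \<and> p \<in> fst c) \<Longrightarrow> X c = 0"
  unfolding tangent_space_def by blast

lemma tangent_spaceI:
  assumes "\<And>c. \<not> (c \<in> A \<and> p \<in> fst c) \<Longrightarrow> X c = 0"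
    and "\<And>c d. c \<in> A \<Longrightarrow> d \<in> A \<Longrightarrow> p \<in> fst c \<Longrightarrow> p \<in> fst d \<Longrightarrow>
      X d = FD (snd d \<circ> chart_inv c) (snd c p) (X c)"
  shows "X \<in> tangent_space A p"
  using assms unfolding tangent_space_def by blast

lemma tangent_vec_in:
  assumes "c \<in> A" "p \<in> fst c"
  shows "tangent_vec A c p w \<in> tangent_space A p"
proof (rule tangent_spaceI)
  fix d e assume d: "d \<in> A" "e \<in> A" "p \<in> fst d" "p \<in> fst e"
  show "tangent_vec A c p w e = FD (snd e \<circ> chart_inv d) (snd d p) (tangent_vec A c p w d)"
    unfolding tangent_vec_apply[OF d(1,3)] tangent_vec_apply[OF d(2,4)]
    by (rule FD_transition_chain) (use assms d in auto)
qed (auto simp: tangent_vec_def)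

lemma tangent_vec_component:
  "X \<in> tangent_space A p \<Longrightarrow> c \<in> A \<Longrightarrow> p \<in> fst c \<Longrightarrow> tangent_vec A c p (X c) = X"
  using tangent_space_transition[of X p c] tangent_space_outside[of X p]
  unfolding tangent_vec_def fun_eq_iff by metis

lemma tangent_space_eqI:
  "X \<in> tangent_space A p \<Longrightarrow> Y \<in> tangent_space A p \<Longrightarrow> c \<in> A \<Longrightarrow> p \<in> fst c \<Longrightarrow> X c = Y c \<Longrightarrow> X = Y"
  by (metis tangent_vec_component)

lemma tangent_space_lincomb:
  "X \<in> tangent_space A p \<Longrightarrow> Y \<in> tangent_space A p \<Longrightarrow>
    (\<lambda>c. a *\<^sub>R X c + b *\<^sub>R Y c) \<in> tangent_space A p"
proof (rule tangent_spaceI)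
  fix c d
  assume X: "X \<in> tangent_space A p" and Y: "Y \<in> tangent_space A p"
    and c: "c \<in> A" "d \<in> A" "p \<in> fst c" "p \<in> fst d"
  show "a *\<^sub>R X d + b *\<^sub>R Y d = FD (snd d \<circ> chart_inv c) (snd c p) (a *\<^sub>R X c + b *\<^sub>R Y c)"
    unfolding tangent_space_transition[OF X c] tangent_space_transition[OF Y c]
    by (simp add: linear_add[OF linear_transition[OF c]] linear_cmul[OF linear_transition[OF c]])
qed (simp add: tangent_space_outside)

lemma tangent_space_0: "(\<lambda>_. 0) \<in> tangent_space A p"
  by (rule tangent_spaceI) (simp_all add: linear_0[OF linear_transition])

lemma tangent_vec_eq_0_iff:
  "c \<in> A \<Longrightarrow> p \<in> fst c \<Longrightarrow> tangent_vec A c p w = (\<lambda>_. 0) \<longleftrightarrow> w = 0"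
  by (metis tangent_vec_self tangent_vec_component tangent_space_0)

lemma tangent_vec_linear:
  assumes "c \<in> A" "p \<in> fst c"
  shows "tangent_vec A c p (a *\<^sub>R v + b *\<^sub>R w) =
    (\<lambda>d. a *\<^sub>R tangent_vec A c p v d + b *\<^sub>R tangent_vec A c p w d)"
  using assms by (intro ext) (auto simp: tangent_vec_def linear_add[OF linear_transition] linear_cmul[OF linear_transition])

text \<open>\<open>differential\<close> is defined with a chosen chart; the chain rule along the
  transition map frees it from the choice.\<close>

lemma differential_eq:
  assumes h: "\<And>c. c \<in> A \<Longrightarrow> smooth_on (chart_image c) (h \<circ> chart_inv c)"
    and X: "X \<in> tangent_space A p" and c: "c \<in> A" "p \<in> fst c"
  shows "differential A h p X = FD (h \<circ> chart_inv c) (snd c p) (X c)"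
proof -
  define d where "d = chart_at A p"
  have "p \<in> carrier_of A" using c by (blast elim: carrierE intro: carrierI)
  then have d: "d \<in> A" "p \<in> fst d" by (auto simp: chart_at d_def)
  have "FD (h \<circ> chart_inv d) (snd d p) (X d) =
      FD (h \<circ> chart_inv c) ((snd c \<circ> chart_inv d) (snd d p)) (FD (snd c \<circ> chart_inv d) (snd d p) (X d))"
  proof (rule FD_chain_local[OF open_overlap smooth_transition open_chart_image h])
    fix z assume "z \<in> snd d ` (fst d \<inter> fst c)"
    then obtain q where "q \<in> fst d" "q \<in> fst c" "z = snd d q" by blast
    then show "(h \<circ> chart_inv c) ((snd c \<circ> chart_inv d) z) = (h \<circ> chart_inv d) z"
      using c d by (simp add: chart_inv_chart)
  qed (use c d in \<open>auto simp: chart_inv_chart chart_image_def\<close>)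
  then show ?thesis
    using c d tangent_space_transition[OF X d(1) c(1) d(2) c(2)]
    by (simp add: chart_inv_chart differential_def d_def[symmetric])
qed

section \<open>The topology generated by an atlas\<close>

lemma openin_atlas:
  "openin (atlas_topology A) W \<longleftrightarrow> W \<subseteq> carrier_of A \<and> (\<forall>c\<in>A. open (snd c ` (W \<inter> fst c)))"
proof -
  \<comment> \<open>\<open>topology\<close> returns the intended family only after this check;
    injectivity of the charts makes images commute with intersections.\<close>
  have "istopology (\<lambda>W. W \<subseteq> carrier_of A \<and> (\<forall>c\<in>A. open (snd c ` (W \<inter> fst c))))"
    unfolding istopology_def
  proof safe
    fix S T x c assume *: "\<forall>c\<in>A. open (snd c ` (S \<inter> fst c))" "\<forall>c\<in>A. open (snd c ` (T \<inter> fst c))" and c: "c \<in> A"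
    have "snd c ` (S \<inter> T \<inter> fst c) = snd c ` (S \<inter> fst c) \<inter> snd c ` (T \<inter> fst c)"
      using inj_chart[OF c] by (auto simp: inj_on_def image_iff)
    then show "open (snd c ` (S \<inter> T \<inter> fst c))" using * c by auto
  next
    fix K c assume *: "\<forall>S\<in>K. S \<subseteq> carrier_of A \<and> (\<forall>c\<in>A. open (snd c ` (S \<inter> fst c)))" and c: "c \<in> A"
    have "snd c ` (\<Union>K \<inter> fst c) = (\<Union>S\<in>K. snd c ` (S \<inter> fst c))" by auto
    then show "open (snd c ` (\<Union>K \<inter> fst c))" using * c by auto
  qed auto
  then show ?thesis unfolding atlas_topology_def by (simp add: topology_inverse')
qed

lemma openin_chart_domain: "c \<in> A \<Longrightarrow> openin (atlas_topology A) (fst c)"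
  unfolding openin_atlas using open_overlap by (auto simp: carrier_of_def Int_commute)

lemma topspace_atlas: "topspace (atlas_topology A) = carrier_of A"
proof (rule antisym)
  show "topspace (atlas_topology A) \<subseteq> carrier_of A" unfolding topspace_def by (auto simp: openin_atlas)
  show "carrier_of A \<subseteq> topspace (atlas_topology A)"
    using openin_chart_domain openin_subset unfolding carrier_of_def by blast
qed

lemma openin_chart_preimage:
  assumes "c \<in> A" "open V"
  shows "openin (atlas_topology A) {p \<in> fst c. snd c p \<in> V}"
  unfolding openin_atlas
proof safe
  fix d assume d: "d \<in> A"
  have "snd d ` ({p \<in> fst c. snd c p \<in> V} \<inter> fst d) =
      snd d ` (fst d \<inter> fst c) \<inter> (snd c \<circ> chart_inv d) -` V"
    using d by (auto simp: chart_inv_chart)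
  then show "open (snd d ` ({p \<in> fst c. snd c p \<in> V} \<inter> fst d))"
    using continuous_open_preimage[OF smooth_on_continuous_on[OF smooth_transition[OF d assms(1)]]
        open_overlap[OF d assms(1)] assms(2)] by simp
qed (use assms in \<open>auto simp: carrier_of_def\<close>)

text \<open>Preimages of a countable base of the model space under countably many charts form a
  base.\<close>

lemma second_countable_atlasI:
  assumes "countable C" "C \<subseteq> A" "carrier_of A \<subseteq> (\<Union>c\<in>C. fst c)"
  shows "second_countable (atlas_topology A)"
proof -
  obtain B :: "'e set set" where B: "countable B" "\<And>b. b \<in> B \<Longrightarrow> open b"
    "\<And>S. open S \<Longrightarrow> \<exists>U. U \<subseteq> B \<and> S = \<Union>U"
    by (rule univ_second_countable) blast
  define E where "E = (\<lambda>(c, b). {p \<in> fst c. snd c p \<in> b}) ` (C \<times> B)"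
  have "countable E" unfolding E_def using assms(1) B(1) by auto
  moreover have "\<forall>V\<in>E. openin (atlas_topology A) V"
    unfolding E_def using openin_chart_preimage assms(2) B(2) by auto
  moreover have "\<exists>V\<in>E. p \<in> V \<and> V \<subseteq> U" if U: "openin (atlas_topology A) U" "p \<in> U" for U p
  proof -
    have "p \<in> carrier_of A" using U by (auto simp: openin_atlas)
    then obtain c where c: "c \<in> C" "p \<in> fst c" using assms(3) by auto
    then have cA: "c \<in> A" using assms(2) by auto
    have "open (snd c ` (U \<inter> fst c))" using U cA by (auto simp: openin_atlas)
    then obtain b where b: "b \<in> B" "snd c p \<in> b" "b \<subseteq> snd c ` (U \<inter> fst c)"
      using B(3)[of "snd c ` (U \<inter> fst c)"] U c by blast
    have "{p \<in> fst c. snd c p \<in> b} \<subseteq> U"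
    proof safe
      fix q assume "q \<in> fst c" "snd c q \<in> b"
      then obtain q' where "q' \<in> U" "q' \<in> fst c" "snd c q = snd c q'" using b(3) by auto
      then show "q \<in> U" using inj_onD[OF inj_chart[OF cA]] \<open>q \<in> fst c\<close> by metis
    qed
    then show ?thesis unfolding E_def using b c by blast
  qed
  ultimately show ?thesis unfolding second_countable_def by blast
qed

text \<open>A second countable space is Lindelof, so countably many chart domains cover; one chart
  is then picked for each domain.\<close>

lemma second_countable_atlasD:
  assumes "second_countable (atlas_topology A)"
  obtains C where "countable C" "C \<subseteq> A" "carrier_of A \<subseteq> (\<Union>c\<in>C. fst c)"
proof -
  have "\<exists>V. countable V \<and> V \<subseteq> fst ` A \<and> topspace (atlas_topology A) \<subseteq> \<Union>V"
    using second_countable_imp_Lindelof_space[OF assms] openin_chart_domain topspace_atlas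
    unfolding Lindelof_space_def
    by (metis (no_types, lifting) carrier_of_def image_iff order_refl)
  then obtain V where V: "countable V" "V \<subseteq> fst ` A" "carrier_of A \<subseteq> \<Union>V"
    by (auto simp: topspace_atlas)
  obtain C where "C \<subseteq> A" "countable C" "V = fst ` C"
    using V(1,2) by (meson countable_subset_image)
  then show ?thesis using V that by auto
qed

end

section \<open>Embedded submanifolds\<close>

text \<open>\<open>cover\<close> is what makes \<open>N\<close> an embedded submanifold:
  \<open>submanifold_atlas\<close> merely collects the charts that happen to exist.\<close>

locale submanifold = atlas A for A :: "('p, 'e::euclidean_space) atlas" +
  fixes N :: "'p set" and I :: "('p, 'f::euclidean_space) atlas"
  assumes N: "N \<subseteq> carrier_of A" and I: "I = submanifold_atlas A N"
    and cover: "carrier_of I = N"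
begin

lemma I_D:
  assumes "c \<in> I"
  shows "openin (subtopology (atlas_topology A) N) (fst c)" "inj_on (snd c) (fst c)"
    "open (snd c ` fst c)"
    "d \<in> A \<Longrightarrow> open (snd c ` (fst c \<inter> fst d))"
    "d \<in> A \<Longrightarrow> smooth_on (snd c ` (fst c \<inter> fst d)) (snd d \<circ> chart_inv c)"
  using assms unfolding I submanifold_atlas_def by (auto simp: chart_inv_def)

lemma I_sub: "c \<in> I \<Longrightarrow> fst c \<subseteq> N"
  using openin_subset[OF I_D(1), of c] by simp

lemma I_left_inverse:
  assumes "c \<in> I" "d \<in> A" "p \<in> fst c" "p \<in> fst d"
  obtains W h where "open W" "snd d p \<in> W" "smooth_on W h"
    "\<And>q. q \<in> fst c \<Longrightarrow> q \<in> fst d \<Longrightarrow> snd d q \<in> W \<Longrightarrow> h (snd d q) = snd c q"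
proof -
  have "\<forall>d\<in>A. \<forall>p\<in>fst c \<inter> fst d. \<exists>W h. open W \<and> snd d p \<in> W \<and> smooth_on W h \<and>
      (\<forall>q\<in>fst c \<inter> fst d. snd d q \<in> W \<longrightarrow> h (snd d q) = snd c q)"
    using assms(1) unfolding I submanifold_atlas_def by (cases c) simp
  with assms(2-4) have "\<exists>W h. open W \<and> snd d p \<in> W \<and> smooth_on W h \<and>
      (\<forall>q\<in>fst c \<inter> fst d. snd d q \<in> W \<longrightarrow> h (snd d q) = snd c q)" by blast
  then show thesis using that by blast
qed

lemma I_inv: "c \<in> I \<Longrightarrow> p \<in> fst c \<Longrightarrow> chart_inv c (snd c p) = p"
  unfolding chart_inv_def by (rule inv_into_f_f[OF I_D(2)])

lemma open_I_chart:
  assumes c: "c \<in> I" and V: "openin (atlas_topology A) V"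
  shows "open (snd c ` (fst c \<inter> V))"
proof (subst open_subopen, rule ballI)
  fix z assume "z \<in> snd c ` (fst c \<inter> V)"
  then obtain p where p: "p \<in> fst c" "p \<in> V" "z = snd c p" by auto
  then obtain d where d: "d \<in> A" "p \<in> fst d" using I_sub[OF c] N by (blast elim: carrierE intro: carrierI)
  let ?O = "snd c ` (fst c \<inter> fst d)"
  let ?T = "?O \<inter> (snd d \<circ> chart_inv c) -` (snd d ` (V \<inter> fst d))"
  have "open ?T"
    using V d by (intro continuous_open_preimage smooth_on_continuous_on I_D[OF c])
      (auto simp: openin_atlas)
  moreover have "z \<in> ?T" using p d c by (auto simp: I_inv)
  moreover have "?T \<subseteq> snd c ` (fst c \<inter> V)"
  proof
    fix y assume "y \<in> ?T"
    then obtain q where q: "q \<in> fst c" "q \<in> fst d" "y = snd c q"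
      "snd c q \<in> (snd d \<circ> chart_inv c) -` (snd d ` (V \<inter> fst d))" by blast
    then obtain q' where "snd d q = snd d q'" "q' \<in> V" "q' \<in> fst d" using c by (auto simp: I_inv)
    then have "q \<in> V" using inj_onD[OF inj_chart[OF d(1)], of q q'] q by auto
    then show "y \<in> snd c ` (fst c \<inter> V)" using q by auto
  qed
  ultimately show "\<exists>T. open T \<and> z \<in> T \<and> T \<subseteq> snd c ` (fst c \<inter> V)" by blast
qed

lemma open_I_overlap:
  assumes "c \<in> I" "c' \<in> I"
  shows "open (snd c ` (fst c \<inter> fst c'))"
proof -
  obtain V where "openin (atlas_topology A) V" "fst c' = V \<inter> N"
    using I_D(1)[OF assms(2)] by (auto simp: openin_subtopology)
  moreover have "fst c \<inter> (V \<inter> N) = fst c \<inter> V" using I_sub[OF assms(1)] by auto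
  ultimately show ?thesis using open_I_chart[OF assms(1)] by metis
qed

text \<open>Near a point the transition is the inclusion, read in an ambient chart, followed by the
  smooth local extension \<open>h\<close> of \<open>c'\<close>.\<close>

lemma smooth_I_transition:
  assumes c: "c \<in> I" and c': "c' \<in> I"
  shows "smooth_on (snd c ` (fst c \<inter> fst c')) (snd c' \<circ> chart_inv c)"
proof (rule smooth_on_local)
  fix z assume "z \<in> snd c ` (fst c \<inter> fst c')"
  then obtain p where p: "p \<in> fst c" "p \<in> fst c'" "z = snd c p" by auto
  then obtain d where d: "d \<in> A" "p \<in> fst d" using I_sub[OF c] N by (blast elim: carrierE intro: carrierI)
  obtain W h where h: "open W" "snd d p \<in> W" "smooth_on W h"
    "\<And>q. q \<in> fst c' \<Longrightarrow> q \<in> fst d \<Longrightarrow> snd d q \<in> W \<Longrightarrow> h (snd d q) = snd c' q"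
    using I_left_inverse[OF c' d(1) p(2) d(2)] by blast
  let ?O = "snd c ` (fst c \<inter> fst d)"
  let ?T = "snd c ` (fst c \<inter> fst c') \<inter> (?O \<inter> (snd d \<circ> chart_inv c) -` W)"
  have T: "open ?T"
    using d h open_I_overlap[OF c c']
    by (intro open_Int continuous_open_preimage smooth_on_continuous_on I_D[OF c]) auto
  moreover have "z \<in> ?T" using p d c h by (auto simp: I_inv)
  moreover have "smooth_on ?T (snd c' \<circ> chart_inv c)"
  proof (rule smooth_on_cong[OF _ T])
    show "smooth_on ?T (\<lambda>z. h ((snd d \<circ> chart_inv c) z))"
      by (rule smooth_on_compose[OF T h(3) smooth_on_subset[OF I_D(5)[OF c d(1)]]]) auto
    fix y assume y: "y \<in> ?T"
    then obtain q where q: "q \<in> fst c" "q \<in> fst c'" "y = snd c q" by auto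
    obtain q' where q': "q' \<in> fst c" "q' \<in> fst d" "y = snd c q'" using y by auto
    have "q' = q" using q q' inj_onD[OF I_D(2)[OF c], of q q'] by auto
    then show "h ((snd d \<circ> chart_inv c) y) = (snd c' \<circ> chart_inv c) y"
      using y q q' c h(4)[of q] by (auto simp: I_inv)
  qed
  ultimately show "\<exists>W. open W \<and> z \<in> W \<and> smooth_on W (snd c' \<circ> chart_inv c)" by blast
qed

lemma smooth_atlas_I: "smooth_atlas I"
  unfolding smooth_atlas_def chart_image_def
  using I_D(2,3) open_I_overlap smooth_I_transition by blast

sublocale Sub: atlas I
  by unfold_locales (rule smooth_atlas_I)

text \<open>Agreement with the subspace topology lets the Hausdorff property and second countability
  be inherited. A set open in the charts of \<open>I\<close> is cut out of \<open>N\<close> near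
  each point by the preimage of its chart image under the ambient extension
  \<open>h\<close>.\<close>

lemma openin_I: "openin (atlas_topology I) X \<longleftrightarrow> openin (subtopology (atlas_topology A) N) X"
proof
  assume "openin (subtopology (atlas_topology A) N) X"
  then obtain V where V: "openin (atlas_topology A) V" "X = V \<inter> N" by (auto simp: openin_subtopology)
  have "X \<inter> fst c = fst c \<inter> V" if "c \<in> I" for c using I_sub[OF that] V by auto
  then show "openin (atlas_topology I) X"
    unfolding Sub.openin_atlas using open_I_chart V cover by auto
next
  assume X: "openin (atlas_topology I) X"
  show "openin (subtopology (atlas_topology A) N) X"
  proof (subst openin_subopen, safe)
    fix p assume p: "p \<in> X"
    then have pN: "p \<in> N" using X cover by (auto simp: Sub.openin_atlas)
    then obtain c where c: "c \<in> I" "p \<in> fst c" using cover by (blast elim: carrierE intro: carrierI)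
    obtain d where d: "d \<in> A" "p \<in> fst d" using pN N by (blast elim: carrierE intro: carrierI)
    obtain W h where h: "open W" "snd d p \<in> W" "smooth_on W h"
      "\<And>q. q \<in> fst c \<Longrightarrow> q \<in> fst d \<Longrightarrow> snd d q \<in> W \<Longrightarrow> h (snd d q) = snd c q"
      using I_left_inverse[OF c(1) d(1) c(2) d(2)] by blast
    obtain V where V: "openin (atlas_topology A) V" "fst c = V \<inter> N"
      using I_D(1)[OF c(1)] by (auto simp: openin_subtopology)
    let ?O = "snd c ` (X \<inter> fst c)"
    have O: "open ?O" using X c by (auto simp: Sub.openin_atlas)
    define V1 where "V1 = V \<inter> {q \<in> fst d. snd d q \<in> W \<inter> h -` ?O}"
    have "openin (atlas_topology A) V1"
      unfolding V1_def
      by (intro openin_Int V openin_chart_preimage d continuous_open_preimage smooth_on_continuous_on h O)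
    moreover have "p \<in> V1" using p c d h V unfolding V1_def by auto
    moreover have "V1 \<inter> N \<subseteq> X"
    proof safe
      fix q assume q: "q \<in> V1" "q \<in> N"
      then have qc: "q \<in> fst c" "q \<in> fst d" "snd d q \<in> W" "h (snd d q) \<in> ?O"
        unfolding V1_def using V by auto
      then obtain q' where q': "q' \<in> X" "q' \<in> fst c" "snd c q = snd c q'" using h(4)[of q] by auto
      then show "q \<in> X" using inj_onD[OF I_D(2)[OF c(1)], of q q'] qc by auto
    qed
    ultimately show "\<exists>T. openin (subtopology (atlas_topology A) N) T \<and> p \<in> T \<and> T \<subseteq> X"
      using pN by (intro exI[of _ "V1 \<inter> N"]) (auto simp: openin_subtopology)
  qed
qed

lemma topology_I: "atlas_topology I = subtopology (atlas_topology A) N"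
  by (simp add: topology_eq openin_I)

lemma smooth_manifold_I:
  assumes "smooth_manifold A"
  shows "smooth_manifold I"
  using assms unfolding smooth_manifold_def topology_I
  by (simp add: smooth_atlas_I Hausdorff_space_subtopology second_countable_subtopology)

section \<open>The inclusion on tangent vectors\<close>

abbreviation incl where "incl c d p \<equiv> FD (snd d \<circ> chart_inv c) (snd c p)"

lemma linear_incl:
  assumes "c \<in> I" "d \<in> A" "p \<in> fst c" "p \<in> fst d"
  shows "linear (incl c d p)"
  by (rule smooth_on_linear_FD[OF I_D(5)]) (use assms in auto)

lemma incl_chain:
  assumes "c \<in> I" "d \<in> A" "d' \<in> A" "p \<in> fst c" "p \<in> fst d" "p \<in> fst d'"
  shows "incl c d' p w = FD (snd d' \<circ> chart_inv d) (snd d p) (incl c d p w)"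
proof -
  have "incl c d' p w =
      FD (snd d' \<circ> chart_inv d) ((snd d \<circ> chart_inv c) (snd c p)) (incl c d p w)"
  proof (rule FD_chain_local[OF I_D(4) I_D(5) open_overlap smooth_transition])
    fix z assume "z \<in> snd c ` (fst c \<inter> fst d)"
    then obtain q where "q \<in> fst c" "q \<in> fst d" "z = snd c q" by blast
    then show "(snd d' \<circ> chart_inv d) ((snd d \<circ> chart_inv c) z) = (snd d' \<circ> chart_inv c) z"
      using assms by (simp add: chart_inv_chart I_inv)
  qed (use assms in \<open>auto simp: chart_inv_chart I_inv\<close>)
  then show ?thesis using assms by (simp add: I_inv)
qed

lemma incl_chain':
  assumes "c \<in> I" "c' \<in> I" "d \<in> A" "p \<in> fst c" "p \<in> fst c'" "p \<in> fst d"
  shows "incl c d p w = incl c' d p (FD (snd c' \<circ> chart_inv c) (snd c p) w)"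
proof -
  have "incl c d p w =
      FD (snd d \<circ> chart_inv c') ((snd c' \<circ> chart_inv c) (snd c p)) (FD (snd c' \<circ> chart_inv c) (snd c p) w)"
  proof (rule FD_chain_local[OF open_I_overlap smooth_I_transition I_D(4) I_D(5)])
    fix z assume "z \<in> snd c ` (fst c \<inter> fst c')"
    then obtain q where "q \<in> fst c" "q \<in> fst c'" "z = snd c q" by blast
    then show "(snd d \<circ> chart_inv c') ((snd c' \<circ> chart_inv c) z) = (snd d \<circ> chart_inv c) z"
      using assms by (simp add: I_inv)
  qed (use assms in \<open>auto simp: I_inv\<close>)
  then show ?thesis using assms by (simp add: I_inv)
qed

lemma FD_left_inverse:
  assumes "c \<in> I" "d \<in> A" "open W" "smooth_on W h"
    "\<And>q. q \<in> fst c \<Longrightarrow> q \<in> fst d \<Longrightarrow> snd d q \<in> W \<Longrightarrow> h (snd d q) = snd c q"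
    and p: "p \<in> fst c" "p \<in> fst d" "snd d p \<in> W"
  shows "FD h (snd d p) (incl c d p w) = w"
proof -
  have "FD (\<lambda>z. z) (snd c p) w = FD h ((snd d \<circ> chart_inv c) (snd c p)) (incl c d p w)"
    by (rule FD_chain_local[OF I_D(4) I_D(5) assms(3,4)]) (use assms in \<open>auto simp: I_inv\<close>)
  then show ?thesis using assms by (simp add: I_inv)
qed

lemma inj_incl:
  assumes "c \<in> I" "d \<in> A" "p \<in> fst c" "p \<in> fst d"
  shows "inj (incl c d p)"
proof -
  obtain W h where h: "open W" "snd d p \<in> W" "smooth_on W h"
    "\<And>q. q \<in> fst c \<Longrightarrow> q \<in> fst d \<Longrightarrow> snd d q \<in> W \<Longrightarrow> h (snd d q) = snd c q"
    using I_left_inverse[OF assms] by blast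
  show ?thesis
    by (rule inj_on_inverseI[of _ "FD h (snd d p)"])
      (rule FD_left_inverse[OF assms(1,2) h(1,3,4) assms(3,4) h(2)])
qed

abbreviation psh where "psh p \<equiv> tangent_map I A (\<lambda>q. q) p"

lemma psh_apply:
  assumes "X \<in> tangent_space I p" "c \<in> I" "d \<in> A" "p \<in> fst c" "p \<in> fst d"
  shows "psh p X d = incl c d p (X c)"
proof -
  define c' where "c' = chart_at I p"
  have "p \<in> carrier_of I" using assms by (blast elim: carrierE intro: carrierI)
  then have c': "c' \<in> I" "p \<in> fst c'" by (auto simp: chart_at c'_def)
  have "psh p X d = incl c' d p (X c')"
    using assms by (simp add: tangent_map_def c'_def Let_def comp_def)
  also have "X c' = FD (snd c' \<circ> chart_inv c) (snd c p) (X c)"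
    by (rule Sub.tangent_space_transition[OF assms(1,2) c'(1) assms(4) c'(2)])
  also have "incl c' d p \<dots> = incl c d p (X c)"
    by (rule incl_chain'[symmetric]) (use assms c' in auto)
  finally show ?thesis .
qed

lemma psh_in: "X \<in> tangent_space I p \<Longrightarrow> p \<in> N \<Longrightarrow> psh p X \<in> tangent_space A p"
proof -
  assume X: "X \<in> tangent_space I p" and p: "p \<in> N"
  obtain c where c: "c \<in> I" "p \<in> fst c" using p cover by (blast elim: carrierE intro: carrierI)
  have "psh p X d = 0" if "\<not> (d \<in> A \<and> p \<in> fst d)" for d
    using that by (simp add: tangent_map_def del: not_all de_Morgan_conj)
  moreover have "psh p X d' = FD (snd d' \<circ> chart_inv d) (snd d p) (psh p X d)"
    if "d \<in> A" "d' \<in> A" "p \<in> fst d" "p \<in> fst d'" for d d'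
    unfolding psh_apply[OF X c(1) that(1) c(2) that(3)] psh_apply[OF X c(1) that(2) c(2) that(4)]
    by (rule incl_chain[OF c(1) that(1,2) c(2) that(3,4)])
  ultimately show ?thesis by (intro tangent_spaceI)
qed

lemma psh_eqI:
  assumes "X \<in> tangent_space I p" "Y \<in> tangent_space A p" "c \<in> I" "d \<in> A" "p \<in> fst c" "p \<in> fst d"
    "incl c d p (X c) = Y d"
  shows "psh p X = Y"
proof -
  have "p \<in> N" using assms(3,5) I_sub by blast
  then show ?thesis
    by (intro tangent_space_eqI[OF psh_in[OF assms(1)] assms(2,4,6)])
      (use assms in \<open>auto simp: psh_apply[OF assms(1,3)]\<close>)
qed

text \<open>The inclusion is injective, so its image has dimension \<open>DIM('f)\<close>; it lies
  in the kernel of the nonzero functional \<open>m\<close>, which has the same dimension.\<close>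

lemma range_incl_hypersurface:
  fixes m :: "'e \<Rightarrow> real"
  assumes "c \<in> I" "d \<in> A" "p \<in> fst c" "p \<in> fst d" and m: "linear m" "m v \<noteq> 0"
    and 0: "\<And>w. m (incl c d p w) = 0" and dim: "DIM('f) = DIM('e) - 1"
  shows "range (incl c d p) = {v. m v = 0}"
proof -
  obtain a where a: "\<And>v. m v = a \<bullet> v"
    using adjoint_works[OF m(1), of _ 1] by (metis inner_commute inner_real_def mult.right_neutral)
  have "a \<noteq> 0" using a[of v] m(2) by auto
  then have "dim {v. m v = 0} = DIM('e) - 1" unfolding a by (rule dim_hyperplane)
  moreover have "dim (range (incl c d p)) = DIM('f)"
    using dim_image_eq[of "incl c d p" UNIV] linear_incl[OF assms(1-4)] inj_incl[OF assms(1-4)] by simp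
  ultimately show ?thesis
    using dim 0 linear_incl[OF assms(1-4)] subspace_hyperplane[of a]
    by (intro subspace_dim_equal) (auto simp: linear_subspace_image a)
qed

end

section \<open>Coordinate formulas for a Finsler function\<close>

lemma linear_axis_expansion:
  fixes T :: "real^'n \<Rightarrow> 'b::real_vector"
  assumes "linear T"
  shows "T a = (\<Sum>j\<in>UNIV. a $ j *\<^sub>R T (axis j 1))"
proof -
  have "T a = T (\<Sum>j\<in>UNIV. a $ j *\<^sub>R axis j 1)"
    by (rule arg_cong[where f = T]) (auto simp: vec_eq_iff axis_def if_distrib cong: if_cong)
  then show ?thesis using assms by (simp add: linear_sum linear_cmul)
qed

lemma matrix_inv_right:
  fixes A :: "real^'n^'n"
  assumes "invertible A"
  shows "A ** matrix_inv A = mat 1"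
proof -
  have "\<exists>A'. A ** A' = mat 1 \<and> A' ** A = mat 1" using assms by (simp add: invertible_def)
  from someI_ex[OF this] show ?thesis by (simp add: matrix_inv_def)
qed

lemma smooth_on_det:
  fixes A :: "'a::euclidean_space \<Rightarrow> real^'n^'n"
  assumes "open S" "\<And>i j. smooth_on S (\<lambda>z. A z $ i $ j)"
  shows "smooth_on S (\<lambda>z. det (A z))"
  unfolding det_def
  by (intro smooth_on_sum smooth_on_mult smooth_on_prod smooth_on_const assms)

text \<open>By Cramer's rule the components are quotients of determinants of matrices with smooth
  entries.\<close>

lemma smooth_on_matrix_inv_mult:
  fixes A :: "'a::euclidean_space \<Rightarrow> real^'n^'n"
  assumes "open S" "\<And>i j. smooth_on S (\<lambda>z. A z $ i $ j)" "\<And>i. smooth_on S (\<lambda>z. b z $ i)"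
    and inv: "\<And>z. z \<in> S \<Longrightarrow> invertible (A z)"
  shows "smooth_on S (\<lambda>z. matrix_inv (A z) *v b z)"
proof (rule smooth_on_cong[OF _ assms(1)])
  have num: "smooth_on S (\<lambda>z. det (\<chi> i j. if j = k then b z $ i else A z $ i $ j))" for k
  proof (rule smooth_on_det[OF assms(1)])
    show "smooth_on S (\<lambda>z. (\<chi> i j. if j = k then b z $ i else A z $ i $ j) $ i $ j)" for i j
      using assms(2,3) by (cases "j = k") auto
  qed
  show "smooth_on S (\<lambda>z. \<chi> k. det (\<chi> i j. if j = k then b z $ i else A z $ i $ j) / det (A z))"
    using inv num by (intro smooth_on_vec_lambda smooth_on_divide num smooth_on_det[OF assms(1,2)] assms(1))
      (auto simp: invertible_det_nz)
  fix z assume "z \<in> S"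
  then have i: "invertible (A z)" by (rule inv)
  then have "A z *v (matrix_inv (A z) *v b z) = b z"
    by (simp add: matrix_vector_mul_assoc matrix_inv_right)
  then show "(\<chi> k. det (\<chi> i j. if j = k then b z $ i else A z $ i $ j) / det (A z)) =
      matrix_inv (A z) *v b z"
    using cramer[of "A z"] i by (simp add: invertible_det_nz)
qed

locale finsler_factor =
  fixes U :: "(real^'n) set" and F :: "real^'n \<Rightarrow> real^'n \<Rightarrow> real"
  assumes open_U: "open U"
    and smooth_F: "smooth_on (U \<times> (- {0})) (\<lambda>(x, y). F x y)"
    and homogeneous: "x \<in> U \<Longrightarrow> t > 0 \<Longrightarrow> F x (t *\<^sub>R y) = t * F x y"
    and positive: "x \<in> U \<Longrightarrow> y \<noteq> 0 \<Longrightarrow> F x y > 0"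
    and convex: "x \<in> U \<Longrightarrow> y \<noteq> 0 \<Longrightarrow> w \<noteq> 0 \<Longrightarrow> w \<bullet> (fundamental_tensor F x y *v w) > 0"
begin

definition K where "K z = (F (fst z) (snd z))\<^sup>2"
definition Om where "Om = U \<times> (- {0 :: real^'n})"
text \<open>Half of it, on vertical vectors, is the fundamental tensor; this is the origin of the
  factors 1/2 and 2 below.\<close>

definition HK where "HK z X Y = FD (\<lambda>z. FD K z X) z Y"

lemma open_Om: "open Om"
  unfolding Om_def by (intro open_Times open_U) auto

lemma smooth_K: "smooth_on Om K"
  unfolding K_def[abs_def] using smooth_F
  by (intro smooth_on_power open_Om) (simp add: Om_def case_prod_beta')

lemma linear_K: "z \<in> Om \<Longrightarrow> linear (FD K z)"
  using smooth_K by (rule smooth_on_linear_FD)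

lemma HK_sym: "z \<in> Om \<Longrightarrow> HK z X Y = HK z Y X"
  unfolding HK_def by (rule FD_symmetric[OF open_Om smooth_K])

lemma linear_HK2: "z \<in> Om \<Longrightarrow> linear (HK z X)"
  unfolding HK_def using smooth_on_FD[OF smooth_K] by (rule smooth_on_linear_FD)

lemma linear_HK1: "z \<in> Om \<Longrightarrow> linear (\<lambda>X. HK z X Y)"
  unfolding HK_def by (rule FD_FD_linear[OF open_Om smooth_K])

lemma partial_snd:
  assumes k: "smooth_on Om k" and "(x, y) \<in> Om"
  shows "partial j (\<lambda>y. k (x, y)) y = FD k (x, y) (0, axis j 1)"
proof -
  have "((\<lambda>y. (x, y)) has_derivative (\<lambda>h. (0, h))) (at y)" by (auto intro!: derivative_eq_intros)
  from FD_eqI[OF has_derivative_compose[OF this smooth_on_has_derivative[OF assms]]]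
  show ?thesis by (simp add: partial_def)
qed

lemma partial_fst:
  assumes k: "smooth_on Om k" and "(x, y) \<in> Om"
  shows "partial j (\<lambda>x. k (x, y)) x = FD k (x, y) (axis j 1, 0)"
proof -
  have "((\<lambda>x. (x, y)) has_derivative (\<lambda>h. (h, 0))) (at x)" by (auto intro!: derivative_eq_intros)
  from FD_eqI[OF has_derivative_compose[OF this smooth_on_has_derivative[OF assms]]]
  show ?thesis by (simp add: partial_def)
qed

text \<open>The inner partial derivatives are known in closed form only on the slit domain, so the
  function is replaced only there; the slice of the domain over \<open>x\<close> is open, which is
  enough for the outer derivative.\<close>

lemma partial_snd_cong:
  assumes k: "smooth_on Om k" and "(x, y) \<in> Om"
    and eq: "\<And>y. (x, y) \<in> Om \<Longrightarrow> k (x, y) = l y"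
  shows "partial j l y = FD k (x, y) (0, axis j 1)"
proof -
  have o: "open {y. (x, y) \<in> Om}"
    by (rule open_vimage[OF open_Om, unfolded vimage_def]) (auto intro!: continuous_intros)
  have "((\<lambda>y. (x, y)) has_derivative (\<lambda>h. (0, h))) (at y)" by (auto intro!: derivative_eq_intros)
  from has_derivative_compose[OF this smooth_on_has_derivative[OF assms(1,2)]]
  have "((\<lambda>y. k (x, y)) has_derivative (\<lambda>h. FD k (x, y) (0, h))) (at y)" .
  then have "(l has_derivative (\<lambda>h. FD k (x, y) (0, h))) (at y)"
    by (rule has_derivative_transform_within_open[OF _ o]) (use assms in auto)
  from FD_eqI[OF this] show ?thesis by (simp add: partial_def)
qed

lemma partial_y: "(x, y) \<in> Om \<Longrightarrow> partial j (\<lambda>y. (F x y)\<^sup>2) y = FD K (x, y) (0, axis j 1)"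
  using partial_snd[OF smooth_K, of x y j] by (simp add: K_def)

lemma partial_x: "(x, y) \<in> Om \<Longrightarrow> partial j (\<lambda>x. (F x y)\<^sup>2) x = FD K (x, y) (axis j 1, 0)"
  using partial_fst[OF smooth_K, of x y j] by (simp add: K_def)

lemma partial_y_y:
  "(x, y) \<in> Om \<Longrightarrow> partial i (\<lambda>y. partial j (\<lambda>y. (F x y)\<^sup>2) y) y =
    HK (x, y) (0, axis j 1) (0, axis i 1)"
  unfolding HK_def by (rule partial_snd_cong[OF smooth_on_FD[OF smooth_K]]) (simp_all add: partial_y)

lemma partial_y_x:
  "(x, y) \<in> Om \<Longrightarrow> partial i (\<lambda>y. partial j (\<lambda>x. (F x y)\<^sup>2) x) y =
    HK (x, y) (axis j 1, 0) (0, axis i 1)"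
  unfolding HK_def by (rule partial_snd_cong[OF smooth_on_FD[OF smooth_K]]) (simp_all add: partial_x)

lemma linear_inr: "linear (\<lambda>a. (0, a))" and linear_inl: "linear (\<lambda>a. (a, 0))"
  by (auto intro: linearI)

lemma fundamental_tensor_mult:
  assumes "(x, y) \<in> Om"
  shows "(fundamental_tensor F x y *v b) $ i = 1/2 * HK (x, y) (0, axis i 1) (0, b)"
proof -
  have "linear (\<lambda>b. HK (x, y) (0, axis i 1) (0, b))"
    using linear_compose[OF linear_inr linear_HK2[OF assms]] by (simp add: o_def)
  from linear_axis_expansion[OF this, of b] show ?thesis
    by (simp add: matrix_vector_mult_def fundamental_tensor_def partial_y_y[OF assms]
        HK_sym[OF assms, of "(0, axis _ 1)" "(0, axis i 1)"] sum_distrib_left mult_ac)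
qed

lemma fundamental_tensor_form:
  assumes "(x, y) \<in> Om"
  shows "a \<bullet> (fundamental_tensor F x y *v b) = 1/2 * HK (x, y) (0, a) (0, b)"
proof -
  have "linear (\<lambda>a. HK (x, y) (0, a) (0, b))"
    using linear_compose[OF linear_inr linear_HK1[OF assms]] by (simp add: o_def)
  from linear_axis_expansion[OF this, of a] show ?thesis
    by (simp add: inner_vec_def fundamental_tensor_mult[OF assms] sum_distrib_left mult_ac)
qed

lemma fundamental_tensor_sum:
  assumes "(x, y) \<in> Om"
  shows "(\<Sum>i\<in>UNIV. \<Sum>j\<in>UNIV. fundamental_tensor F x y $ i $ j * a $ i * b $ j) =
    1/2 * HK (x, y) (0, a) (0, b)"
  unfolding fundamental_tensor_form[OF assms, symmetric]
  by (simp add: inner_vec_def matrix_vector_mult_def sum_distrib_left mult_ac)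

lemma HK_pos: "(x, y) \<in> Om \<Longrightarrow> w \<noteq> 0 \<Longrightarrow> HK (x, y) (0, w) (0, w) > 0"
  using convex[of x y w] fundamental_tensor_form[of x y w w] by (simp add: Om_def)

lemma invertible_fundamental_tensor:
  assumes "(x, y) \<in> Om"
  shows "invertible (fundamental_tensor F x y)"
proof -
  have "\<forall>w. fundamental_tensor F x y *v w = 0 \<longrightarrow> w = 0"
    using convex[of x y] assms by (force simp: Om_def)
  then show ?thesis
    by (simp add: invertible_left_inverse matrix_left_invertible_ker)
qed

lemma HK_matrix_inv:
  assumes "(x, y) \<in> Om"
  shows "HK (x, y) (0, w) (0, matrix_inv (fundamental_tensor F x y) *v b) = 2 * (w \<bullet> b)"
  using fundamental_tensor_form[OF assms, of w "matrix_inv (fundamental_tensor F x y) *v b"]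
    invertible_fundamental_tensor[OF assms]
  by (simp add: matrix_vector_mul_assoc matrix_inv_right)

text \<open>The bracket in the formula for the spray coefficients, as a vector over its free index
  \<open>h\<close>.\<close>

definition spray_rhs where
  "spray_rhs z = (\<chi> h. HK z (snd z, 0) (0, axis h 1) - FD K z (axis h 1, 0))"

lemma spray_eq:
  assumes "(x, y) \<in> Om"
  shows "spray F x y = (1/4 :: real) *\<^sub>R (matrix_inv (fundamental_tensor F x y) *v spray_rhs (x, y))"
proof -
  have "(\<Sum>j\<in>UNIV. partial h (\<lambda>y. partial j (\<lambda>x. (F x y)\<^sup>2) x) y * y $ j) - partial h (\<lambda>x. (F x y)\<^sup>2) x
      = spray_rhs (x, y) $ h" for h
  proof -
    have "linear (\<lambda>a. HK (x, y) (a, 0) (0, axis h 1))"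
      using linear_compose[OF linear_inl linear_HK1[OF assms]] by (simp add: o_def)
    from linear_axis_expansion[OF this, of y] show ?thesis
      by (simp add: spray_rhs_def partial_y_x[OF assms] partial_x[OF assms] mult_ac)
  qed
  then show ?thesis
    by (simp add: spray_def matrix_vector_mult_def vec_eq_iff)
qed

lemma spray_rhs_inner:
  assumes "(x, y) \<in> Om"
  shows "w \<bullet> spray_rhs (x, y) = HK (x, y) (0, w) (y, 0) - FD K (x, y) (w, 0)"
proof -
  have "linear (\<lambda>a. HK (x, y) (y, 0) (0, a) - FD K (x, y) (a, 0))"
    using linear_compose[OF linear_inr linear_HK2[OF assms]] linear_compose[OF linear_inl linear_K[OF assms]]
    by (intro linear_compose_sub) (simp_all add: o_def)
  from linear_axis_expansion[OF this, of w] show ?thesis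
    by (simp add: inner_vec_def spray_rhs_def HK_sym[OF assms, of "(0, w)"])
qed

text \<open>Differentiate \<open>K (x, t y) = t\<^sup>2 K (x, y)\<close> at
  \<open>t = 1\<close>.\<close>

lemma euler_K:
  assumes "(x, y) \<in> Om"
  shows "FD K (x, y) (0, y) = 2 * K (x, y)"
proof -
  have "((\<lambda>t. (x, t *\<^sub>R y)) has_derivative (\<lambda>h. (0, h *\<^sub>R y))) (at 1)"
    by (auto intro!: derivative_eq_intros)
  from has_derivative_compose[OF this, of K "FD K (x, y)"] smooth_on_has_derivative[OF smooth_K assms]
  have 1: "((\<lambda>t. K (x, t *\<^sub>R y)) has_derivative (\<lambda>h. FD K (x, y) (0, h *\<^sub>R y))) (at 1)" by simp
  have "((\<lambda>t. t\<^sup>2 * K (x, y)) has_derivative (\<lambda>h. 2 * h * K (x, y))) (at (1::real))"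
    by (auto intro!: derivative_eq_intros)
  then have 2: "((\<lambda>t. K (x, t *\<^sub>R y)) has_derivative (\<lambda>h. 2 * h * K (x, y))) (at 1)"
    by (rule has_derivative_transform_within_open[of _ _ _ _ "{0<..}"])
      (use assms in \<open>auto simp: K_def homogeneous power_mult_distrib Om_def\<close>)
  show ?thesis using fun_cong[OF has_derivative_unique[OF 1 2], of 1] by simp
qed

lemma smooth_HK:
  fixes k :: "'c::euclidean_space \<Rightarrow> (real^'n) \<times> (real^'n)"
  assumes "open S" "smooth_on S k" "\<And>x. x \<in> S \<Longrightarrow> k x \<in> Om" "smooth_on S v" "smooth_on S w"
  shows "smooth_on S (\<lambda>x. HK (k x) (v x) (w x))"
  unfolding HK_def by (rule smooth_on_FD_FD_compose[OF assms(1) open_Om smooth_K assms(2-5)])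

lemma smooth_fundamental_tensor: "smooth_on Om (\<lambda>z. fundamental_tensor F (fst z) (snd z) $ i $ j)"
proof (rule smooth_on_cong)
  show "smooth_on Om (\<lambda>z. 1/2 * HK z (0, axis j 1) (0, axis i 1))"
    by (intro smooth_on_mult smooth_HK smooth_on_const smooth_on_ident open_Om)
  show "1/2 * HK z (0, axis j 1) (0, axis i 1) = fundamental_tensor F (fst z) (snd z) $ i $ j"
    if "z \<in> Om" for z
    using that by (cases z) (simp add: fundamental_tensor_def partial_y_y)
qed (rule open_Om)

lemma smooth_matrix_inv:
  fixes k :: "'c::euclidean_space \<Rightarrow> (real^'n) \<times> (real^'n)"
  assumes "open S" "smooth_on S k" "\<And>x. x \<in> S \<Longrightarrow> k x \<in> Om" "smooth_on S b"
  shows "smooth_on S (\<lambda>x. matrix_inv (fundamental_tensor F (fst (k x)) (snd (k x))) *v b x)"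
proof (rule smooth_on_matrix_inv_mult[OF assms(1)])
  show "smooth_on S (\<lambda>x. fundamental_tensor F (fst (k x)) (snd (k x)) $ i $ j)" for i j
    using smooth_on_compose[OF assms(1) smooth_fundamental_tensor assms(2,3)] by simp
  show "smooth_on S (\<lambda>x. b x $ i)" for i by (intro smooth_on_vec_nth assms)
  show "invertible (fundamental_tensor F (fst (k x)) (snd (k x)))" if "x \<in> S" for x
    using assms(3)[OF that] by (simp add: invertible_fundamental_tensor)
qed

lemma smooth_spray_rhs:
  fixes k :: "'c::euclidean_space \<Rightarrow> (real^'n) \<times> (real^'n)"
  assumes "open S" "smooth_on S k" "\<And>x. x \<in> S \<Longrightarrow> k x \<in> Om"
  shows "smooth_on S (\<lambda>x. spray_rhs (k x))"
  unfolding spray_rhs_def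
  by (intro smooth_on_vec_lambda smooth_on_diff smooth_HK smooth_on_FD_compose[OF _ smooth_K]
      smooth_on_Pair smooth_on_snd smooth_on_const assms)

lemma smooth_spray:
  fixes k :: "'c::euclidean_space \<Rightarrow> (real^'n) \<times> (real^'n)"
  assumes "open S" "smooth_on S k" "\<And>x. x \<in> S \<Longrightarrow> k x \<in> Om"
  shows "smooth_on S (\<lambda>x. spray F (fst (k x)) (snd (k x)))"
proof (rule smooth_on_cong[OF _ assms(1)])
  show "smooth_on S (\<lambda>x. (1/4 :: real) *\<^sub>R (matrix_inv (fundamental_tensor F (fst (k x)) (snd (k x))) *v spray_rhs (k x)))"
    by (intro smooth_on_scaleR smooth_on_const smooth_matrix_inv smooth_spray_rhs assms)
  show "(1/4 :: real) *\<^sub>R (matrix_inv (fundamental_tensor F (fst (k x)) (snd (k x))) *v spray_rhs (k x)) =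
      spray F (fst (k x)) (snd (k x))" if "x \<in> S" for x
    using spray_eq[of "fst (k x)" "snd (k x)"] assms(3)[OF that] by simp
qed

text \<open>Pairing cancels the inverse matrix: the constant is 1/4 from the definition of the spray
  times 2 from \<open>HK_matrix_inv\<close>.\<close>

lemma HK_spray:
  assumes "(x, y) \<in> Om"
  shows "HK (x, y) (0, w) (0, spray F x y) = 1/2 * (HK (x, y) (0, w) (y, 0) - FD K (x, y) (w, 0))"
proof -
  have "linear (\<lambda>b. HK (x, y) (0, w) (0, b))"
    using linear_compose[OF linear_inr linear_HK2[OF assms]] by (simp add: o_def)
  from linear_cmul[OF this] show ?thesis
    using HK_matrix_inv[OF assms, of w "spray_rhs (x, y)"]
    by (simp add: spray_eq[OF assms] spray_rhs_inner[OF assms])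
qed

end

section \<open>Coordinate formulas for the warped product\<close>

locale warped_local =
  warped_coordinates F1 F2 f + P: finsler_factor U1 F1 + Q: finsler_factor U2 F2
  for U1 :: "(real^'n) set" and F1 :: "real^'n \<Rightarrow> real^'n \<Rightarrow> real"
    and U2 :: "(real^'m) set" and F2 :: "real^'m \<Rightarrow> real^'m \<Rightarrow> real" and f :: "real^'n \<Rightarrow> real" +
  assumes smooth_f: "smooth_on U1 f" and f_nonzero: "x \<in> U1 \<Longrightarrow> f x \<noteq> 0"
begin

definition Om :: "('n, 'm) tm set" where
  "Om = {z. fst (fst z) \<in> U1 \<and> snd (fst z) \<in> U2 \<and> fst (snd z) \<noteq> 0 \<and> snd (snd z) \<noteq> 0}"

definition p1 :: "('n, 'm) tm \<Rightarrow> (real^'n) \<times> (real^'n)" where "p1 z = (fst (fst z), fst (snd z))"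
definition p2 :: "('n, 'm) tm \<Rightarrow> (real^'m) \<times> (real^'m)" where "p2 z = (snd (fst z), snd (snd z))"
definition f2 where "f2 x = (f x)\<^sup>2"

text \<open>Half of the squared warped Finsler function; its vertical Hessian is the block diagonal
  tensor with blocks \<open>g_ij\<close> and \<open>f\<^sup>2 g_\<alpha>\<beta>\<close>.\<close>

definition L :: "('n, 'm) tm \<Rightarrow> real" where
  "L z = 1/2 * (P.K (p1 z) + f2 (fst (fst z)) * Q.K (p2 z))"

definition B :: "('n, 'm) tm \<Rightarrow> (real^'n) \<times> (real^'m)" where "B z = (B1 z, B2 z)"

lemma Om_eq: "Om = {z. p1 z \<in> P.Om \<and> p2 z \<in> Q.Om}"
  by (auto simp: Om_def p1_def p2_def P.Om_def Q.Om_def)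

lemma Om_D: "z \<in> Om \<Longrightarrow> p1 z \<in> P.Om" "z \<in> Om \<Longrightarrow> p2 z \<in> Q.Om" "z \<in> Om \<Longrightarrow> fst (fst z) \<in> U1"
  by (auto simp: Om_eq) (simp add: p1_def P.Om_def)

lemma bounded_linear_p1: "bounded_linear p1"
  unfolding p1_def
  by (intro bounded_linear_Pair bounded_linear_fst_comp bounded_linear_snd_comp
      bounded_linear_fst bounded_linear_snd bounded_linear_ident)

lemma bounded_linear_p2: "bounded_linear p2"
  unfolding p2_def
  by (intro bounded_linear_Pair bounded_linear_fst_comp bounded_linear_snd_comp
      bounded_linear_fst bounded_linear_snd bounded_linear_ident)

lemma open_Om: "open Om"
proof -
  have "Om = p1 -` P.Om \<inter> p2 -` Q.Om" by (auto simp: Om_eq)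
  then show ?thesis
    using linear_continuous_on[OF bounded_linear_p1, of UNIV] linear_continuous_on[OF bounded_linear_p2, of UNIV]
    by (auto intro!: open_Int open_vimage P.open_Om Q.open_Om)
qed

lemma smooth_p1: "smooth_on S p1" and smooth_p2: "smooth_on S p2"
  by (auto intro: smooth_on_linear bounded_linear_p1 bounded_linear_p2)

lemma smooth_f2: "smooth_on U1 f2"
  unfolding f2_def by (intro smooth_on_power smooth_f P.open_U)

lemma smooth_base: "smooth_on Om (\<lambda>z. fst (fst z))"
  by (intro smooth_on_fst smooth_on_ident open_Om)

lemma smooth_f2': "smooth_on Om (\<lambda>z. f2 (fst (fst z)))"
  by (rule smooth_on_compose[OF open_Om smooth_f2 smooth_base]) (rule Om_D)

lemma smooth_K1: "smooth_on Om (\<lambda>z. P.K (p1 z))" and smooth_K2: "smooth_on Om (\<lambda>z. Q.K (p2 z))"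
  by (auto intro: smooth_on_compose[OF open_Om P.smooth_K smooth_p1]
      smooth_on_compose[OF open_Om Q.smooth_K smooth_p2] simp: Om_D)

lemma smooth_L: "smooth_on Om L"
  unfolding L_def by (intro smooth_on_mult smooth_on_add smooth_on_const smooth_f2' smooth_K1 smooth_K2 open_Om)

lemma f2_pos: "x \<in> U1 \<Longrightarrow> f2 x > 0"
  using f_nonzero by (simp add: f2_def)

lemma has_derivative_f2:
  assumes "z \<in> Om"
  shows "((\<lambda>z. f2 (fst (fst z))) has_derivative (\<lambda>X. FD f2 (fst (fst z)) (fst (fst X)))) (at z)"
proof -
  have "((\<lambda>z :: ('n, 'm) tm. fst (fst z)) has_derivative (\<lambda>X. fst (fst X))) (at z)"
    by (auto intro!: derivative_eq_intros)
  from has_derivative_compose[OF this smooth_on_has_derivative[OF smooth_f2 Om_D(3)[OF assms]]]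
  show ?thesis .
qed

lemma has_derivative_p1: "(p1 has_derivative p1) (at z)" and has_derivative_p2: "(p2 has_derivative p2) (at z)"
  by (auto intro: bounded_linear_imp_has_derivative bounded_linear_p1 bounded_linear_p2)

lemma FD_L:
  assumes "z \<in> Om"
  shows "FD L z X = 1/2 * (FD P.K (p1 z) (p1 X) + (f2 (fst (fst z)) * FD Q.K (p2 z) (p2 X) +
    FD f2 (fst (fst z)) (fst (fst X)) * Q.K (p2 z)))"
proof -
  note d1 = has_derivative_compose[OF has_derivative_p1 smooth_on_has_derivative[OF P.smooth_K Om_D(1)[OF assms]]]
  note d2 = has_derivative_compose[OF has_derivative_p2 smooth_on_has_derivative[OF Q.smooth_K Om_D(2)[OF assms]]]
  show ?thesis
    unfolding L_def[abs_def]
    by (rule fun_cong[OF FD_eqI])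
      (intro has_derivative_mult_right has_derivative_add d1 has_derivative_mult has_derivative_f2 d2 assms)
qed

lemma p_inr [simp]: "p1 (0, w) = (0, fst w)" "p2 (0, w) = (0, snd w)"
  "p1 (w, 0) = (fst w, 0)" "p2 (w, 0) = (snd w, 0)"
  by (auto simp: p1_def p2_def)

lemma FD_L_vertical:
  assumes "z \<in> Om"
  shows "FD L z (0, w) = 1/2 * (FD P.K (p1 z) (0, fst w) + f2 (fst (fst z)) * FD Q.K (p2 z) (0, snd w))"
  using linear_0[OF smooth_on_linear_FD[OF smooth_f2 Om_D(3)[OF assms]]] by (simp add: FD_L[OF assms])

text \<open>The last summand is the effect of the warping: it appears when \<open>Y\<close> moves
  the base point of the first factor.\<close>

lemma H_vertical:
  assumes "z \<in> Om"
  shows "FD (\<lambda>z. FD L z (0, w)) z Y =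
    1/2 * (P.HK (p1 z) (0, fst w) (p1 Y) + (f2 (fst (fst z)) * Q.HK (p2 z) (0, snd w) (p2 Y) +
      FD f2 (fst (fst z)) (fst (fst Y)) * FD Q.K (p2 z) (0, snd w)))"
proof -
  note d1 = has_derivative_compose[OF has_derivative_p1
      smooth_on_has_derivative[OF smooth_on_FD[OF P.smooth_K] Om_D(1)[OF assms]], of "(0, fst w)", folded P.HK_def]
  note d2 = has_derivative_compose[OF has_derivative_p2
      smooth_on_has_derivative[OF smooth_on_FD[OF Q.smooth_K] Om_D(2)[OF assms]], of "(0, snd w)", folded Q.HK_def]
  show ?thesis
  proof (rule fun_cong[OF FD_eqI[OF has_derivative_transform_within_open[OF _ open_Om assms FD_L_vertical[symmetric]]]])
  qed (intro has_derivative_mult_right has_derivative_add d1 has_derivative_mult has_derivative_f2 d2 assms)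
qed

definition grad where "grad x = (\<chi> j. FD f2 x (axis j 1))"

lemma linear_f2: "x \<in> U1 \<Longrightarrow> linear (FD f2 x)"
  using smooth_f2 by (rule smooth_on_linear_FD)

lemma inner_grad: "x \<in> U1 \<Longrightarrow> w \<bullet> grad x = FD f2 x w"
  using linear_axis_expansion[OF linear_f2, of x w] by (simp add: inner_vec_def grad_def)

definition vgrad where "vgrad z = (\<chi> j. FD Q.K z (0, axis j 1))"

lemma inner_vgrad:
  assumes "z \<in> Q.Om"
  shows "w \<bullet> vgrad z = FD Q.K z (0, w)"
proof -
  have "linear (\<lambda>w. FD Q.K z (0, w))"
    using linear_compose[OF Q.linear_inr Q.linear_K[OF assms]] by (simp add: o_def)
  from linear_axis_expansion[OF this, of w] show ?thesis by (simp add: inner_vec_def vgrad_def)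
qed

lemma partial_f2: "partial j (\<lambda>x. (f x)\<^sup>2) x = FD f2 x (axis j 1)"
  by (simp add: partial_def f2_def[abs_def])

lemma B1_eq:
  assumes "z \<in> Om"
  shows "B1 z = spray F1 (fst (p1 z)) (snd (p1 z)) -
    (1/4 * Q.K (p2 z)) *\<^sub>R (matrix_inv (fundamental_tensor F1 (fst (p1 z)) (snd (p1 z))) *v grad (fst (fst z)))"
proof -
  obtain x u y v where "z = ((x, u), (y, v))" by (metis surj_pair)
  then show ?thesis
    by (simp add: B1_def p1_def p2_def vec_eq_iff matrix_vector_mult_def grad_def partial_f2 Q.K_def
        sum_distrib_left mult_ac)
qed

lemma B2_eq:
  assumes "z \<in> Om"
  shows "B2 z = spray F2 (fst (p2 z)) (snd (p2 z)) +
    (1 / (4 * f2 (fst (fst z))) * FD f2 (fst (fst z)) (fst (snd z))) *\<^sub>R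
      (matrix_inv (fundamental_tensor F2 (fst (p2 z)) (snd (p2 z))) *v vgrad (p2 z))"
proof -
  obtain x u y v where z: "z = ((x, u), (y, v))" by (metis surj_pair)
  have "(u, v) \<in> Q.Om" "x \<in> U1" using Om_D(2,3)[OF assms] by (auto simp: z p2_def)
  moreover have "(\<Sum>i\<in>UNIV. partial i (\<lambda>x. (f x)\<^sup>2) x * y $ i) = FD f2 x y"
    using linear_axis_expansion[OF linear_f2[OF \<open>x \<in> U1\<close>], of y] by (simp add: partial_f2 mult.commute)
  ultimately show ?thesis
    unfolding z
    by (simp add: B2_def p2_def vec_eq_iff matrix_vector_mult_def vgrad_def Q.partial_y
        f2_def[of x] sum_distrib_left[symmetric] sum_divide_distrib[symmetric] mult.assoc)
      (simp add: mult_ac sum_distrib_left)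
qed

lemma smooth_B: "smooth_on Om B"
proof -
  have grad: "smooth_on Om (\<lambda>z. grad (fst (fst z)))"
    unfolding grad_def
    by (intro smooth_on_vec_lambda smooth_on_FD_compose[OF open_Om smooth_f2 smooth_base] Om_D
        smooth_on_const open_Om)
  have vgrad: "smooth_on Om (\<lambda>z. vgrad (p2 z))"
    unfolding vgrad_def
    by (intro smooth_on_vec_lambda smooth_on_FD_compose[OF open_Om Q.smooth_K smooth_p2] Om_D
        smooth_on_const open_Om)
  have df2: "smooth_on Om (\<lambda>z. FD f2 (fst (fst z)) (fst (snd z)))"
    by (intro smooth_on_FD_compose[OF open_Om smooth_f2 smooth_base] Om_D smooth_on_fst smooth_on_snd
        smooth_on_ident open_Om)
  have "smooth_on Om B1"
  proof (rule smooth_on_cong[OF _ open_Om B1_eq[symmetric]])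
    show "smooth_on Om (\<lambda>z. spray F1 (fst (p1 z)) (snd (p1 z)) -
      (1/4 * Q.K (p2 z)) *\<^sub>R (matrix_inv (fundamental_tensor F1 (fst (p1 z)) (snd (p1 z))) *v grad (fst (fst z))))"
      by (intro smooth_on_diff smooth_on_scaleR smooth_on_mult smooth_on_const P.smooth_spray
          P.smooth_matrix_inv grad smooth_K2 open_Om smooth_p1 Om_D)
  qed
  moreover have "smooth_on Om B2"
  proof (rule smooth_on_cong[OF _ open_Om B2_eq[symmetric]])
    show "smooth_on Om (\<lambda>z. spray F2 (fst (p2 z)) (snd (p2 z)) +
      (1 / (4 * f2 (fst (fst z))) * FD f2 (fst (fst z)) (fst (snd z))) *\<^sub>R
      (matrix_inv (fundamental_tensor F2 (fst (p2 z)) (snd (p2 z))) *v vgrad (p2 z)))"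
      using f2_pos[OF Om_D(3)]
      by (intro smooth_on_add smooth_on_scaleR smooth_on_mult smooth_on_divide smooth_on_const Q.smooth_spray
          Q.smooth_matrix_inv vgrad df2 smooth_f2' open_Om smooth_p2 Om_D) (auto simp: less_imp_neq[THEN not_sym])
  qed
  ultimately show ?thesis
    unfolding B_def[abs_def] by (intro smooth_on_Pair open_Om)
qed

text \<open>On the right side of the spray equation the warping adds half the derivative of
  \<open>f2\<close> along \<open>y\<close> times the vertical derivative of \<open>Q.K\<close> along
  \<open>snd w\<close>, and subtracts half of \<open>Q.K\<close> times the derivative of
  \<open>f2\<close> along \<open>fst w\<close>. The correction terms of \<open>B2\<close> and
  \<open>B1\<close> yield exactly these two contributions (\<open>e2\<close> and
  \<open>e1\<close>).\<close>

sublocale W: spray_coords Om L B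
proof
  show "open Om" "smooth_on Om L" "smooth_on Om B" by (rule open_Om smooth_L smooth_B)+
  fix z assume z: "z \<in> Om"
  show "FD L z (0, snd z) = 2 * L z"
    using P.euler_K[of "fst (p1 z)" "snd (p1 z)"] Q.euler_K[of "fst (p2 z)" "snd (p2 z)"] Om_D(1,2)[OF z]
    unfolding FD_L_vertical[OF z] by (simp add: L_def) (simp add: p1_def p2_def)
  have f20: "FD f2 (fst (fst z)) 0 = 0" by (rule linear_0[OF linear_f2[OF Om_D(3)[OF z]]])
  {
    fix w :: "(real^'n) \<times> (real^'m)"
    have H0: "FD (\<lambda>z. FD L z (0, w)) z (0, b) =
        1/2 * (P.HK (p1 z) (0, fst w) (0, fst b) + f2 (fst (fst z)) * Q.HK (p2 z) (0, snd w) (0, snd b))" for b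
      by (simp add: H_vertical[OF z] f20)
    show "FD (\<lambda>z. FD L z (0, w)) z (0, w) > 0" if "w \<noteq> 0"
    proof -
      have 1: "P.HK (p1 z) (0, fst w) (0, fst w) \<ge> 0" "fst w \<noteq> 0 \<Longrightarrow> P.HK (p1 z) (0, fst w) (0, fst w) > 0"
        using P.HK_pos[of "fst (p1 z)" "snd (p1 z)" "fst w"] Om_D(1)[OF z]
          linear_0[OF P.linear_HK2[OF Om_D(1)[OF z]], of "(0, 0)"]
        by (cases "fst w = 0"; force simp: zero_prod_def)+
      have 2: "Q.HK (p2 z) (0, snd w) (0, snd w) \<ge> 0" "snd w \<noteq> 0 \<Longrightarrow> Q.HK (p2 z) (0, snd w) (0, snd w) > 0"
        using Q.HK_pos[of "fst (p2 z)" "snd (p2 z)" "snd w"] Om_D(2)[OF z]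
          linear_0[OF Q.linear_HK2[OF Om_D(2)[OF z]], of "(0, 0)"]
        by (cases "snd w = 0"; force simp: zero_prod_def)+
      have f: "f2 (fst (fst z)) > 0" using f2_pos[OF Om_D(3)[OF z]] .
      have "fst w \<noteq> 0 \<or> snd w \<noteq> 0" using that by (auto simp: prod_eq_iff)
      then have "P.HK (p1 z) (0, fst w) (0, fst w) + f2 (fst (fst z)) * Q.HK (p2 z) (0, snd w) (0, snd w) > 0"
        using 1 2 f by (auto intro: add_pos_nonneg add_nonneg_pos)
      then show ?thesis by (simp add: H0)
    qed
    have lin1: "linear (\<lambda>b. P.HK (p1 z) (0, fst w) (0, b))"
      using linear_compose[OF P.linear_inr P.linear_HK2[OF Om_D(1)[OF z]]] by (simp add: o_def)
    have lin2: "linear (\<lambda>b. Q.HK (p2 z) (0, snd w) (0, b))"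
      using linear_compose[OF Q.linear_inr Q.linear_HK2[OF Om_D(2)[OF z]]] by (simp add: o_def)
    have m1: "P.HK (p1 z) (0, a) (0, matrix_inv (fundamental_tensor F1 (fst (p1 z)) (snd (p1 z))) *v b) = 2 * (a \<bullet> b)"
      and s1: "P.HK (p1 z) (0, a) (0, spray F1 (fst (p1 z)) (snd (p1 z))) =
        1/2 * (P.HK (p1 z) (0, a) (fst (snd z), 0) - FD P.K (p1 z) (a, 0))" for a b
      using P.HK_matrix_inv[of "fst (p1 z)" "snd (p1 z)" a b] P.HK_spray[of "fst (p1 z)" "snd (p1 z)" a]
        Om_D(1)[OF z] by (simp_all add: p1_def)
    have m2: "Q.HK (p2 z) (0, a) (0, matrix_inv (fundamental_tensor F2 (fst (p2 z)) (snd (p2 z))) *v b) = 2 * (a \<bullet> b)"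
      and s2: "Q.HK (p2 z) (0, a) (0, spray F2 (fst (p2 z)) (snd (p2 z))) =
        1/2 * (Q.HK (p2 z) (0, a) (snd (snd z), 0) - FD Q.K (p2 z) (a, 0))" for a b
      using Q.HK_matrix_inv[of "fst (p2 z)" "snd (p2 z)" a b] Q.HK_spray[of "fst (p2 z)" "snd (p2 z)" a]
        Om_D(2)[OF z] by (simp_all add: p2_def)
    have e1: "P.HK (p1 z) (0, fst w) (0, B1 z) =
        1/2 * (P.HK (p1 z) (0, fst w) (fst (snd z), 0) - FD P.K (p1 z) (fst w, 0)) -
        1/2 * Q.K (p2 z) * FD f2 (fst (fst z)) (fst w)"
      unfolding B1_eq[OF z] linear_diff[OF lin1] linear_cmul[OF lin1] m1 s1
      by (simp add: inner_grad[OF Om_D(3)[OF z]])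
    have "f2 (fst (fst z)) \<noteq> 0" using f2_pos[OF Om_D(3)[OF z]] by simp
    then have e2: "f2 (fst (fst z)) * Q.HK (p2 z) (0, snd w) (0, B2 z) =
        1/2 * f2 (fst (fst z)) * (Q.HK (p2 z) (0, snd w) (snd (snd z), 0) - FD Q.K (p2 z) (snd w, 0)) +
        1/2 * FD f2 (fst (fst z)) (fst (snd z)) * FD Q.K (p2 z) (0, snd w)"
      unfolding B2_eq[OF z] linear_add[OF lin2] linear_cmul[OF lin2] m2 s2
      by (simp add: inner_vgrad[OF Om_D(2)[OF z]] field_simps)
    show "2 * FD (\<lambda>z. FD L z (0, w)) z (0, B z) = FD (\<lambda>z. FD L z (0, w)) z (snd z, 0) - FD L z (w, 0)"
      unfolding H0 H_vertical[OF z] FD_L[OF z] B_def fst_conv snd_conv e1 e2 p_inr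
      by (simp add: algebra_simps f20)
  }
qed

section \<open>Translation of the coordinate definitions into the abstract objects\<close>

lemma FD_B:
  assumes "z \<in> Om"
  shows "(B1 has_derivative (\<lambda>X. fst (FD B z X))) (at z)" "(B2 has_derivative (\<lambda>X. snd (FD B z X))) (at z)"
  using has_derivative_fst[OF W.has_derivative_B[OF assms]] has_derivative_snd[OF W.has_derivative_B[OF assms]]
  by (simp_all add: B_def)

text \<open>The fibre derivative of the pair \<open>B\<close> is one linear map with four blocks;
  the coefficients of the nonlinear connection are the entries of these blocks.\<close>

lemma B_coeffs:
  assumes "z \<in> Om"
  shows "B11 z i j = fst (W.N z (axis j 1, 0)) $ i" "B12 z i \<beta> = fst (W.N z (0, axis \<beta> 1)) $ i"
    "B21 z \<alpha> j = snd (W.N z (axis j 1, 0)) $ \<alpha>" "B22 z \<alpha> \<beta> = snd (W.N z (0, axis \<beta> 1)) $ \<alpha>"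
proof -
  obtain x u y v where z: "z = ((x, u), (y, v))" by (metis surj_pair)
  have 1: "((\<lambda>y. ((x, u), (y, v))) has_derivative (\<lambda>h. (0, (h, 0)))) (at y)"
    and 2: "((\<lambda>v. ((x, u), (y, v))) has_derivative (\<lambda>h. (0, (0, h)))) (at v)"
    by (auto intro!: derivative_eq_intros simp: zero_prod_def)
  note d = FD_B[OF assms, unfolded z]
  note dn = bounded_linear.has_derivative[OF bounded_linear_vec_nth]
  note a = FD_eqI[OF dn[OF has_derivative_compose[OF 1 d(1)]]] FD_eqI[OF dn[OF has_derivative_compose[OF 2 d(1)]]]
    FD_eqI[OF dn[OF has_derivative_compose[OF 1 d(2)]]] FD_eqI[OF dn[OF has_derivative_compose[OF 2 d(2)]]]
  show "B11 z i j = fst (W.N z (axis j 1, 0)) $ i" "B12 z i \<beta> = fst (W.N z (0, axis \<beta> 1)) $ i"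
    "B21 z \<alpha> j = snd (W.N z (axis j 1, 0)) $ \<alpha>" "B22 z \<alpha> \<beta> = snd (W.N z (0, axis \<beta> 1)) $ \<alpha>"
    by (simp_all add: z B11_def B12_def B21_def B22_def partial_def a W.N_def)
qed

lemma linear_pair_expansion:
  fixes T :: "(real^'n) \<times> (real^'m) \<Rightarrow> 'b::real_vector"
  assumes "linear T"
  shows "T w = (\<Sum>j\<in>UNIV. fst w $ j *\<^sub>R T (axis j 1, 0)) + (\<Sum>\<beta>\<in>UNIV. snd w $ \<beta> *\<^sub>R T (0, axis \<beta> 1))"
proof -
  have "linear (\<lambda>a. T (a, 0))" "linear (\<lambda>b. T (0, b))"
    using linear_compose[OF P.linear_inl assms] linear_compose[OF Q.linear_inr assms]
    by (simp_all add: o_def linear_compose[of "\<lambda>a. (a, 0)" T, unfolded o_def] linear_compose[of "\<lambda>a. (0, a)" T, unfolded o_def] assms linearI)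
  from linear_axis_expansion[OF this(1), of "fst w"] linear_axis_expansion[OF this(2), of "snd w"]
  show ?thesis using linear_add[OF assms, of "(fst w, 0)" "(0, snd w)"] by simp
qed

lemma N_components:
  assumes "z \<in> Om"
  shows "fst (W.N z w) $ i = (\<Sum>j\<in>UNIV. B11 z i j * fst w $ j) + (\<Sum>\<beta>\<in>UNIV. B12 z i \<beta> * snd w $ \<beta>)"
    "snd (W.N z w) $ \<alpha> = (\<Sum>j\<in>UNIV. B21 z \<alpha> j * fst w $ j) + (\<Sum>\<beta>\<in>UNIV. B22 z \<alpha> \<beta> * snd w $ \<beta>)"
  unfolding linear_pair_expansion[OF W.linear_N[OF assms], of w]
  by (simp_all add: B_coeffs[OF assms] fst_sum snd_sum mult.commute)

lemma delta_y_eq: "z \<in> Om \<Longrightarrow> delta_y z i X = fst (W.del z X) $ i"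
  by (cases X) (auto simp: delta_y_def W.del_def N_components)

lemma delta_v_eq: "z \<in> Om \<Longrightarrow> delta_v z \<alpha> X = snd (W.del z X) $ \<alpha>"
  by (cases X) (auto simp: delta_v_def W.del_def N_components)

lemma sum_dd_y: "(\<Sum>i\<in>UNIV. a $ i *\<^sub>R dd_y i) = (0, (a, 0))"
  by (auto simp: dd_y_def prod_eq_iff fst_sum snd_sum vec_eq_iff axis_def if_distrib cong: if_cong)

lemma sum_dd_v: "(\<Sum>\<alpha>\<in>UNIV. a $ \<alpha> *\<^sub>R dd_v \<alpha>) = (0, (0, a))"
  by (auto simp: dd_v_def prod_eq_iff fst_sum snd_sum vec_eq_iff axis_def if_distrib cong: if_cong)

lemma delta_x_eq: "z \<in> Om \<Longrightarrow> delta_x z i = ((axis i 1, 0), - W.N z (axis i 1, 0))"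
  by (simp add: delta_x_def B_coeffs sum_dd_y sum_dd_v prod_eq_iff)

lemma delta_u_eq: "z \<in> Om \<Longrightarrow> delta_u z \<alpha> = ((0, axis \<alpha> 1), - W.N z (0, axis \<alpha> 1))"
  by (simp add: delta_u_def B_coeffs sum_dd_y sum_dd_v prod_eq_iff)

text \<open>\<open>(w, - W.N z w)\<close> is the horizontal lift of \<open>w\<close>, so the frame
  sums in \<xi> and J become lifts.\<close>

lemma sum_delta:
  assumes "z \<in> Om"
  shows "(\<Sum>i\<in>UNIV. fst w $ i *\<^sub>R delta_x z i) + (\<Sum>\<alpha>\<in>UNIV. snd w $ \<alpha> *\<^sub>R delta_u z \<alpha>) = (w, - W.N z w)"
proof -
  have "linear (\<lambda>w. (w, - W.N z w))"
    using W.linear_N[OF assms] by (intro linearI) (simp_all add: linear_add linear_cmul)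
  from linear_pair_expansion[OF this, of w] show ?thesis by (simp add: delta_x_eq[OF assms] delta_u_eq[OF assms])
qed

lemma xi_loc_eq: "z \<in> Om \<Longrightarrow> xi_loc z = W.xi z"
  using sum_delta[of z "snd z"] by (cases z) (auto simp: xi_loc_def W.xi_def)

lemma J_loc_eq:
  assumes "z \<in> Om"
  shows "J_loc z X = W.J z X"
proof -
  obtain a b c where X: "X = ((a, b), c)" by (metis surj_pair)
  have "J_loc z X = ((\<Sum>i\<in>UNIV. delta_y z i X *\<^sub>R delta_x z i) + (\<Sum>\<alpha>\<in>UNIV. delta_v z \<alpha> X *\<^sub>R delta_u z \<alpha>))
      - (0, (a, 0)) - (0, (0, b))"
    by (simp add: J_loc_def X sum_dd_y sum_dd_v)
  also have "\<dots> = W.J z X"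
    unfolding delta_y_eq[OF assms] delta_v_eq[OF assms] sum_delta[OF assms]
    by (simp add: W.J_def X prod_eq_iff)
  finally show ?thesis .
qed

text \<open>There is no mixed block, since each summand of \<open>L\<close> involves the fibre
  variables of one factor only.\<close>

lemma g_eq:
  assumes "z \<in> Om"
  shows "W.g z w w' =
    (\<Sum>i\<in>UNIV. \<Sum>j\<in>UNIV. fundamental_tensor F1 (fst (fst z)) (fst (snd z)) $ i $ j * fst w $ i * fst w' $ j) +
    (f (fst (fst z)))\<^sup>2 * (\<Sum>\<alpha>\<in>UNIV. \<Sum>\<beta>\<in>UNIV. fundamental_tensor F2 (snd (fst z)) (snd (snd z)) $ \<alpha> $ \<beta> * snd w $ \<alpha> * snd w' $ \<beta>)"
proof -
  have 1: "(fst (fst z), fst (snd z)) \<in> P.Om" "(snd (fst z), snd (snd z)) \<in> Q.Om"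
    using Om_D(1,2)[OF assms] by (auto simp: p1_def p2_def)
  show ?thesis
    unfolding W.g_def W.H_def H_vertical[OF assms] P.fundamental_tensor_sum[OF 1(1)] Q.fundamental_tensor_sum[OF 1(2)]
    using linear_0[OF linear_f2[OF Om_D(3)[OF assms]]]
    by (simp add: f2_def algebra_simps) (simp add: p1_def p2_def)
qed

lemma eta_loc_eq:
  assumes "z \<in> Om"
  shows "eta_loc z X = W.th z X"
proof -
  obtain x u y v where z: "z = ((x, u), (y, v))" by (metis surj_pair)
  obtain a b c where X: "X = ((a, b), c)" by (metis surj_pair)
  have "W.th z X = W.g z (y, v) (a, b)" using W.th_eq_g[OF assms] by (simp add: W.th_def X z)
  then show ?thesis
    unfolding g_eq[OF assms] by (simp add: eta_loc_def z X mult_ac)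
qed

lemma sasaki_loc_eq:
  assumes "z \<in> Om"
  shows "sasaki_loc z X Y = W.G z X Y"
proof -
  obtain x u y v where z: "z = ((x, u), (y, v))" by (metis surj_pair)
  obtain a b c where X: "X = ((a, b), c)" by (metis surj_pair)
  obtain a' b' c' where Y: "Y = ((a', b'), c')" by (metis surj_pair)
  show ?thesis
    unfolding W.G_def g_eq[OF assms] delta_y_eq[OF assms, symmetric] delta_v_eq[OF assms, symmetric]
    by (simp add: sasaki_loc_def z X Y Let_def sum_distrib_left mult_ac add_ac)
qed

lemma L_scale:
  assumes "(X, Y) \<in> Om" "t > 0"
  shows "L (X, t *\<^sub>R Y) = t\<^sup>2 * L (X, Y)"
  using assms Om_D[OF assms(1)]
  by (simp add: L_def p1_def p2_def P.K_def Q.K_def Om_def P.homogeneous Q.homogeneous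
      power_mult_distrib algebra_simps)

lemma L_pos: "z \<in> Om \<Longrightarrow> L z > 0"
proof -
  assume z: "z \<in> Om"
  have "F1 (fst (fst z)) (fst (snd z)) > 0" using z by (intro P.positive) (auto simp: Om_def)
  then have "P.K (p1 z) > 0" by (simp add: P.K_def p1_def)
  moreover have "f2 (fst (fst z)) * Q.K (p2 z) \<ge> 0" by (simp add: f2_def Q.K_def)
  ultimately show ?thesis by (simp add: L_def add_pos_nonneg)
qed

end

section \<open>The slit tangent bundle of the warped product\<close>

lemma (in warped_local) spray_coords: "spray_coords Om L B"
  by (rule W.spray_coords_axioms)

locale warped_finsler = warped_product A1 F1 A2 F2 f
  for A1 :: "('a, real^'n) atlas" and F1 :: "'a \<times> ('a, real^'n) tvec \<Rightarrow> real"
    and A2 :: "('b, real^'m) atlas" and F2 :: "'b \<times> ('b, real^'m) tvec \<Rightarrow> real"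
    and f :: "'a \<Rightarrow> real" +
  assumes finsler1: "finsler_manifold A1 F1" and finsler2: "finsler_manifold A2 F2"
    and smooth_f: "smooth_function A1 f" and f_nonzero: "\<forall>p\<in>carrier_of A1. f p \<noteq> 0"
begin

sublocale M1: atlas A1
  by unfold_locales (use finsler1 in \<open>simp add: finsler_manifold_def smooth_manifold_def\<close>)

sublocale M2: atlas A2
  by unfold_locales (use finsler2 in \<open>simp add: finsler_manifold_def smooth_manifold_def\<close>)

lemma finsler_factor_chart:
  fixes A :: "('c, real^'k) atlas"
  assumes "finsler_manifold A K" "c \<in> A"
  shows "finsler_factor (chart_image c) (in_chart A K c)"
proof -
  interpret atlas A
    by unfold_locales (use assms in \<open>simp add: finsler_manifold_def smooth_manifold_def\<close>)
  note K = assms(1)[unfolded finsler_manifold_def, THEN conjunct2]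
  show ?thesis
  proof
    show "open (chart_image c)" by (rule open_chart_image[OF assms(2)])
    show "smooth_on (chart_image c \<times> - {0}) (\<lambda>(x, y). in_chart A K c x y)"
      using K assms(2) by blast
    show "w \<bullet> (fundamental_tensor (in_chart A K c) x y *v w) > 0"
      if "x \<in> chart_image c" "y \<noteq> 0" "w \<noteq> 0" for x y w
      using K assms(2) that by blast
    fix x y assume x: "x \<in> chart_image c"
    let ?p = "chart_inv c x"
    have p: "?p \<in> fst c" "?p \<in> carrier_of A"
      by (rule chart_inv_in[OF x], rule chart_inv_carrier[OF assms(2) x])
    have v: "tangent_vec A c ?p y \<in> tangent_space A ?p" by (rule tangent_vec_in[OF assms(2) p(1)])
    show "in_chart A K c x (t *\<^sub>R y) = t * in_chart A K c x y" if "t > 0" for t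
    proof -
      have "tangent_vec A c ?p (t *\<^sub>R y) = (\<lambda>d. t *\<^sub>R tangent_vec A c ?p y d)"
        using tangent_vec_linear[OF assms(2) p(1), of t y 0 0] by simp
      then show ?thesis using K p(2) v that by (simp add: in_chart_def)
    qed
    show "in_chart A K c x y > 0" if "y \<noteq> 0"
      using K p v that tangent_vec_eq_0_iff[OF assms(2) p(1), of y] unfolding in_chart_def by blast
  qed
qed

text \<open>A constant with the two charts as arguments, so that two pairs of charts can be compared
  in one statement.\<close>

definition Lc where
  "Lc a b = warped_local.L (in_chart A1 F1 a) (in_chart A2 F2 b) (f \<circ> chart_inv a)"
definition Bc where
  "Bc a b = warped_local.B (in_chart A1 F1 a) (in_chart A2 F2 b) (f \<circ> chart_inv a)"
definition Omc :: "('a, real^'n) chart \<Rightarrow> ('b, real^'m) chart \<Rightarrow> ('n, 'm) tm set" where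
  "Omc a b = {z. fst (fst z) \<in> chart_image a \<and> snd (fst z) \<in> chart_image b \<and>
     fst (snd z) \<noteq> 0 \<and> snd (snd z) \<noteq> 0}"

text \<open>The explicit inverse of \<open>TM0_chart a b\<close> on \<open>Omc a b\<close>, in place
  of the abstract \<open>chart_inv\<close>.\<close>

definition pt where
  "pt a b z = ((chart_inv a (fst (fst z)), tangent_vec A1 a (chart_inv a (fst (fst z))) (fst (snd z))),
     (chart_inv b (snd (fst z)), tangent_vec A2 b (chart_inv b (snd (fst z))) (snd (snd z))))"

abbreviation tc where "tc a b \<equiv> TM0_chart a b"

lemma tc_mem: "P \<in> fst (tc a b) \<longleftrightarrow> P \<in> TM0 \<and> fst (fst P) \<in> fst a \<and> fst (snd P) \<in> fst b"
  by (simp add: TM0_chart_def)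

lemma tc_apply: "snd (tc a b) P =
    ((snd a (fst (fst P)), snd b (fst (snd P))), (snd (fst P) a, snd (snd P) b))"
  by (simp add: TM0_chart_def case_prod_beta')

lemma TM0_mem: "P \<in> TM0 \<longleftrightarrow>
   fst (fst P) \<in> carrier_of A1 \<and> snd (fst P) \<in> tangent_space A1 (fst (fst P)) \<and> snd (fst P) \<noteq> (\<lambda>_. 0) \<and>
   fst (snd P) \<in> carrier_of A2 \<and> snd (snd P) \<in> tangent_space A2 (fst (snd P)) \<and> snd (snd P) \<noteq> (\<lambda>_. 0)"
  by (auto simp: TM0_def case_prod_beta')

section \<open>Charts of the slit tangent bundle\<close>

context
  fixes a b assumes a: "a \<in> A1" and b: "b \<in> A2"
begin

lemma warped_local:
  "warped_local (chart_image a) (in_chart A1 F1 a) (chart_image b) (in_chart A2 F2 b) (f \<circ> chart_inv a)"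
proof -
  have "smooth_on (chart_image a) (f \<circ> chart_inv a)"
    using smooth_f a by (simp add: smooth_function_def)
  moreover have "(f \<circ> chart_inv a) x \<noteq> 0" if "x \<in> chart_image a" for x
    using f_nonzero M1.chart_inv_carrier[OF a that] by simp
  ultimately show ?thesis
    unfolding warped_local_def warped_local_axioms_def
    using finsler_factor_chart[OF finsler1 a] finsler_factor_chart[OF finsler2 b] by blast
qed

lemma Omc_eq: "Omc a b = warped_local.Om (chart_image a) (chart_image b)"
  unfolding warped_local.Om_def[OF warped_local] Omc_def ..

lemma spray_coords: "spray_coords (Omc a b) (Lc a b) (Bc a b)"
  unfolding Omc_eq Lc_def Bc_def by (rule warped_local.spray_coords[OF warped_local])

lemma open_Omc: "open (Omc a b)"
  using spray_coords by (rule spray_coords.open_Om)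

lemma pt_in: "z \<in> Omc a b \<Longrightarrow> pt a b z \<in> fst (tc a b)"
  unfolding tc_mem TM0_mem pt_def Omc_def
  using a b by (simp add: M1.chart_inv_in M2.chart_inv_in M1.chart_inv_carrier M2.chart_inv_carrier
      M1.tangent_vec_in M2.tangent_vec_in M1.tangent_vec_eq_0_iff M2.tangent_vec_eq_0_iff)

lemma tc_pt: "z \<in> Omc a b \<Longrightarrow> snd (tc a b) (pt a b z) = z"
  unfolding tc_apply pt_def Omc_def
  using a b by (simp add: M1.chart_inv_in M2.chart_inv_in M1.chart_chart_inv M2.chart_chart_inv
      M1.tangent_vec_self M2.tangent_vec_self)

lemma pt_tc: "P \<in> fst (tc a b) \<Longrightarrow> pt a b (snd (tc a b) P) = P"
  unfolding tc_mem TM0_mem tc_apply pt_def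
  using a b by (simp add: M1.chart_inv_chart M2.chart_inv_chart M1.tangent_vec_component M2.tangent_vec_component)

text \<open>A nonzero tangent vector has a nonzero component in every chart around its base point,
  because one component determines it.\<close>

lemma tc_in: "P \<in> fst (tc a b) \<Longrightarrow> snd (tc a b) P \<in> Omc a b"
  unfolding tc_mem TM0_mem tc_apply Omc_def chart_image_def
  using a b M1.tangent_space_0 M2.tangent_space_0
    M1.tangent_space_eqI[of "snd (fst P)" "fst (fst P)" "\<lambda>_. 0" a]
    M2.tangent_space_eqI[of "snd (snd P)" "fst (snd P)" "\<lambda>_. 0" b] by auto

lemma inj_tc: "inj_on (snd (tc a b)) (fst (tc a b))"
  by (rule inj_on_inverseI[of _ "pt a b"]) (rule pt_tc)

lemma chart_image_tc: "chart_image (tc a b) = Omc a b"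
  unfolding chart_image_def
proof (intro equalityI subsetI)
  fix z assume "z \<in> Omc a b"
  then show "z \<in> snd (tc a b) ` fst (tc a b)" using pt_in tc_pt by (metis imageI)
qed (auto simp: tc_in)

lemma chart_inv_tc: "z \<in> Omc a b \<Longrightarrow> chart_inv (tc a b) z = pt a b z"
  unfolding chart_inv_def by (rule inv_into_f_eq[OF inj_tc pt_in tc_pt])

lemma L_chart: "P \<in> fst (tc a b) \<Longrightarrow> Lc a b (snd (tc a b) P) = 1/2 * (F P)\<^sup>2"
  using a b unfolding tc_mem TM0_mem
  by (simp add: Lc_def warped_local.L_def[OF warped_local] warped_local.f2_def[OF warped_local]
      warped_local.p1_def[OF warped_local] warped_local.p2_def[OF warped_local]
      finsler_factor.K_def[OF finsler_factor_chart[OF finsler1 a]]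
      finsler_factor.K_def[OF finsler_factor_chart[OF finsler2 b]]
      in_chart_def tc_apply F_def case_prod_beta' M1.chart_inv_chart M2.chart_inv_chart
      M1.tangent_vec_component M2.tangent_vec_component)

lemma Omc_scale: "(X, Y) \<in> Omc a b \<Longrightarrow> t > 0 \<Longrightarrow> (X, t *\<^sub>R Y) \<in> Omc a b"
  by (simp add: Omc_def)

lemma L_scale: "(X, Y) \<in> Omc a b \<Longrightarrow> t > 0 \<Longrightarrow> Lc a b (X, t *\<^sub>R Y) = t\<^sup>2 * Lc a b (X, Y)"
  unfolding Omc_eq Lc_def by (rule warped_local.L_scale[OF warped_local])

lemma L_pos: "z \<in> Omc a b \<Longrightarrow> Lc a b z > 0"
  unfolding Omc_eq Lc_def by (rule warped_local.L_pos[OF warped_local])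

end

section \<open>Transition maps of the slit tangent bundle\<close>

context
  fixes a b a' b' assumes a: "a \<in> A1" and b: "b \<in> A2" and a': "a' \<in> A1" and b': "b' \<in> A2"
begin

definition S0 where "S0 = snd a ` (fst a \<inter> fst a') \<times> snd b ` (fst b \<inter> fst b')"
definition \<phi>0 where "\<phi>0 w = ((snd a' \<circ> chart_inv a) (fst w), (snd b' \<circ> chart_inv b) (snd w))"
definition O0 where "O0 = Omc a b \<inter> {z. fst z \<in> S0}"

lemma open_S0: "open S0"
  unfolding S0_def by (intro open_Times M1.open_overlap M2.open_overlap a b a' b')

lemma open_O0: "open O0"
  unfolding O0_def
  by (intro open_Int open_Omc a b open_vimage_fst[OF open_S0, unfolded vimage_def])

lemma smooth_\<phi>0: "smooth_on S0 \<phi>0"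
proof -
  have "smooth_on S0 (\<lambda>w. (snd a' \<circ> chart_inv a) (fst w))"
    by (rule smooth_on_compose[OF open_S0 M1.smooth_transition[OF a a'] smooth_on_fst[OF open_S0 smooth_on_ident]])
      (auto simp: S0_def)
  moreover have "smooth_on S0 (\<lambda>w. (snd b' \<circ> chart_inv b) (snd w))"
    by (rule smooth_on_compose[OF open_S0 M2.smooth_transition[OF b b'] smooth_on_snd[OF open_S0 smooth_on_ident]])
      (auto simp: S0_def)
  ultimately show ?thesis unfolding \<phi>0_def[abs_def] by (rule smooth_on_Pair[OF open_S0])
qed

lemma FD_\<phi>0:
  assumes "w \<in> S0"
  shows "FD \<phi>0 w y = (FD (snd a' \<circ> chart_inv a) (fst w) (fst y), FD (snd b' \<circ> chart_inv b) (snd w) (snd y))"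
proof -
  have "fst w \<in> snd a ` (fst a \<inter> fst a')" "snd w \<in> snd b ` (fst b \<inter> fst b')"
    using assms by (auto simp: S0_def)
  note d = smooth_on_has_derivative[OF M1.smooth_transition[OF a a'] this(1)]
    smooth_on_has_derivative[OF M2.smooth_transition[OF b b'] this(2)]
  have "(\<phi>0 has_derivative (\<lambda>y. (FD (snd a' \<circ> chart_inv a) (fst w) (fst y),
      FD (snd b' \<circ> chart_inv b) (snd w) (snd y)))) (at w)"
    unfolding \<phi>0_def[abs_def]
    by (intro has_derivative_Pair has_derivative_compose[OF has_derivative_fst[OF has_derivative_ident] d(1)]
        has_derivative_compose[OF has_derivative_snd[OF has_derivative_ident] d(2)])
  from FD_eqI[OF this] show ?thesis by simp
qed

lemma O0_mem: "P \<in> fst (tc a b) \<Longrightarrow> snd (tc a b) P \<in> O0 \<longleftrightarrow> P \<in> fst (tc a' b')"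
  unfolding O0_def S0_def using tc_in[OF a b, of P]
  by (auto simp: tc_apply tc_mem M1.chart_mem[OF a] M2.chart_mem[OF b])

lemma overlap_tc: "snd (tc a b) ` (fst (tc a b) \<inter> fst (tc a' b')) = O0"
proof (intro equalityI subsetI)
  fix z assume z: "z \<in> O0"
  then have "z \<in> Omc a b" by (simp add: O0_def)
  then have "pt a b z \<in> fst (tc a b)" "snd (tc a b) (pt a b z) = z"
    using pt_in[OF a b] tc_pt[OF a b] by blast+
  then show "z \<in> snd (tc a b) ` (fst (tc a b) \<inter> fst (tc a' b'))"
    using z O0_mem[of "pt a b z"] by (metis IntI imageI)
qed (auto simp: O0_mem)

text \<open>Fibre coordinates transform by the derivative of the base transition, by the definition
  of a tangent vector; hence a transition of \<open>TM0_atlas\<close> is the map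
  \<open>\<Phi>\<close> of \<open>spray_change\<close>.\<close>

lemma transition_tc:
  assumes "z \<in> O0"
  shows "(snd (tc a' b') \<circ> chart_inv (tc a b)) z = (\<phi>0 (fst z), FD \<phi>0 (fst z) (snd z))"
proof -
  have z: "z \<in> Omc a b" "fst z \<in> S0" using assms by (auto simp: O0_def)
  have "fst (fst z) \<in> snd a ` (fst a \<inter> fst a')" "snd (fst z) \<in> snd b ` (fst b \<inter> fst b')"
    using z(2) by (auto simp: S0_def)
  then obtain p q where p: "p \<in> fst a" "p \<in> fst a'" "fst (fst z) = snd a p"
    and q: "q \<in> fst b" "q \<in> fst b'" "snd (fst z) = snd b q" by blast
  show ?thesis
    using p q a b a' b'
    by (simp add: chart_inv_tc[OF a b z(1)] tc_apply FD_\<phi>0[OF z(2)] \<phi>0_def pt_def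
        M1.chart_inv_chart M2.chart_inv_chart M1.tangent_vec_apply M2.tangent_vec_apply)
qed

lemma smooth_transition_tc: "smooth_on O0 (snd (tc a' b') \<circ> chart_inv (tc a b))"
proof (rule smooth_on_cong[OF _ open_O0])
  have "smooth_on O0 (\<lambda>z. \<phi>0 (fst z))"
    by (rule smooth_on_compose[OF open_O0 smooth_\<phi>0 smooth_on_fst[OF open_O0 smooth_on_ident]])
      (simp add: O0_def)
  moreover have "smooth_on O0 (\<lambda>z. FD \<phi>0 (fst z) (snd z))"
    by (rule smooth_on_FD_compose[OF open_O0 smooth_\<phi>0 smooth_on_fst[OF open_O0 smooth_on_ident] _
          smooth_on_snd[OF open_O0 smooth_on_ident]]) (simp add: O0_def)
  ultimately show "smooth_on O0 (\<lambda>z. (\<phi>0 (fst z), FD \<phi>0 (fst z) (snd z)))"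
    by (rule smooth_on_Pair[OF open_O0])
qed (rule transition_tc[symmetric])

text \<open>Both Lagrangians express half the square of \<open>F\<close> at the same point. This
  invariance of L is the input from which the invariance of the connection is deduced.\<close>

lemma spray_change: "spray_change (Omc a b) (Lc a b) (Bc a b) (Omc a' b') (Lc a' b') (Bc a' b') O0 S0 \<phi>0"
proof -
  interpret A: spray_coords "Omc a b" "Lc a b" "Bc a b" by (rule spray_coords[OF a b])
  interpret A': spray_coords "Omc a' b'" "Lc a' b'" "Bc a' b'" by (rule spray_coords[OF a' b'])
  show ?thesis
  proof
    fix z assume z: "z \<in> O0"
    define P where "P = pt a b z"
    have zO: "z \<in> Omc a b" "fst z \<in> S0" using z by (auto simp: O0_def)
    have P: "P \<in> fst (tc a b)" "snd (tc a b) P = z"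
      using pt_in[OF a b zO(1)] tc_pt[OF a b zO(1)] by (auto simp: P_def)
    then have P': "P \<in> fst (tc a' b')" using O0_mem z by blast
    have eq: "(\<phi>0 (fst z), FD \<phi>0 (fst z) (snd z)) = snd (tc a' b') P"
      using transition_tc[OF z] by (simp add: chart_inv_tc[OF a b zO(1)] P_def)
    show "fst z \<in> S0" by (rule zO)
    show "(\<phi>0 (fst z), FD \<phi>0 (fst z) (snd z)) \<in> Omc a' b'"
      unfolding eq by (rule tc_in[OF a' b' P'])
    show "Lc a' b' (\<phi>0 (fst z), FD \<phi>0 (fst z) (snd z)) = Lc a b z"
      using L_chart[OF a' b' P'] L_chart[OF a b P(1)] by (simp add: eq P(2))
    have "fst (fst z) \<in> snd a ` (fst a \<inter> fst a')" "snd (fst z) \<in> snd b ` (fst b \<inter> fst b')"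
      using zO(2) by (auto simp: S0_def)
    then obtain p q where p: "p \<in> fst a" "p \<in> fst a'" "fst (fst z) = snd a p"
      and q: "q \<in> fst b" "q \<in> fst b'" "snd (fst z) = snd b q" by blast
    \<comment> \<open>The reverse base transition provides a preimage of \<open>w\<close>, by the
      chain rule.\<close>
    have "FD \<phi>0 (fst z) (FD (snd a \<circ> chart_inv a') (snd a' p) (fst w), FD (snd b \<circ> chart_inv b') (snd b' q) (snd w)) = w"
      for w
      using M1.FD_transition_chain[OF a' a a' p(2,1,2), of "fst w"]
        M2.FD_transition_chain[OF b' b b' q(2,1,2), of "snd w"]
      by (simp add: FD_\<phi>0[OF zO(2)] p q M1.FD_transition_id[OF a'] M2.FD_transition_id[OF b'])
    then have "\<exists>y. FD \<phi>0 (fst z) y = w" for w by blast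
    then show "surj (FD \<phi>0 (fst z))" unfolding surj_def by metis
  qed (simp_all add: open_O0 open_S0 smooth_\<phi>0, simp add: O0_def)
qed

lemma FD_transition_tc:
  assumes "z \<in> O0"
  shows "FD (snd (tc a' b') \<circ> chart_inv (tc a b)) z = spray_change.d\<Phi> \<phi>0 z"
proof (rule FD_eqI)
  interpret C: spray_change "Omc a b" "Lc a b" "Bc a b" "Omc a' b'" "Lc a' b'" "Bc a' b'" O0 S0 \<phi>0
    by (rule spray_change)
  show "(snd (tc a' b') \<circ> chart_inv (tc a b) has_derivative C.d\<Phi> z) (at z)"
    by (rule has_derivative_transform_within_open[OF C.has_derivative_\<Phi>[OF assms] open_O0 assms])
      (simp only: C.\<Phi>_def transition_tc)
qed

end

lemma TM0_atlasI: "a \<in> A1 \<Longrightarrow> b \<in> A2 \<Longrightarrow> tc a b \<in> TM0_atlas"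
  unfolding TM0_atlas_def by blast

lemma TM0_atlasE:
  assumes "c \<in> TM0_atlas"
  obtains a b where "a \<in> A1" "b \<in> A2" "c = tc a b"
  using assms unfolding TM0_atlas_def by blast

sublocale T: atlas TM0_atlas
proof
  show "smooth_atlas TM0_atlas"
    unfolding smooth_atlas_def
  proof (intro conjI ballI)
    fix c d assume c: "c \<in> TM0_atlas" and d: "d \<in> TM0_atlas"
    obtain a b where ab: "a \<in> A1" "b \<in> A2" "c = tc a b" using c by (rule TM0_atlasE)
    obtain a' b' where ab': "a' \<in> A1" "b' \<in> A2" "d = tc a' b'" using d by (rule TM0_atlasE)
    show "inj_on (snd c) (fst c)" "open (chart_image c)"
      by (simp_all add: ab inj_tc chart_image_tc open_Omc)
    show "open (snd c ` (fst c \<inter> fst d))" "smooth_on (snd c ` (fst c \<inter> fst d)) (snd d \<circ> chart_inv c)"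
      unfolding ab(3) ab'(3) overlap_tc[OF ab(1,2) ab'(1,2)]
      by (rule open_O0[OF ab(1,2) ab'(1,2)] smooth_transition_tc[OF ab(1,2) ab'(1,2)])+
  qed
qed

lemma TM0_charts:
  assumes "P \<in> TM0"
  shows "c1 P \<in> A1" "c2 P \<in> A2" "P \<in> fst (tc (c1 P) (c2 P))"
  using assms chart_at[of "fst (fst P)" A1] chart_at[of "fst (snd P)" A2]
  unfolding tc_mem c1_def c2_def by (simp_all add: TM0_mem)

lemma carrier_TM0: "carrier_of TM0_atlas = TM0"
proof (intro equalityI subsetI)
  fix P assume "P \<in> TM0"
  then show "P \<in> carrier_of TM0_atlas" using TM0_charts TM0_atlasI carrierI by metis
next
  fix P assume "P \<in> carrier_of TM0_atlas"
  then obtain c where c: "c \<in> TM0_atlas" "P \<in> fst c" by (rule carrierE)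
  from c(1) obtain a b where "c = tc a b" by (rule TM0_atlasE)
  with c(2) show "P \<in> TM0" by (simp add: tc_mem)
qed

section \<open>Topology of the slit tangent bundle\<close>

lemma openin_TM0I:
  assumes "U \<subseteq> TM0"
    and "\<And>a b. a \<in> A1 \<Longrightarrow> b \<in> A2 \<Longrightarrow> open (V a b)"
    and "\<And>a b P. a \<in> A1 \<Longrightarrow> b \<in> A2 \<Longrightarrow> P \<in> fst (tc a b) \<Longrightarrow> P \<in> U \<longleftrightarrow> snd (tc a b) P \<in> V a b"
  shows "openin (atlas_topology TM0_atlas) U"
  unfolding T.openin_atlas carrier_TM0
proof (intro conjI ballI assms(1))
  fix c assume "c \<in> TM0_atlas"
  then obtain a b where ab: "a \<in> A1" "b \<in> A2" "c = tc a b" by (rule TM0_atlasE)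
  have "snd c ` (U \<inter> fst c) = Omc a b \<inter> V a b"
    unfolding chart_image_tc[OF ab(1,2), symmetric] chart_image_def ab(3)
    using assms(3)[OF ab(1,2)] by blast
  then show "open (snd c ` (U \<inter> fst c))" using open_Omc[OF ab(1,2)] assms(2)[OF ab(1,2)] by auto
qed

lemma openin_TM0_base1:
  assumes "openin (atlas_topology A1) U"
  shows "openin (atlas_topology TM0_atlas) {P \<in> TM0. fst (fst P) \<in> U}"
proof (rule openin_TM0I[where V = "\<lambda>a b. {z. fst (fst z) \<in> snd a ` (fst a \<inter> U)}"])
  fix a b assume a: "a \<in> A1"
  show "open {z :: ('n, 'm) tm. fst (fst z) \<in> snd a ` (fst a \<inter> U)}"
    using assms a unfolding M1.openin_atlas Int_commute[of "fst a"]
    by (intro open_vimage[of _ "\<lambda>z. fst (fst z)", unfolded vimage_def]) (auto intro!: continuous_intros)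
  show "P \<in> {P \<in> TM0. fst (fst P) \<in> U} \<longleftrightarrow> snd (tc a b) P \<in> {z. fst (fst z) \<in> snd a ` (fst a \<inter> U)}"
    if "P \<in> fst (tc a b)" for P
    using that M1.chart_mem[OF a] by (simp add: tc_mem tc_apply)
qed auto

lemma openin_TM0_base2:
  assumes "openin (atlas_topology A2) U"
  shows "openin (atlas_topology TM0_atlas) {P \<in> TM0. fst (snd P) \<in> U}"
proof (rule openin_TM0I[where V = "\<lambda>a b. {z. snd (fst z) \<in> snd b ` (fst b \<inter> U)}"])
  fix a b assume b: "b \<in> A2"
  show "open {z :: ('n, 'm) tm. snd (fst z) \<in> snd b ` (fst b \<inter> U)}"
    using assms b unfolding M2.openin_atlas Int_commute[of "fst b"]
    by (intro open_vimage[of _ "\<lambda>z. snd (fst z)", unfolded vimage_def]) (auto intro!: continuous_intros)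
  show "P \<in> {P \<in> TM0. fst (snd P) \<in> U} \<longleftrightarrow> snd (tc a b) P \<in> {z. snd (fst z) \<in> snd b ` (fst b \<inter> U)}"
    if "P \<in> fst (tc a b)" for P
    using that M2.chart_mem[OF b] by (simp add: tc_mem tc_apply)
qed auto

text \<open>Points that differ in a base point are separated by open sets of that base; points over
  the same base points share a chart and are separated in its image.\<close>

lemma Hausdorff_TM0: "Hausdorff_space (atlas_topology TM0_atlas)"
  unfolding Hausdorff_space_def T.topspace_atlas carrier_TM0
proof (intro allI impI)
  fix P Q assume PQ: "P \<in> TM0 \<and> Q \<in> TM0 \<and> P \<noteq> Q"
  have H: "Hausdorff_space (atlas_topology A1)" "Hausdorff_space (atlas_topology A2)"
    using finsler1 finsler2 by (simp_all add: finsler_manifold_def smooth_manifold_def)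
  let ?T = "atlas_topology TM0_atlas"
  consider "fst (fst P) \<noteq> fst (fst Q)" | "fst (snd P) \<noteq> fst (snd Q)"
    | "fst (fst P) = fst (fst Q)" "fst (snd P) = fst (snd Q)" by blast
  then show "\<exists>U V. openin ?T U \<and> openin ?T V \<and> P \<in> U \<and> Q \<in> V \<and> disjnt U V"
  proof cases
    case 1
    then obtain U V where UV: "openin (atlas_topology A1) U" "openin (atlas_topology A1) V"
      "fst (fst P) \<in> U" "fst (fst Q) \<in> V" "disjnt U V"
      using H(1) PQ unfolding Hausdorff_space_def M1.topspace_atlas TM0_mem by metis
    show ?thesis
      by (rule exI[of _ "{P \<in> TM0. fst (fst P) \<in> U}"], rule exI[of _ "{P \<in> TM0. fst (fst P) \<in> V}"])
        (use UV PQ in \<open>auto simp: openin_TM0_base1 disjnt_iff\<close>)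
  next
    case 2
    then obtain U V where UV: "openin (atlas_topology A2) U" "openin (atlas_topology A2) V"
      "fst (snd P) \<in> U" "fst (snd Q) \<in> V" "disjnt U V"
      using H(2) PQ unfolding Hausdorff_space_def M2.topspace_atlas TM0_mem by metis
    show ?thesis
      by (rule exI[of _ "{P \<in> TM0. fst (snd P) \<in> U}"], rule exI[of _ "{P \<in> TM0. fst (snd P) \<in> V}"])
        (use UV PQ in \<open>auto simp: openin_TM0_base2 disjnt_iff\<close>)
  next
    case 3
    define c where "c = tc (c1 P) (c2 P)"
    have c: "c \<in> TM0_atlas" "P \<in> fst c" "Q \<in> fst c"
      using TM0_charts[of P] PQ TM0_atlasI 3 by (auto simp: c_def tc_mem)
    have "snd c P \<noteq> snd c Q" using inj_onD[OF T.inj_chart[OF c(1)]] c PQ by blast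
    from hausdorff[OF this] obtain U V
      where UV: "open U" "open V" "snd c P \<in> U" "snd c Q \<in> V" "U \<inter> V = {}" by blast
    show ?thesis
      by (rule exI[of _ "{P \<in> fst c. snd c P \<in> U}"], rule exI[of _ "{P \<in> fst c. snd c P \<in> V}"])
        (use UV c in \<open>auto simp: T.openin_chart_preimage disjnt_iff\<close>)
  qed
qed

lemma smooth_manifold_TM0: "smooth_manifold TM0_atlas"
proof -
  have "second_countable (atlas_topology A1)" "second_countable (atlas_topology A2)"
    using finsler1 finsler2 by (simp_all add: finsler_manifold_def smooth_manifold_def)
  then obtain C1 C2 where C1: "countable C1" "C1 \<subseteq> A1" "carrier_of A1 \<subseteq> (\<Union>c\<in>C1. fst c)"
    and C2: "countable C2" "C2 \<subseteq> A2" "carrier_of A2 \<subseteq> (\<Union>c\<in>C2. fst c)"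
    using M1.second_countable_atlasD M2.second_countable_atlasD by metis
  have "second_countable (atlas_topology TM0_atlas)"
  proof (rule T.second_countable_atlasI)
    show "countable ((\<lambda>x. tc (fst x) (snd x)) ` (C1 \<times> C2))" using C1 C2 by auto
    show "(\<lambda>x. tc (fst x) (snd x)) ` (C1 \<times> C2) \<subseteq> TM0_atlas"
    proof
      fix c assume "c \<in> (\<lambda>x. tc (fst x) (snd x)) ` (C1 \<times> C2)"
      then obtain x where x: "c = tc (fst x) (snd x)" "x \<in> C1 \<times> C2" by (rule imageE)
      then have "fst x \<in> C1" "snd x \<in> C2" by (simp_all add: mem_Times_iff)
      with x(1) show "c \<in> TM0_atlas" using C1(2) C2(2) TM0_atlasI by blast
    qed
    show "carrier_of TM0_atlas \<subseteq> (\<Union>c\<in>(\<lambda>x. tc (fst x) (snd x)) ` (C1 \<times> C2). fst c)"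
    proof
      fix P assume "P \<in> carrier_of TM0_atlas"
      then have P: "P \<in> TM0" by (simp add: carrier_TM0)
      then obtain a b where "a \<in> C1" "fst (fst P) \<in> fst a" "b \<in> C2" "fst (snd P) \<in> fst b"
        using C1(3) C2(3) unfolding TM0_mem by blast
      then show "P \<in> (\<Union>c\<in>(\<lambda>x. tc (fst x) (snd x)) ` (C1 \<times> C2). fst c)"
        using P by (intro UN_I[of "tc a b"] image_eqI[of _ _ "(a, b)"]) (simp_all add: tc_mem)
    qed
  qed
  then show ?thesis using T.atlas Hausdorff_TM0 by (simp add: smooth_manifold_def)
qed

subsection \<open>The tensor fields do not depend on the chart\<close>

context
  fixes a b P assumes a: "a \<in> A1" and b: "b \<in> A2" and P: "P \<in> fst (tc a b)"
begin

abbreviation "cP' \<equiv> tc (c1 P) (c2 P)"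
abbreviation "zP' \<equiv> snd cP' P"
abbreviation "zT \<equiv> snd (tc a b) P"
abbreviation "\<phi>P \<equiv> \<phi>0 a b (c1 P) (c2 P)"
abbreviation "TP \<equiv> tangent_space TM0_atlas P"

lemma P_TM0: "P \<in> TM0"
  using P by (simp add: tc_mem)

lemmas P_charts = TM0_charts[OF P_TM0]

lemma change: "spray_change (Omc a b) (Lc a b) (Bc a b) (Omc (c1 P) (c2 P)) (Lc (c1 P) (c2 P)) (Bc (c1 P) (c2 P))
    (O0 a b (c1 P) (c2 P)) (S0 a b (c1 P) (c2 P)) \<phi>P"
  by (rule spray_change[OF a b P_charts(1,2)])

lemma z_O0: "zT \<in> O0 a b (c1 P) (c2 P)"
  using O0_mem[OF a b P_charts(1,2) P] P_charts(3) by blast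

lemma z_\<Phi>: "spray_change.\<Phi> \<phi>P zT = zP'"
  using transition_tc[OF a b P_charts(1,2) z_O0]
  by (simp add: spray_change.\<Phi>_def[OF change] chart_inv_tc[OF a b tc_in[OF a b P]] pt_tc[OF a b P])

lemma X_d\<Phi>:
  assumes "X \<in> TP"
  shows "X cP' = spray_change.d\<Phi> \<phi>P zT (X (tc a b))"
  unfolding FD_transition_tc[OF a b P_charts(1,2) z_O0, symmetric]
  by (rule T.tangent_space_transition[OF assms TM0_atlasI[OF a b] TM0_atlasI[OF P_charts(1,2)] P P_charts(3)])

lemma wl_P: "warped_local (chart_image (c1 P)) (in_chart A1 F1 (c1 P)) (chart_image (c2 P)) (in_chart A2 F2 (c2 P))
    (f \<circ> chart_inv (c1 P))"
  by (rule warped_local[OF P_charts(1,2)])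

lemma z_Om: "zP' \<in> warped_local.Om (chart_image (c1 P)) (chart_image (c2 P))"
  using tc_in[OF P_charts] Omc_eq[OF P_charts(1,2)] by simp

text \<open>\<open>c1 P\<close> and \<open>c2 P\<close> vary with \<open>P\<close> in no controlled
  way, while smoothness is checked in a fixed pair \<open>a\<close>, \<open>b\<close>; this formula
  bridges the two.\<close>

lemma sasaki_eq:
  assumes "X \<in> TP" "Y \<in> TP"
  shows "sasaki P X Y = spray_coords.G (Lc a b) (Bc a b) zT (X (tc a b)) (Y (tc a b))"
proof -
  have "sasaki P X Y = spray_coords.G (Lc (c1 P) (c2 P)) (Bc (c1 P) (c2 P)) zP'
      (X cP') (Y cP')"
    unfolding sasaki_def Let_def Lc_def Bc_def by (rule warped_local.sasaki_loc_eq[OF wl_P z_Om])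
  also have "\<dots> = spray_coords.G (Lc a b) (Bc a b) zT (X (tc a b)) (Y (tc a b))"
    unfolding z_\<Phi>[symmetric] X_d\<Phi>[OF assms(1)] X_d\<Phi>[OF assms(2)]
    by (rule spray_change.G_\<Phi>[OF change z_O0])
  finally show ?thesis .
qed

lemma eta_TM0_eq:
  assumes "X \<in> TP"
  shows "eta_TM0 P X = spray_coords.th (Lc a b) zT (X (tc a b))"
proof -
  have "eta_TM0 P X = spray_coords.th (Lc (c1 P) (c2 P)) zP' (X cP')"
    unfolding eta_TM0_def Let_def Lc_def Bc_def by (rule warped_local.eta_loc_eq[OF wl_P z_Om])
  also have "\<dots> = spray_coords.th (Lc a b) zT (X (tc a b))"
    unfolding z_\<Phi>[symmetric] X_d\<Phi>[OF assms(1)]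
    by (rule spray_change.th_\<Phi>[OF change z_O0, symmetric])
  finally show ?thesis .
qed

lemma tangent_vec_d\<Phi>:
  "tangent_vec TM0_atlas cP' P
     (spray_change.d\<Phi> \<phi>P zT w) = tangent_vec TM0_atlas (tc a b) P w"
proof (rule T.tangent_space_eqI)
  note c' = TM0_atlasI[OF P_charts(1,2)] P_charts(3)
  note c = TM0_atlasI[OF a b] P
  show "tangent_vec TM0_atlas cP' P
      (spray_change.d\<Phi> \<phi>P zT w) \<in> TP"
    by (rule T.tangent_vec_in[OF c'])
  show V: "tangent_vec TM0_atlas (tc a b) P w \<in> TP" by (rule T.tangent_vec_in[OF c])
  show "cP' \<in> TM0_atlas" "P \<in> fst cP'" by (rule c')+
  show "tangent_vec TM0_atlas cP' P
      (spray_change.d\<Phi> \<phi>P zT w) cP' =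
      tangent_vec TM0_atlas (tc a b) P w cP'"
    unfolding T.tangent_vec_self[OF c'] X_d\<Phi>[OF V] T.tangent_vec_self[OF c] ..
qed

lemma J_eq:
  assumes "X \<in> TP"
  shows "J P X = tangent_vec TM0_atlas (tc a b) P (spray_coords.J (Bc a b) zT (X (tc a b)))"
proof -
  have "J P X = tangent_vec TM0_atlas cP' P
      (spray_coords.J (Bc (c1 P) (c2 P)) zP' (X cP'))"
    unfolding J_def Let_def Lc_def Bc_def warped_local.J_loc_eq[OF wl_P z_Om] ..
  also have "\<dots> = tangent_vec TM0_atlas (tc a b) P (spray_coords.J (Bc a b) zT (X (tc a b)))"
    unfolding z_\<Phi>[symmetric] X_d\<Phi>[OF assms] spray_change.J_\<Phi>[OF change z_O0] by (rule tangent_vec_d\<Phi>)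
  finally show ?thesis .
qed

lemma xi_TM0_eq: "xi_TM0 P = tangent_vec TM0_atlas (tc a b) P (spray_coords.xi (Bc a b) zT)"
proof -
  have "xi_TM0 P = tangent_vec TM0_atlas cP' P
      (spray_coords.xi (Bc (c1 P) (c2 P)) zP')"
    unfolding xi_TM0_def Let_def Lc_def Bc_def warped_local.xi_loc_eq[OF wl_P z_Om] ..
  also have "\<dots> = tangent_vec TM0_atlas (tc a b) P (spray_coords.xi (Bc a b) zT)"
    unfolding z_\<Phi>[symmetric] spray_change.xi_\<Phi>[OF change z_O0] by (rule tangent_vec_d\<Phi>)
  finally show ?thesis .
qed

end

end

section \<open>The indicatrix bundle\<close>

text \<open>\<open>model\<close> makes the type \<open>'e\<close> of the model space a parameter;
  its dimension is that of a hypersurface in \<open>TM0\<close>, which has dimension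
  \<open>2 (n + m)\<close>.\<close>

locale indicatrix_bundle = warped_finsler A1 F1 A2 F2 f
  for A1 :: "('a, real^'n) atlas" and F1 :: "'a \<times> ('a, real^'n) tvec \<Rightarrow> real"
    and A2 :: "('b, real^'m) atlas" and F2 :: "'b \<times> ('b, real^'m) tvec \<Rightarrow> real"
    and f :: "'a \<Rightarrow> real" +
  fixes model :: "'e::euclidean_space itself"
  assumes dim: "DIM('e) = 2 * (CARD('n) + CARD('m)) - 1"
begin

abbreviation IB :: "(('a, 'n, 'b, 'm) tm_point, 'e) atlas" where "IB \<equiv> indicatrix_atlas"

text \<open>\<open>F\<close> is nonnegative, so its square decides; this trades the square root for
  \<open>Lc\<close>.\<close>

lemma indicatrix_L:
  assumes "a \<in> A1" "b \<in> A2" "P \<in> fst (tc a b)"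
  shows "P \<in> indicatrix \<longleftrightarrow> 2 * Lc a b (snd (tc a b) P) = 1"
proof -
  have "F P \<ge> 0" by (simp add: F_def case_prod_beta')
  then have "(F P)\<^sup>2 = 1 \<longleftrightarrow> F P = 1" by (auto simp: power2_eq_1_iff)
  moreover have "P \<in> TM0" using assms(3) by (simp add: tc_mem)
  ultimately show ?thesis
    by (simp add: indicatrix_def L_chart[OF assms])
qed

text \<open>Charts of the indicatrix bundle: the radial projection to the affine hyperplane through the
  fibre coordinate \<open>Y0\<close> of a given point and orthogonal to it.\<close>

lemma indicatrix_chart:
  assumes P0: "P0 \<in> indicatrix"
  shows "P0 \<in> carrier_of IB"
proof -
  have "P0 \<in> TM0" using P0 by (simp add: indicatrix_def)
  note ab = TM0_charts[OF this]
  define a where "a = c1 P0"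
  define b where "b = c2 P0"
  define c where "c = tc a b"
  have a: "a \<in> A1" and b: "b \<in> A2" and P0c: "P0 \<in> fst c" using ab by (simp_all add: a_def b_def c_def)
  have cT: "c \<in> TM0_atlas" using TM0_atlasI[OF a b] by (simp add: c_def)
  interpret C: spray_coords "Omc a b" "Lc a b" "Bc a b" by (rule spray_coords[OF a b])
  define Y0 where "Y0 = snd (snd c P0)"
  have "Y0 \<noteq> 0" using tc_in[OF a b, of P0] P0c by (auto simp: Y0_def c_def Omc_def)
  define s where "s = Y0 \<bullet> Y0"
  have s: "s > 0" using \<open>Y0 \<noteq> 0\<close> by (simp add: s_def)
  \<comment> \<open>All base directions together with the fibre directions orthogonal to
    \<open>Y0\<close>: codimension one, hence isometric to \<open>'e\<close>.\<close>
  define T where "T = {z :: ('n, 'm) tm. (0, Y0) \<bullet> z = 0}"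
  have "dim T = DIM(('n, 'm) tm) - 1"
    unfolding T_def using \<open>Y0 \<noteq> 0\<close> by (intro dim_hyperplane) (simp add: zero_prod_def)
  then have dimT: "dim (UNIV :: 'e set) = dim T" using dim by simp
  have subT: "subspace T" unfolding T_def by (rule subspace_hyperplane)
  obtain \<alpha> :: "'e \<Rightarrow> ('n, 'm) tm" and \<beta> where \<alpha>\<beta>: "linear \<alpha>" "linear \<beta>" "\<alpha> ` UNIV = T"
    "\<And>e. \<beta> (\<alpha> e) = e" "\<And>z. z \<in> T \<Longrightarrow> \<alpha> (\<beta> z) = z"
    by (rule isometries_subspaces[OF subspace_UNIV subT dimT]) (metis UNIV_I)
  have \<alpha>0: "snd (\<alpha> e) \<bullet> Y0 = 0" for e
  proof -
    have "\<alpha> e \<in> T" using \<alpha>\<beta>(3) by blast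
    then show ?thesis by (simp add: T_def inner_prod_def inner_commute)
  qed
  \<comment> \<open>Scales the fibre part until its inner product with \<open>Y0\<close> is
    \<open>s\<close>, then subtracts \<open>Y0\<close>, so that the fibre part becomes orthogonal to
    \<open>Y0\<close>.\<close>
  define \<kappa> :: "('n, 'm) tm \<Rightarrow> ('n, 'm) tm" where
    "\<kappa> z = (fst z, (s / (snd z \<bullet> Y0)) *\<^sub>R snd z - Y0)" for z
  define \<psi> where "\<psi> P = \<beta> (\<kappa> (snd c P))" for P
  define V where "V = {z :: ('n, 'm) tm. snd z \<bullet> Y0 > 0}"
  define U where "U = {P \<in> indicatrix. P \<in> fst c \<and> snd c P \<in> V}"
  define \<gamma> where "\<gamma> e = (fst (\<alpha> e), snd (\<alpha> e) + Y0)" for e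
  define O' where "O' = {e. \<gamma> e \<in> Omc a b}"
  \<comment> \<open>Inverts the projection: L has degree 2 in the fibre, so dividing by this root
    brings \<open>2 L\<close> back to 1.\<close>
  define \<rho> where "\<rho> e = (fst (\<gamma> e), (1 / sqrt (2 * Lc a b (\<gamma> e))) *\<^sub>R snd (\<gamma> e))" for e
  have V: "open V"
    unfolding V_def by (rule open_Collect_less) (auto intro!: continuous_intros)
  have sm\<gamma>: "smooth_on S \<gamma>" if "open S" for S
    unfolding \<gamma>_def
    using smooth_on_linear[of \<alpha> S] \<alpha>\<beta>(1) that
    by (intro smooth_on_Pair smooth_on_add smooth_on_fst smooth_on_snd smooth_on_const)
      (simp_all add: linear_conv_bounded_linear)
  have O': "open O'"
    using open_vimage[OF open_Omc[OF a b], of \<gamma>] smooth_on_continuous_on[OF sm\<gamma>[OF open_UNIV]]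
    by (simp add: O'_def vimage_def)
  have sm\<rho>: "smooth_on O' \<rho>"
    unfolding \<rho>_def
  proof (intro smooth_on_Pair smooth_on_scaleR smooth_on_divide smooth_on_sqrt smooth_on_mult smooth_on_const
      smooth_on_fst smooth_on_snd sm\<gamma> O' smooth_on_compose[OF O' C.smooth_L sm\<gamma>[OF O']])
  qed (auto simp: O'_def dest: L_pos[OF a b])
  have sm\<kappa>: "smooth_on V \<kappa>"
    unfolding \<kappa>_def
    by (intro smooth_on_Pair smooth_on_diff smooth_on_scaleR smooth_on_divide smooth_on_inner smooth_on_const
        smooth_on_fst smooth_on_snd smooth_on_ident V) (simp add: V_def)
  have \<rho>: "\<rho> e \<in> Omc a b" "2 * Lc a b (\<rho> e) = 1" "\<rho> e \<in> V" "\<kappa> (\<rho> e) = \<alpha> e" if "e \<in> O'" for e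
  proof -
    have \<gamma>: "(fst (\<gamma> e), snd (\<gamma> e)) \<in> Omc a b" using that by (simp add: O'_def)
    define r where "r = sqrt (2 * Lc a b (\<gamma> e))"
    have r: "r > 0" using L_pos[OF a b, of "\<gamma> e"] that by (simp add: r_def O'_def)
    have \<rho>_r: "\<rho> e = (fst (\<gamma> e), (1 / r) *\<^sub>R snd (\<gamma> e))" by (simp add: \<rho>_def r_def)
    show "\<rho> e \<in> Omc a b" unfolding \<rho>_r using Omc_scale[OF a b \<gamma>, of "1 / r"] r by simp
    have "r\<^sup>2 = 2 * Lc a b (\<gamma> e)" using r L_pos[OF a b, of "\<gamma> e"] that by (simp add: r_def O'_def)
    moreover from this have "Lc a b (\<gamma> e) \<noteq> 0" using r by auto
    ultimately show "2 * Lc a b (\<rho> e) = 1"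
      unfolding \<rho>_r using L_scale[OF a b \<gamma>, of "1 / r"] r by (simp add: power_divide)
    have in0: "snd (\<gamma> e) \<bullet> Y0 = s" using \<alpha>0[of e] by (simp add: \<gamma>_def inner_add_left s_def)
    then have in1: "snd (\<rho> e) \<bullet> Y0 = s / r" by (simp add: \<rho>_r)
    then show "\<rho> e \<in> V" using s r by (simp add: V_def)
    show "\<kappa> (\<rho> e) = \<alpha> e"
      unfolding \<kappa>_def in1 using s r by (simp add: \<rho>_r \<gamma>_def)
  qed
  have U: "\<psi> P \<in> O'" "\<rho> (\<psi> P) = snd c P" if "P \<in> U" for P
  proof -
    define z where "z = snd c P"
    define t where "t = s / (snd z \<bullet> Y0)"
    have P: "P \<in> fst (tc a b)" "P \<in> indicatrix" "z \<in> V" using that by (auto simp: U_def c_def z_def)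
    have z: "(fst z, snd z) \<in> Omc a b" "2 * Lc a b (fst z, snd z) = 1"
      using tc_in[OF a b P(1)] indicatrix_L[OF a b P(1)] P(2) by (auto simp: z_def c_def)
    have t: "t > 0" using s P(3) by (simp add: t_def V_def)
    have "\<kappa> z \<in> T" using P(3) by (simp add: T_def \<kappa>_def V_def inner_diff_right inner_commute s_def)
    then have "\<alpha> (\<psi> P) = \<kappa> z" unfolding \<psi>_def z_def[symmetric] by (rule \<alpha>\<beta>(5))
    then have \<gamma>: "\<gamma> (\<psi> P) = (fst z, t *\<^sub>R snd z)" by (simp add: \<gamma>_def \<kappa>_def t_def)
    then show "\<psi> P \<in> O'" using Omc_scale[OF a b z(1) t] by (simp add: O'_def)
    have "2 * Lc a b (\<gamma> (\<psi> P)) = t\<^sup>2"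
      unfolding \<gamma> L_scale[OF a b z(1) t] using z(2) by simp
    then have "sqrt (2 * Lc a b (\<gamma> (\<psi> P))) = t" using t by simp
    then show "\<rho> (\<psi> P) = snd c P" using t by (simp add: \<rho>_def \<gamma> z_def[symmetric])
  qed
  have pU: "pt a b (\<rho> e) \<in> U" "\<psi> (pt a b (\<rho> e)) = e" "snd c (pt a b (\<rho> e)) = \<rho> e" if "e \<in> O'" for e
  proof -
    have p: "pt a b (\<rho> e) \<in> fst (tc a b)" by (rule pt_in[OF a b \<rho>(1)[OF that]])
    show q: "snd c (pt a b (\<rho> e)) = \<rho> e" using tc_pt[OF a b \<rho>(1)[OF that]] by (simp add: c_def)
    show "pt a b (\<rho> e) \<in> U"
      using p q \<rho>[OF that] indicatrix_L[OF a b p] by (simp add: U_def c_def)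
    show "\<psi> (pt a b (\<rho> e)) = e" by (simp add: \<psi>_def q \<rho>(4)[OF that] \<alpha>\<beta>(4))
  qed
  have inj: "inj_on \<psi> U"
  proof (rule inj_onI)
    fix P Q assume PQ: "P \<in> U" "Q \<in> U" "\<psi> P = \<psi> Q"
    then have "snd c P = snd c Q" using U(2) by metis
    then show "P = Q" using inj_onD[OF T.inj_chart[OF cT]] PQ by (simp add: U_def)
  qed
  have img: "\<psi> ` U = O'"
  proof (intro equalityI subsetI)
    fix e assume "e \<in> O'"
    then show "e \<in> \<psi> ` U" using pU(1,2) by (metis imageI)
  qed (use U(1) in blast)
  have inv: "inv_into U \<psi> e = pt a b (\<rho> e)" if "e \<in> O'" for e
    by (rule inv_into_f_eq[OF inj pU(1,2)[OF that]])
  have "(U, \<psi>) \<in> IB"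
    unfolding indicatrix_atlas_def submanifold_atlas_def mem_Collect_eq case_prod_conv
  proof (intro conjI ballI)
    have "U = {P \<in> fst c. snd c P \<in> V} \<inter> indicatrix" by (auto simp: U_def)
    then show "openin (subtopology (atlas_topology TM0_atlas) indicatrix) U"
      using T.openin_chart_preimage[OF cT V] by (auto simp: openin_subtopology)
    show "inj_on \<psi> U" "open (\<psi> ` U)" by (simp_all add: inj img O')
  next
    fix d p assume d: "d \<in> TM0_atlas" and p: "p \<in> U \<inter> fst d"
    let ?O = "snd d ` (fst d \<inter> fst c)"
    let ?W = "?O \<inter> (snd c \<circ> chart_inv d) -` V"
    have W: "open ?W"
      by (intro continuous_open_preimage smooth_on_continuous_on T.smooth_transition T.open_overlap d cT V)
    have "smooth_on ?W (\<lambda>w. \<kappa> ((snd c \<circ> chart_inv d) w))"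
      by (rule smooth_on_compose[OF W sm\<kappa> smooth_on_subset[OF T.smooth_transition[OF d cT]]]) auto
    from smooth_on_linear_compose[OF _ W this, of \<beta>]
    have "smooth_on ?W (\<lambda>w. \<beta> (\<kappa> ((snd c \<circ> chart_inv d) w)))"
      using \<alpha>\<beta>(2) by (simp add: linear_conv_bounded_linear)
    moreover have "snd d p \<in> ?W" using p d by (auto simp: U_def T.chart_inv_chart)
    moreover have "\<forall>q\<in>U \<inter> fst d. snd d q \<in> ?W \<longrightarrow> \<beta> (\<kappa> ((snd c \<circ> chart_inv d) (snd d q))) = \<psi> q"
      using d by (simp add: T.chart_inv_chart \<psi>_def)
    ultimately show "\<exists>W h. open W \<and> snd d p \<in> W \<and> smooth_on W h \<and>
        (\<forall>q\<in>U \<inter> fst d. snd d q \<in> W \<longrightarrow> h (snd d q) = \<psi> q)"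
      using W by blast
  next
    fix d assume d: "d \<in> TM0_atlas"
    let ?O = "O' \<inter> \<rho> -` (snd c ` (fst c \<inter> fst d))"
    have im: "\<psi> ` (U \<inter> fst d) = ?O"
    proof (intro equalityI subsetI)
      fix e assume "e \<in> \<psi> ` (U \<inter> fst d)"
      then obtain q where q: "q \<in> U" "q \<in> fst d" "e = \<psi> q" by blast
      then have "q \<in> fst c" by (simp add: U_def)
      then show "e \<in> ?O" using q U[OF q(1)] by auto
    next
      fix e assume e: "e \<in> ?O"
      then obtain q where q: "q \<in> fst c" "q \<in> fst d" "\<rho> e = snd c q" by blast
      have "pt a b (\<rho> e) = q" using pt_tc[OF a b, of q] q by (simp add: c_def)
      then show "e \<in> \<psi> ` (U \<inter> fst d)" using pU[of e] e q by (metis IntD1 IntI imageI)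
    qed
    have O: "open ?O"
      by (intro continuous_open_preimage smooth_on_continuous_on sm\<rho> O' T.open_overlap d cT)
    then show "open (\<psi> ` (U \<inter> fst d))" by (simp add: im)
    show "smooth_on (\<psi> ` (U \<inter> fst d)) (snd d \<circ> inv_into U \<psi>)"
      unfolding im
    proof (rule smooth_on_cong[OF _ O])
      show "smooth_on ?O (\<lambda>e. (snd d \<circ> chart_inv c) (\<rho> e))"
        by (rule smooth_on_compose[OF O T.smooth_transition[OF cT d] smooth_on_subset[OF sm\<rho>]]) auto
      show "(snd d \<circ> chart_inv c) (\<rho> e) = (snd d \<circ> inv_into U \<psi>) e" if "e \<in> ?O" for e
        using that inv[of e] chart_inv_tc[OF a b \<rho>(1)[of e]] by (simp add: c_def)
    qed
  qed
  moreover have "P0 \<in> fst (U, \<psi>)"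
    using P0 P0c s by (simp add: U_def V_def Y0_def s_def)
  ultimately show ?thesis by (rule carrierI)
qed

sublocale S: submanifold TM0_atlas indicatrix IB
proof
  show "indicatrix \<subseteq> carrier_of TM0_atlas" by (auto simp: carrier_TM0 indicatrix_def)
  show "IB = submanifold_atlas TM0_atlas indicatrix" by (rule indicatrix_atlas_def)
  have "fst c \<subseteq> indicatrix" if "c \<in> IB" for c
  proof -
    have "openin (subtopology (atlas_topology TM0_atlas) indicatrix) (fst c)"
      using that unfolding indicatrix_atlas_def submanifold_atlas_def by auto
    then show ?thesis using openin_subset by fastforce
  qed
  then show "carrier_of IB = indicatrix"
    using indicatrix_chart unfolding carrier_of_def by blast
qed

end

type_synonym ('a, 'n, 'b, 'm, 'e) ib_tvec = "(('a, 'n, 'b, 'm) tm_point, 'e) tvec"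

context indicatrix_bundle
begin

section \<open>The tensor fields at a point of the indicatrix\<close>

lemma push_psh: "push = S.psh"
  by (simp add: push_def fun_eq_iff)

context
  fixes a b c P assumes a: "a \<in> A1" and b: "b \<in> A2" and c: "c \<in> IB"
    and Pc: "P \<in> fst c" and Pd: "P \<in> fst (tc a b)"
begin

interpretation C: spray_coords "Omc a b" "Lc a b" "Bc a b"
  by (rule spray_coords[OF a b])

abbreviation "zP \<equiv> snd (tc a b) P"
abbreviation "iP \<equiv> S.incl c (tc a b) P"

lemma tc_in_atlas: "tc a b \<in> TM0_atlas"
  by (rule TM0_atlasI[OF a b])

lemma P_N: "P \<in> indicatrix"
  using S.I_sub[OF c] Pc by blast

lemma zP: "zP \<in> Omc a b" "2 * Lc a b zP = 1"
  using tc_in[OF a b Pd] indicatrix_L[OF a b Pd] P_N by simp_all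

lemma linear_iP: "linear iP"
  by (rule S.linear_incl[OF c tc_in_atlas Pc Pd])

lemma inj_iP: "iP v = iP w \<Longrightarrow> v = w"
  using S.inj_incl[OF c tc_in_atlas Pc Pd] by (simp add: inj_eq)

text \<open>\<open>Lc\<close> is constantly 1/2 along the indicatrix, and the chain rule
  differentiates this.\<close>

lemma dL_incl: "FD (Lc a b) zP (iP w) = 0"
proof -
  have "FD (\<lambda>_. 1/2 :: real) (snd c P) w =
      FD (Lc a b) ((snd (tc a b) \<circ> chart_inv c) (snd c P)) (iP w)"
  proof (rule FD_chain_local[OF S.I_D(4)[OF c tc_in_atlas] S.I_D(5)[OF c tc_in_atlas] C.open_Om C.smooth_L])
    fix z assume "z \<in> snd c ` (fst c \<inter> fst (tc a b))"
    then obtain q where q: "q \<in> fst c" "q \<in> fst (tc a b)" "z = snd c q" by blast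
    have "q \<in> indicatrix" using S.I_sub[OF c] q by blast
    then show "Lc a b ((snd (tc a b) \<circ> chart_inv c) z) = 1/2"
      using indicatrix_L[OF a b q(2)] q c by (simp add: S.I_inv)
  qed (use c Pc Pd zP in \<open>auto simp: S.I_inv\<close>)
  then show ?thesis using c Pc by (simp add: S.I_inv)
qed

text \<open>The radial direction \<open>(0, snd zP)\<close> shows that dL is nonzero: by Euler's
  relation its value there is \<open>2 L = 1\<close>. The dimension count then applies.\<close>

lemma range_iP: "range iP = {v. FD (Lc a b) zP v = 0}"
proof (rule S.range_incl_hypersurface[OF c tc_in_atlas Pc Pd C.linear_L[OF zP(1)] _ dL_incl])
  show "FD (Lc a b) zP (0, snd zP) \<noteq> 0" using C.euler[OF zP(1)] zP(2) by simp
  show "DIM('e) = DIM(('n, 'm) tm) - 1" by (simp add: dim)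
qed

lemma push_apply: "X \<in> tangent_space IB P \<Longrightarrow> push P X (tc a b) = iP (X c)"
  unfolding push_psh by (rule S.psh_apply[OF _ c tc_in_atlas Pc Pd])

lemma push_in: "X \<in> tangent_space IB P \<Longrightarrow> push P X \<in> tangent_space TM0_atlas P"
  unfolding push_psh by (rule S.psh_in[OF _ P_N])

text \<open>\<open>pull\<close> is an \<open>inv_into\<close> and is meaningful only on the range of
  \<open>push\<close>; by \<open>range_iP\<close> that range consists of the vectors killed by
  dL.\<close>

lemma pull:
  assumes Z: "Z \<in> tangent_space TM0_atlas P" "FD (Lc a b) zP (Z (tc a b)) = 0"
  shows "(pull P Z :: ('a, 'n, 'b, 'm, 'e) ib_tvec) \<in> tangent_space IB P"
    and "iP ((pull P Z :: ('a, 'n, 'b, 'm, 'e) ib_tvec) c) = Z (tc a b)"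
proof -
  obtain w where w: "iP w = Z (tc a b)" using Z(2) range_iP by (metis (mono_tags, lifting) mem_Collect_eq rangeE)
  have X: "tangent_vec IB c P w \<in> tangent_space IB P" by (rule S.Sub.tangent_vec_in[OF c Pc])
  have "push P (tangent_vec IB c P w) = Z"
    unfolding push_psh
    by (rule S.psh_eqI[OF X Z(1) c tc_in_atlas Pc Pd]) (simp add: S.Sub.tangent_vec_self[OF c Pc] w)
  then have *: "Z \<in> push P ` tangent_space IB P" using X by blast
  show p: "(pull P Z :: ('a, 'n, 'b, 'm, 'e) ib_tvec) \<in> tangent_space IB P"
    unfolding pull_def by (rule inv_into_into[OF *])
  have "push P (pull P Z :: ('a, 'n, 'b, 'm, 'e) ib_tvec) = Z"
    unfolding pull_def by (rule f_inv_into_f[OF *])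
  then show "iP ((pull P Z :: ('a, 'n, 'b, 'm, 'e) ib_tvec) c) = Z (tc a b)"
    using push_apply[OF p] by simp
qed

lemma metric_eq:
  "X \<in> tangent_space IB P \<Longrightarrow> Y \<in> tangent_space IB P \<Longrightarrow>
    indicatrix_metric P X Y = C.G zP (iP (X c)) (iP (Y c))"
  by (simp add: indicatrix_metric_def sasaki_eq[OF a b Pd push_in push_in] push_apply)

lemma eta_eq: "X \<in> tangent_space IB P \<Longrightarrow> eta P X = C.th zP (iP (X c))"
  by (simp add: eta_def eta_TM0_eq[OF a b Pd push_in] push_apply)

lemma xi_TM0_in: "xi_TM0 P \<in> tangent_space TM0_atlas P"
  unfolding xi_TM0_eq[OF a b Pd] by (rule T.tangent_vec_in[OF tc_in_atlas Pd])

lemma xi_TM0_apply: "xi_TM0 P (tc a b) = C.xi zP"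
  unfolding xi_TM0_eq[OF a b Pd] by (rule T.tangent_vec_self[OF tc_in_atlas Pd])

lemma xi_eq: "xi P \<in> tangent_space IB P" "iP (xi P c) = C.xi zP"
  unfolding xi_def using pull[OF xi_TM0_in] C.dL_xi[OF zP(1)] by (simp_all add: xi_TM0_apply)

text \<open>\<open>D\<close> is defined through dF. Differentiating \<open>F * F = 2 L\<close> at a
  point where \<open>F = 1\<close> gives dF = dL.\<close>

lemma differential_F:
  assumes X: "X \<in> tangent_space TM0_atlas P"
  shows "differential TM0_atlas F P X = FD (Lc a b) zP (X (tc a b))"
proof -
  have sm: "smooth_on (chart_image d) (F \<circ> chart_inv d)" and
    sq: "\<And>z. z \<in> chart_image d \<Longrightarrow> (F \<circ> chart_inv d) z * (F \<circ> chart_inv d) z = 2 * Lc a b z"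
    if ab: "a \<in> A1" "b \<in> A2" "d = tc a b" for a b d
  proof -
    interpret D: spray_coords "Omc a b" "Lc a b" "Bc a b" by (rule spray_coords[OF ab(1,2)])
    have ci: "chart_image d = Omc a b" by (simp add: ab(3) chart_image_tc[OF ab(1,2)])
    have eq: "(F \<circ> chart_inv d) z * (F \<circ> chart_inv d) z = 2 * Lc a b z" "(F \<circ> chart_inv d) z \<ge> 0"
      if "z \<in> Omc a b" for z
      using L_chart[OF ab(1,2) pt_in[OF ab(1,2) that]] tc_pt[OF ab(1,2) that]
      by (simp_all add: ab(3) chart_inv_tc[OF ab(1,2) that] power2_eq_square F_def case_prod_beta')
    show "(F \<circ> chart_inv d) z * (F \<circ> chart_inv d) z = 2 * Lc a b z" if "z \<in> chart_image d" for z
      using eq that by (simp only: ci)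
    show "smooth_on (chart_image d) (F \<circ> chart_inv d)"
      unfolding ci
    proof (rule smooth_on_cong[OF _ D.open_Om])
      show "smooth_on (Omc a b) (\<lambda>z. sqrt (2 * Lc a b z))"
      proof (rule smooth_on_sqrt[OF D.open_Om])
        show "smooth_on (Omc a b) (\<lambda>z. 2 * Lc a b z)"
          by (rule smooth_on_mult[OF D.open_Om smooth_on_const D.smooth_L])
      qed (simp add: L_pos[OF ab(1,2)])
      show "sqrt (2 * Lc a b z) = (F \<circ> chart_inv d) z" if "z \<in> Omc a b" for z
        by (rule real_sqrt_unique) (simp_all only: power2_eq_square eq[OF that])
    qed
  qed
  let ?G = "F \<circ> chart_inv (tc a b)"
  have zi: "zP \<in> chart_image (tc a b)" using zP(1) by (simp add: chart_image_tc[OF a b])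
  have dG: "(?G has_derivative FD ?G zP) (at zP)"
    by (rule smooth_on_has_derivative[OF sm[OF a b refl] zi])
  have 1: "((\<lambda>z. 2 * Lc a b z) has_derivative (\<lambda>h. ?G zP * FD ?G zP h + FD ?G zP h * ?G zP)) (at zP)"
    by (rule has_derivative_transform_within_open[OF has_derivative_mult[OF dG dG]
          T.open_chart_image[OF tc_in_atlas] zi sq[OF a b refl]])
  have 2: "((\<lambda>z. 2 * Lc a b z) has_derivative (\<lambda>h. 2 * FD (Lc a b) zP h)) (at zP)"
    by (intro has_derivative_mult_right smooth_on_has_derivative[OF C.smooth_L zP(1)])
  have "?G zP * FD ?G zP h + FD ?G zP h * ?G zP = 2 * FD (Lc a b) zP h" for h
    by (rule fun_cong[OF has_derivative_unique[OF 1 2]])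
  moreover have "?G zP = 1" using P_N Pd by (simp add: T.chart_inv_chart[OF tc_in_atlas] indicatrix_def)
  ultimately have "FD ?G zP h = FD (Lc a b) zP h" for h by simp
  moreover have "differential TM0_atlas F P X = FD ?G zP (X (tc a b))"
  proof (rule T.differential_eq[OF _ X tc_in_atlas Pd])
    fix e assume "e \<in> TM0_atlas"
    then obtain a' b' where "a' \<in> A1" "b' \<in> A2" "e = tc a' b'" by (rule TM0_atlasE)
    then show "smooth_on (chart_image e) (F \<circ> chart_inv e)" by (rule sm)
  qed
  ultimately show ?thesis by simp
qed

lemma phi_TM0_eq:
  assumes Z: "Z \<in> tangent_space TM0_atlas P" "FD (Lc a b) zP (Z (tc a b)) = 0"
  shows "phi_TM0 P Z = tangent_vec TM0_atlas (tc a b) P (C.phi zP (Z (tc a b)))"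
proof -
  define t where "t = C.th zP (Z (tc a b))"
  \<comment> \<open>The component of \<open>Z\<close> in \<open>D\<close>, obtained by removing its
    multiple of \<xi>.\<close>
  define X0 where "X0 = (\<lambda>e. 1 *\<^sub>R Z e + (- t) *\<^sub>R xi_TM0 P e)"
  have X0: "X0 \<in> tangent_space TM0_atlas P"
    unfolding X0_def by (rule T.tangent_space_lincomb[OF Z(1) xi_TM0_in])
  have X0d: "X0 (tc a b) = Z (tc a b) - t *\<^sub>R C.xi zP" by (simp add: X0_def xi_TM0_apply)
  have "(THE X. X \<in> D P \<and> (\<exists>s. Z = (\<lambda>c. X c + s *\<^sub>R xi_TM0 P c))) = X0"
  proof (rule the_equality)
    have "differential TM0_atlas F P X0 = 0" "eta_TM0 P X0 = 0"
      unfolding differential_F[OF X0] eta_TM0_eq[OF a b Pd X0] X0d t_def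
      using C.dL_D[OF zP] C.th_D[OF zP] Z(2) by simp_all
    then have "X0 \<in> D P" using X0 by (simp add: D_def)
    moreover have "Z = (\<lambda>c. X0 c + t *\<^sub>R xi_TM0 P c)" by (simp add: X0_def)
    ultimately show "X0 \<in> D P \<and> (\<exists>s. Z = (\<lambda>c. X0 c + s *\<^sub>R xi_TM0 P c))" by blast
    fix X assume X: "X \<in> D P \<and> (\<exists>s. Z = (\<lambda>c. X c + s *\<^sub>R xi_TM0 P c))"
    then obtain s where s: "Z = (\<lambda>c. X c + s *\<^sub>R xi_TM0 P c)" by blast
    have XT: "X \<in> tangent_space TM0_atlas P" and "eta_TM0 P X = 0" using X by (simp_all add: D_def)
    then have th0: "C.th zP (X (tc a b)) = 0" by (simp add: eta_TM0_eq[OF a b Pd])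
    \<comment> \<open>Applying \<eta> to the decomposition forces its coefficient \<open>s\<close>,
      hence uniqueness.\<close>
    have "t = C.th zP (X (tc a b) + s *\<^sub>R C.xi zP)"
      unfolding t_def by (subst s) (simp add: xi_TM0_apply)
    also have "\<dots> = s"
      using th0 C.th_xi1[OF zP] linear_add[OF C.linear_th[OF zP(1)]] linear_cmul[OF C.linear_th[OF zP(1)]]
      by simp
    finally show "X = X0" unfolding X0_def by (subst s) simp
  qed
  then have "phi_TM0 P Z = J P X0" unfolding phi_TM0_def by simp
  also have "\<dots> = tangent_vec TM0_atlas (tc a b) P (C.phi zP (Z (tc a b)))"
    unfolding J_eq[OF a b Pd X0] X0d C.phi_def t_def ..
  finally show ?thesis .
qed

lemma phi_eq:
  assumes X: "X \<in> tangent_space IB P"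
  shows "phi P X \<in> tangent_space IB P" "iP (phi P X c) = C.phi zP (iP (X c))"
proof -
  have Z: "push P X \<in> tangent_space TM0_atlas P" "FD (Lc a b) zP (push P X (tc a b)) = 0"
    using push_in[OF X] dL_incl by (simp_all add: push_apply[OF X])
  note eq = phi_TM0_eq[OF Z]
  have *: "phi_TM0 P (push P X) \<in> tangent_space TM0_atlas P"
    "phi_TM0 P (push P X) (tc a b) = C.phi zP (iP (X c))"
    unfolding eq using T.tangent_vec_in[OF tc_in_atlas Pd] T.tangent_vec_self[OF tc_in_atlas Pd]
    by (simp_all add: push_apply[OF X])
  then have "FD (Lc a b) zP (phi_TM0 P (push P X) (tc a b)) = 0"
    using C.dL_phi[OF zP] by simp
  from pull[OF *(1) this] show "phi P X \<in> tangent_space IB P" "iP (phi P X c) = C.phi zP (iP (X c))"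
    unfolding phi_def by (simp_all add: *(2))
qed

lemma IB_eqI: "X \<in> tangent_space IB P \<Longrightarrow> Y \<in> tangent_space IB P \<Longrightarrow> iP (X c) = iP (Y c) \<Longrightarrow> X = Y"
  using S.Sub.tangent_space_eqI[OF _ _ c Pc] inj_iP by blast

text \<open>Each vector identity is checked after the injective map \<open>iP\<close>, where it is
  an identity of \<open>spray_coords\<close>.\<close>

lemma contact_pointwise:
  assumes X: "X \<in> tangent_space IB P" and Y: "Y \<in> tangent_space IB P"
  shows "phi P (xi P) = (\<lambda>_. 0 :: 'e)" "eta P (xi P :: ('a, 'n, 'b, 'm, 'e) ib_tvec) = 1"
    "eta P (phi P X) = 0" "phi P (phi P X) = (\<lambda>c. - X c + eta P X *\<^sub>R xi P c)"
    "indicatrix_metric P (phi P X) (phi P Y) = indicatrix_metric P X Y - eta P X * eta P Y"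
proof -
  note L0 = dL_incl
  show "phi P (xi P) = (\<lambda>_. 0 :: 'e)"
    by (rule IB_eqI[OF phi_eq(1)[OF xi_eq(1)] S.Sub.tangent_space_0])
      (simp add: phi_eq(2)[OF xi_eq(1)] xi_eq(2) C.phi_xi[OF zP] linear_0[OF linear_iP])
  show "eta P (xi P :: ('a, 'n, 'b, 'm, 'e) ib_tvec) = 1"
    by (simp add: eta_eq[OF xi_eq(1)] xi_eq(2) C.th_xi1[OF zP])
  show "eta P (phi P X) = 0"
    by (simp add: eta_eq[OF phi_eq(1)[OF X]] phi_eq(2)[OF X] C.th_phi[OF zP L0])
  have "(\<lambda>c. (-1) *\<^sub>R X c + eta P X *\<^sub>R xi P c) \<in> tangent_space IB P"
    by (rule S.Sub.tangent_space_lincomb[OF X xi_eq(1)])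
  then have T: "(\<lambda>c. - X c + eta P X *\<^sub>R xi P c) \<in> tangent_space IB P" by simp
  show "phi P (phi P X) = (\<lambda>c. - X c + eta P X *\<^sub>R xi P c)"
    by (rule IB_eqI[OF phi_eq(1)[OF phi_eq(1)[OF X]] T])
      (simp add: phi_eq(2)[OF phi_eq(1)[OF X]] phi_eq(2)[OF X] C.phi_phi[OF zP L0] eta_eq[OF X]
        linear_diff[OF linear_iP] linear_cmul[OF linear_iP] xi_eq(2))
  show "indicatrix_metric P (phi P X) (phi P Y) = indicatrix_metric P X Y - eta P X * eta P Y"
    by (simp add: metric_eq phi_eq X Y eta_eq C.G_phi_phi[OF zP])
qed

end

section \<open>Smoothness of the tensor fields on the indicatrix and the exterior derivative\<close>

lemma chart_IB:
  assumes "P \<in> carrier_of IB"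
  obtains a b c where "a \<in> A1" "b \<in> A2" "c \<in> IB" "P \<in> fst c" "P \<in> fst (tc a b)"
proof -
  obtain c where c: "c \<in> IB" "P \<in> fst c" using assms by (rule carrierE)
  then have "P \<in> TM0" using S.cover assms by (simp add: indicatrix_def)
  from TM0_charts[OF this] c that show thesis by blast
qed

text \<open>One chart of the indicatrix may meet many charts of \<open>TM0\<close>; smoothness is
  local, so a smooth formula on each overlap is enough.\<close>

lemma smooth_on_IB_chart:
  fixes k :: "'e \<Rightarrow> 'k::real_normed_vector"
  assumes c: "c \<in> IB"
    and sm: "\<And>a b. a \<in> A1 \<Longrightarrow> b \<in> A2 \<Longrightarrow> smooth_on (snd c ` (fst c \<inter> fst (tc a b))) (v a b)"
    and eq: "\<And>a b Q. a \<in> A1 \<Longrightarrow> b \<in> A2 \<Longrightarrow> Q \<in> fst c \<Longrightarrow> Q \<in> fst (tc a b) \<Longrightarrow> v a b (snd c Q) = k (snd c Q)"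
  shows "smooth_on (chart_image c) k"
proof (rule smooth_on_local)
  fix z assume "z \<in> chart_image c"
  then obtain P where P: "P \<in> fst c" "z = snd c P" by (auto simp: chart_image_def)
  then have "P \<in> TM0" using S.I_sub[OF c] by (auto simp: indicatrix_def)
  from TM0_charts[OF this] obtain a b where ab: "a \<in> A1" "b \<in> A2" "P \<in> fst (tc a b)" by blast
  let ?W = "snd c ` (fst c \<inter> fst (tc a b))"
  have W: "open ?W" by (rule S.I_D(4)[OF c TM0_atlasI[OF ab(1,2)]])
  moreover have "smooth_on ?W k"
    by (rule smooth_on_cong[OF sm[OF ab(1,2)] W]) (use eq[OF ab(1,2)] in blast)
  moreover have "z \<in> ?W" using P ab by blast
  ultimately show "\<exists>W. open W \<and> z \<in> W \<and> smooth_on W k" by blast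
qed

text \<open>The field \<open>k\<close> is recovered from its image \<open>v\<close> under the inclusion by the derivative of a smooth
  left inverse.\<close>

lemma smooth_on_IB_incl:
  fixes k :: "'e \<Rightarrow> 'e"
  assumes c: "c \<in> IB"
    and sm: "\<And>a b. a \<in> A1 \<Longrightarrow> b \<in> A2 \<Longrightarrow> smooth_on (snd c ` (fst c \<inter> fst (tc a b))) (v a b)"
    and eq: "\<And>a b Q. a \<in> A1 \<Longrightarrow> b \<in> A2 \<Longrightarrow> Q \<in> fst c \<Longrightarrow> Q \<in> fst (tc a b) \<Longrightarrow>
      S.incl c (tc a b) Q (k (snd c Q)) = v a b (snd c Q)"
  shows "smooth_on (chart_image c) k"
proof (rule smooth_on_local)
  fix z assume "z \<in> chart_image c"
  then obtain P where P: "P \<in> fst c" "z = snd c P" by (auto simp: chart_image_def)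
  then have "P \<in> TM0" using S.I_sub[OF c] by (auto simp: indicatrix_def)
  from TM0_charts[OF this] obtain a b where ab: "a \<in> A1" "b \<in> A2" "P \<in> fst (tc a b)" by blast
  have d: "tc a b \<in> TM0_atlas" by (rule TM0_atlasI[OF ab(1,2)])
  obtain W h where h: "open W" "snd (tc a b) P \<in> W" "smooth_on W h"
    "\<And>q. q \<in> fst c \<Longrightarrow> q \<in> fst (tc a b) \<Longrightarrow> snd (tc a b) q \<in> W \<Longrightarrow> h (snd (tc a b) q) = snd c q"
    using S.I_left_inverse[OF c d P(1) ab(3)] by blast
  let ?O = "snd c ` (fst c \<inter> fst (tc a b))"
  let ?\<iota> = "snd (tc a b) \<circ> chart_inv c"
  let ?W = "?O \<inter> ?\<iota> -` W"
  have W: "open ?W"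
    by (intro continuous_open_preimage smooth_on_continuous_on S.I_D(4,5)[OF c d] h)
  moreover have "smooth_on ?W k"
  proof (rule smooth_on_cong[OF _ W])
    show "smooth_on ?W (\<lambda>z. FD h (?\<iota> z) (v a b z))"
      by (rule smooth_on_FD_compose[OF W h(3) smooth_on_subset[OF S.I_D(5)[OF c d]] _
            smooth_on_subset[OF sm[OF ab(1,2)]]]) auto
    fix z assume z: "z \<in> ?W"
    then obtain Q where Q: "Q \<in> fst c" "Q \<in> fst (tc a b)" "z = snd c Q" by blast
    have iz: "?\<iota> z = snd (tc a b) Q" by (simp add: Q S.I_inv[OF c])
    then have QW: "snd (tc a b) Q \<in> W" using z by simp
    show "FD h (?\<iota> z) (v a b z) = k z"
      unfolding iz unfolding Q(3) eq[OF ab(1,2) Q(1,2), symmetric]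
      by (rule S.FD_left_inverse[OF c d h(1,3,4) Q(1,2) QW])
  qed
  moreover have "z \<in> ?W" using P ab h(2) by (auto simp: S.I_inv[OF c])
  ultimately show "\<exists>W. open W \<and> z \<in> W \<and> smooth_on W k" by blast
qed

context
  fixes a b c assumes a: "a \<in> A1" and b: "b \<in> A2" and c: "c \<in> IB"
begin

abbreviation "WI \<equiv> snd c ` (fst c \<inter> fst (tc a b))"
abbreviation "\<iota> \<equiv> snd (tc a b) \<circ> chart_inv c"

lemma open_WI: "open WI" and smooth_\<iota>: "smooth_on WI \<iota>"
  by (rule S.I_D(4,5)[OF c TM0_atlasI[OF a b]])+

lemma \<iota>_in: "z \<in> WI \<Longrightarrow> \<iota> z \<in> Omc a b"
proof -
  assume "z \<in> WI"
  then obtain Q where "Q \<in> fst c" "Q \<in> fst (tc a b)" "z = snd c Q" by blast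
  then show ?thesis using tc_in[OF a b, of Q] by (simp add: S.I_inv[OF c])
qed

lemma smooth_d\<iota>: "smooth_on WI (\<lambda>z. FD \<iota> z w)"
  by (rule smooth_on_FD[OF smooth_\<iota>])

end

lemma tangent_space_IB_vec: "c \<in> IB \<Longrightarrow> P \<in> fst c \<Longrightarrow> tangent_vec IB c P w \<in> tangent_space IB P"
  by (rule S.Sub.tangent_vec_in)

lemma smooth_metric:
  assumes c: "c \<in> IB"
  shows "smooth_on (chart_image c) (\<lambda>z. indicatrix_metric (chart_inv c z)
    (tangent_vec IB c (chart_inv c z) w) (tangent_vec IB c (chart_inv c z) w'))"
proof (rule smooth_on_IB_chart[OF c])
  fix a b assume ab: "a \<in> A1" "b \<in> A2"
  interpret C: spray_coords "Omc a b" "Lc a b" "Bc a b" by (rule spray_coords[OF ab])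
  show "smooth_on (WI a b c) (\<lambda>z. C.G (\<iota> a b c z) (FD (\<iota> a b c) z w) (FD (\<iota> a b c) z w'))"
    by (intro C.smooth_on_G open_WI smooth_\<iota> \<iota>_in smooth_d\<iota> ab c)
  fix Q assume Q: "Q \<in> fst c" "Q \<in> fst (tc a b)"
  show "C.G (\<iota> a b c (snd c Q)) (FD (\<iota> a b c) (snd c Q) w) (FD (\<iota> a b c) (snd c Q) w') =
      indicatrix_metric (chart_inv c (snd c Q))
        (tangent_vec IB c (chart_inv c (snd c Q)) w) (tangent_vec IB c (chart_inv c (snd c Q)) w')"
    using metric_eq[OF ab c Q, of "tangent_vec IB c Q w" "tangent_vec IB c Q w'"]
    by (simp add: S.I_inv[OF c Q(1)] tangent_space_IB_vec[OF c Q(1)] S.Sub.tangent_vec_self[OF c Q(1)])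
qed

lemma eta_tangent_vec:
  assumes "a \<in> A1" "b \<in> A2" "c \<in> IB" "Q \<in> fst c" "Q \<in> fst (tc a b)"
  shows "eta (chart_inv c (snd c Q)) (tangent_vec IB c (chart_inv c (snd c Q)) w) =
    spray_coords.th (Lc a b) (\<iota> a b c (snd c Q)) (FD (\<iota> a b c) (snd c Q) w)"
  using eta_eq[OF assms tangent_space_IB_vec[OF assms(3,4)], of w]
  by (simp add: S.I_inv[OF assms(3,4)] S.Sub.tangent_vec_self[OF assms(3,4)])

lemma smooth_eta:
  assumes c: "c \<in> IB"
  shows "smooth_on (chart_image c) (\<lambda>z. eta (chart_inv c z) (tangent_vec IB c (chart_inv c z) w))"
proof (rule smooth_on_IB_chart[OF c])
  fix a b assume ab: "a \<in> A1" "b \<in> A2"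
  interpret C: spray_coords "Omc a b" "Lc a b" "Bc a b" by (rule spray_coords[OF ab])
  show "smooth_on (WI a b c) (\<lambda>z. C.th (\<iota> a b c z) (FD (\<iota> a b c) z w))"
    by (intro C.smooth_on_th open_WI smooth_\<iota> \<iota>_in smooth_d\<iota> ab c)
qed (rule eta_tangent_vec[OF _ _ c, symmetric])

lemma smooth_xi:
  assumes c: "c \<in> IB"
  shows "smooth_on (chart_image c) (\<lambda>z. (xi (chart_inv c z) :: ('a, 'n, 'b, 'm, 'e) ib_tvec) c)"
proof (rule smooth_on_IB_incl[OF c])
  fix a b assume ab: "a \<in> A1" "b \<in> A2"
  interpret C: spray_coords "Omc a b" "Lc a b" "Bc a b" by (rule spray_coords[OF ab])
  show "smooth_on (WI a b c) (\<lambda>z. C.xi (\<iota> a b c z))"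
    by (intro C.smooth_on_xi open_WI smooth_\<iota> \<iota>_in ab c)
  fix Q assume Q: "Q \<in> fst c" "Q \<in> fst (tc a b)"
  show "S.incl c (tc a b) Q ((xi (chart_inv c (snd c Q)) :: ('a, 'n, 'b, 'm, 'e) ib_tvec) c) =
      C.xi (\<iota> a b c (snd c Q))"
    using xi_eq(2)[OF ab c Q] by (simp add: S.I_inv[OF c Q(1)])
qed

lemma smooth_phi:
  assumes c: "c \<in> IB"
  shows "smooth_on (chart_image c) (\<lambda>z. (phi (chart_inv c z) (tangent_vec IB c (chart_inv c z) w)) c)"
proof (rule smooth_on_IB_incl[OF c])
  fix a b assume ab: "a \<in> A1" "b \<in> A2"
  interpret C: spray_coords "Omc a b" "Lc a b" "Bc a b" by (rule spray_coords[OF ab])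
  show "smooth_on (WI a b c) (\<lambda>z. C.phi (\<iota> a b c z) (FD (\<iota> a b c) z w))"
    by (intro C.smooth_on_phi open_WI smooth_\<iota> \<iota>_in smooth_d\<iota> ab c)
  fix Q assume Q: "Q \<in> fst c" "Q \<in> fst (tc a b)"
  show "S.incl c (tc a b) Q (phi (chart_inv c (snd c Q)) (tangent_vec IB c (chart_inv c (snd c Q)) w) c) =
      C.phi (\<iota> a b c (snd c Q)) (FD (\<iota> a b c) (snd c Q) w)"
    using phi_eq(2)[OF ab c Q tangent_space_IB_vec[OF c Q(1)], of w]
    by (simp add: S.I_inv[OF c Q(1)] S.Sub.tangent_vec_self[OF c Q(1)])
qed

text \<open>In the chart \<open>c\<close> the form is \<open>th\<close> along the inclusion. Its
  derivative has a Hessian term and a term with the second derivative of the inclusion; the latter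
  is symmetric and drops out of the difference, and \<open>omega\<close> evaluates the former.
  \<open>G_phi\<close> finally replaces \<open>J\<close> by \<open>phi\<close>, as \<open>X\<close>
  is tangent to the indicatrix.\<close>

lemma ext_deriv_eta:
  assumes P: "P \<in> carrier_of IB" and X: "X \<in> tangent_space IB P" and Y: "Y \<in> tangent_space IB P"
  shows "ext_deriv IB eta P X Y = indicatrix_metric P X (phi P Y)"
proof -
  define c where "c = chart_at IB P"
  have c: "c \<in> IB" "P \<in> fst c" using chart_at[OF P] by (simp_all add: c_def)
  have "P \<in> TM0" using P S.cover by (simp add: indicatrix_def)
  from TM0_charts[OF this] obtain a b where ab: "a \<in> A1" "b \<in> A2" "P \<in> fst (tc a b)" by blast
  interpret C: spray_coords "Omc a b" "Lc a b" "Bc a b" by (rule spray_coords[OF ab(1,2)])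
  let ?i = "\<iota> a b c" and ?W = "WI a b c" and ?z = "snd c P"
  have z: "?z \<in> ?W" using c ab by blast
  note i = smooth_\<iota>[OF ab(1,2) c(1)] and W = open_WI[OF ab(1,2) c(1)]
  define z where "z = ?i ?z"
  have zO: "z \<in> Omc a b" unfolding z_def by (rule \<iota>_in[OF ab(1,2) c(1) z])
  define e where "e w \<zeta> = eta (chart_inv c \<zeta>) (tangent_vec IB c (chart_inv c \<zeta>) w)" for w \<zeta>
  have e: "FD (e v) ?z w = C.H z (0, fst (FD ?i ?z v)) (FD ?i ?z w) +
      FD (Lc a b) z (0, fst (FD (\<lambda>z. FD ?i z v) ?z w))" for v w
  proof -
    have "((\<lambda>\<zeta>. (0, fst (FD ?i \<zeta> v))) has_derivative (\<lambda>h. (0, fst (FD (\<lambda>z. FD ?i z v) ?z h)))) (at ?z)"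
      by (intro has_derivative_Pair has_derivative_const has_derivative_fst
          smooth_on_has_derivative[OF smooth_on_FD[OF i] z])
    from FD_compose_apply_has_derivative[OF C.open_Om C.smooth_L smooth_on_has_derivative[OF i z] zO[unfolded z_def] this]
    have "((\<lambda>\<zeta>. FD (Lc a b) (?i \<zeta>) (0, fst (FD ?i \<zeta> v))) has_derivative
        (\<lambda>h. C.H z (0, fst (FD ?i ?z v)) (FD ?i ?z h) +
          FD (Lc a b) z (0, fst (FD (\<lambda>z. FD ?i z v) ?z h)))) (at ?z)"
      unfolding C.H_def z_def .
    then have "(e v has_derivative
        (\<lambda>h. C.H z (0, fst (FD ?i ?z v)) (FD ?i ?z h) +
          FD (Lc a b) z (0, fst (FD (\<lambda>z. FD ?i z v) ?z h)))) (at ?z)"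
    proof (rule has_derivative_transform_within_open[OF _ W z])
      fix \<zeta> assume "\<zeta> \<in> ?W"
      then obtain Q where "Q \<in> fst c" "Q \<in> fst (tc a b)" "\<zeta> = snd c Q" by blast
      then show "FD (Lc a b) (?i \<zeta>) (0, fst (FD ?i \<zeta> v)) = e v \<zeta>"
        unfolding e_def using eta_tangent_vec[OF ab(1,2) c(1), of Q v] by (simp add: C.th_def)
    qed
    from FD_eqI[OF this] show ?thesis by simp
  qed
  have z_eq: "z = snd (tc a b) P" by (simp add: z_def S.I_inv[OF c])
  have "ext_deriv IB eta P X Y = FD (e (X c)) ?z (Y c) - FD (e (Y c)) ?z (X c)"
    unfolding ext_deriv_def Let_def c_def[symmetric] e_def ..
  also have "\<dots> = C.H z (0, fst (FD ?i ?z (X c))) (FD ?i ?z (Y c)) -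
      C.H z (0, fst (FD ?i ?z (Y c))) (FD ?i ?z (X c))"
    unfolding e using FD_symmetric[OF W i z, of "X c" "Y c"] by simp
  also have "\<dots> = C.G z (FD ?i ?z (X c)) (C.J z (FD ?i ?z (Y c)))"
    by (rule C.omega[OF zO])
  also have "\<dots> = C.G z (FD ?i ?z (X c)) (C.phi z (FD ?i ?z (Y c)))"
    using C.G_phi[OF zO, of "FD ?i ?z (X c)" "FD ?i ?z (Y c)"] dL_incl[OF ab(1,2) c ab(3), of "X c"]
      zP(2)[OF ab(1,2) c ab(3)] by (simp add: z_eq)
  also have "\<dots> = indicatrix_metric P X (phi P Y)"
    using metric_eq[OF ab(1,2) c ab(3) X phi_eq(1)[OF ab(1,2) c ab(3) Y]] phi_eq(2)[OF ab(1,2) c ab(3) Y]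
    by (simp add: z_eq)
  finally show ?thesis .
qed

lemma contact_structure_IB: "contact_structure IB phi eta xi indicatrix_metric"
proof -
  have metric: "riemannian_metric IB indicatrix_metric"
    unfolding riemannian_metric_def
  proof (intro conjI ballI allI impI)
    fix P X Y assume P: "P \<in> carrier_of IB" and X: "X \<in> tangent_space IB P" and Y: "Y \<in> tangent_space IB P"
    obtain a b c where abc: "a \<in> A1" "b \<in> A2" "c \<in> IB" "P \<in> fst c" "P \<in> fst (tc a b)"
      using P by (rule chart_IB)
    interpret C: spray_coords "Omc a b" "Lc a b" "Bc a b" by (rule spray_coords[OF abc(1,2)])
    note m = metric_eq[OF abc] and z = zP(1)[OF abc]
    show "indicatrix_metric P X Y = indicatrix_metric P Y X"
      using C.G_sym[OF z] by (simp add: m X Y)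
    show "indicatrix_metric P (\<lambda>c. r *\<^sub>R X c + s *\<^sub>R Y c) Z = r * indicatrix_metric P X Z + s * indicatrix_metric P Y Z"
      if Z: "Z \<in> tangent_space IB P" for Z r s
      unfolding m[OF S.Sub.tangent_space_lincomb[OF X Y] Z] m[OF X Z] m[OF Y Z]
        linear_add[OF linear_iP[OF abc]] linear_cmul[OF linear_iP[OF abc]]
        linear_add[OF C.linear_G1[OF z]] linear_cmul[OF C.linear_G1[OF z]] by simp
    show "indicatrix_metric P X X > 0" if "X \<noteq> (\<lambda>_. 0)"
    proof -
      have "S.incl c (tc a b) P (X c) \<noteq> 0"
        using IB_eqI[OF abc X S.Sub.tangent_space_0] that linear_0[OF linear_iP[OF abc]] by auto
      from C.G_pos[OF z this] show ?thesis by (simp add: m X)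
    qed
  qed (rule smooth_metric)
  have eta1: "smooth_one_form IB eta"
    unfolding smooth_one_form_def
  proof (intro conjI ballI allI)
    fix P X Y r s assume P: "P \<in> carrier_of IB" and X: "X \<in> tangent_space IB P" and Y: "Y \<in> tangent_space IB P"
    obtain a b c where abc: "a \<in> A1" "b \<in> A2" "c \<in> IB" "P \<in> fst c" "P \<in> fst (tc a b)"
      using P by (rule chart_IB)
    interpret C: spray_coords "Omc a b" "Lc a b" "Bc a b" by (rule spray_coords[OF abc(1,2)])
    note m = eta_eq[OF abc] and z = zP(1)[OF abc]
    show "eta P (\<lambda>c. r *\<^sub>R X c + s *\<^sub>R Y c) = r * eta P X + s * eta P Y"
      unfolding m[OF S.Sub.tangent_space_lincomb[OF X Y]] m[OF X] m[OF Y]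
        linear_add[OF linear_iP[OF abc]] linear_cmul[OF linear_iP[OF abc]]
        linear_add[OF C.linear_th[OF z]] linear_cmul[OF C.linear_th[OF z]] by simp
  qed (rule smooth_eta)
  have xi1: "smooth_vector_field IB xi"
    unfolding smooth_vector_field_def
  proof (intro conjI ballI)
    fix P assume "P \<in> carrier_of IB"
    then obtain a b c where abc: "a \<in> A1" "b \<in> A2" "c \<in> IB" "P \<in> fst c" "P \<in> fst (tc a b)"
      by (rule chart_IB)
    show "xi P \<in> tangent_space IB P" by (rule xi_eq(1)[OF abc])
  qed (rule smooth_xi)
  have phi1: "smooth_tensor_1_1 IB phi"
    unfolding smooth_tensor_1_1_def
  proof (intro conjI ballI allI)
    fix P X assume P: "P \<in> carrier_of IB" and X: "X \<in> tangent_space IB P"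
    obtain a b c where abc: "a \<in> A1" "b \<in> A2" "c \<in> IB" "P \<in> fst c" "P \<in> fst (tc a b)"
      using P by (rule chart_IB)
    interpret C: spray_coords "Omc a b" "Lc a b" "Bc a b" by (rule spray_coords[OF abc(1,2)])
    note m = phi_eq[OF abc] and z = zP(1)[OF abc]
    show "phi P X \<in> tangent_space IB P" by (rule m(1)[OF X])
    fix Y r s assume Y: "Y \<in> tangent_space IB P"
    show "phi P (\<lambda>c. r *\<^sub>R X c + s *\<^sub>R Y c) = (\<lambda>c. r *\<^sub>R phi P X c + s *\<^sub>R phi P Y c)"
    proof (rule IB_eqI[OF abc m(1)[OF S.Sub.tangent_space_lincomb[OF X Y]]
          S.Sub.tangent_space_lincomb[OF m(1)[OF X] m(1)[OF Y]]])
      show "S.incl c (tc a b) P (phi P (\<lambda>c. r *\<^sub>R X c + s *\<^sub>R Y c) c) =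
          S.incl c (tc a b) P (r *\<^sub>R phi P X c + s *\<^sub>R phi P Y c)"
        unfolding m(2)[OF S.Sub.tangent_space_lincomb[OF X Y]]
          linear_add[OF linear_iP[OF abc]] linear_cmul[OF linear_iP[OF abc]] m(2)[OF X] m(2)[OF Y]
          linear_add[OF C.linear_phi[OF z]] linear_cmul[OF C.linear_phi[OF z]] by simp
    qed
  qed (rule smooth_phi)
  \<comment> \<open>Subtraction is truncated, so positivity of \<open>CARD('n)\<close> is what makes
    the dimension odd.\<close>
  have "odd DIM('e)" unfolding dim using zero_less_card_finite[where 'a = 'n] by simp
  moreover have "smooth_manifold IB" by (rule S.smooth_manifold_I[OF smooth_manifold_TM0])
  moreover have "phi P (xi P) = (\<lambda>_. 0 :: 'e) \<and> eta P (xi P :: ('a, 'n, 'b, 'm, 'e) ib_tvec) = 1 \<and>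
      (\<forall>X\<in>tangent_space IB P. eta P (phi P X) = 0 \<and>
         phi P (phi P X) = (\<lambda>c. - X c + eta P X *\<^sub>R xi P c) \<and>
         (\<forall>Y\<in>tangent_space IB P.
            indicatrix_metric P (phi P X) (phi P Y) = indicatrix_metric P X Y - eta P X * eta P Y \<and>
            ext_deriv IB eta P X Y = indicatrix_metric P X (phi P Y)))"
    if P: "P \<in> carrier_of IB" for P
  proof -
    obtain a b c where abc: "a \<in> A1" "b \<in> A2" "c \<in> IB" "P \<in> fst c" "P \<in> fst (tc a b)"
      using P by (rule chart_IB)
    note cp = contact_pointwise[OF abc]
    show ?thesis
      using cp(1,2)[OF S.Sub.tangent_space_0 S.Sub.tangent_space_0] cp(3,4,5) ext_deriv_eta[OF P] by blast
  qed
  ultimately show ?thesis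
    unfolding contact_structure_def using metric eta1 xi1 phi1 by blast
qed

end

text \<open>The first conjunct states that the indicatrix is an embedded submanifold of dimension
  \<open>DIM('e)\<close>. Without it the contact identities, which range over the carrier of the
  atlas, could speak of fewer points.\<close>

theorem theorem3p1:
  fixes A1 :: "('a, real^'n) atlas" and F1 :: "'a \<times> ('a, real^'n) tvec \<Rightarrow> real"
    and A2 :: "('b, real^'m) atlas" and F2 :: "'b \<times> ('b, real^'m) tvec \<Rightarrow> real"
    and f :: "'a \<Rightarrow> real"
  assumes "finsler_manifold A1 F1"
    and "finsler_manifold A2 F2"
    and "smooth_function A1 f"
    and "\<forall>p\<in>carrier_of A1. f p \<noteq> 0"
    and "DIM('e::euclidean_space) = 2 * (CARD('n) + CARD('m)) - 1"
  shows "carrier_of (warped_product.indicatrix_atlas A1 F1 A2 F2 f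
            :: (('a, 'n, 'b, 'm) tm_point, 'e) atlas)
           = warped_product.indicatrix A1 F1 A2 F2 f \<and>
         contact_structure
           (warped_product.indicatrix_atlas A1 F1 A2 F2 f
            :: (('a, 'n, 'b, 'm) tm_point, 'e) atlas)
           (warped_product.phi A1 F1 A2 F2 f)
           (warped_product.eta A1 F1 A2 F2 f)
           (warped_product.xi A1 F1 A2 F2 f)
           (warped_product.indicatrix_metric A1 F1 A2 F2 f)"
proof -
  interpret indicatrix_bundle A1 F1 A2 F2 f "TYPE('e)"
    by unfold_locales (use assms in auto)
  show ?thesis using S.cover contact_structure_IB by blast
qed

end
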